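(* Let $R=\frac{r}{n}$ be given, with integers $0<r<n$, and let $i$ run through an infinite increasing set of positive integers. Then an infinite series of MDS codes with rate $R$ and ratio of distance to length approaching $1-R$ is constructed as follows. For each $i$ put $n_i=i\,n$ and $r_i=i\,r$, construct a Fourier $n_i\times n_i$ matrix over a finite field (such a field of characteristic $p$ exists for every prime $p$ not dividing $n_i$), and take $r_i$ rows of this matrix in arithmetic sequence with arithmetic difference $k$ satisfying $\gcd(n_i,k)=1$ (for instance $r_i$ consecutive rows). The code generated by these rows is an MDS $(n_i,r_i)$ code. Its rate is $\frac{r_i}{n_i}=\frac{r}{n}=R$, its distance is $d_i=n_i-r_i+1$, and $$\frac{d_i}{n_i}=\frac{n_i-r_i+1}{n_i}=1-R+\frac{1}{n_i},$$ so that $\frac{d_i}{n_i}\to 1-R$ as $i\to\infty$. The codes have efficient encoding and decoding algorithms of complexity $\max\{O(N\log N),O(t^2)\}$, where $N=n_i$ is the length and $t=\lfloor\frac{d_i-1}{2}\rfloor$ is the error-correcting capability of the code.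
   Context: An $(N,m)$ linear code over a field $\mathbb{F}$ is an $m$-dimensional linear subspace of $\mathbb{F}^N$; its rate is $\frac{m}{N}$. Its (minimum) distance is the minimum Hamming weight of a nonzero codeword. The code is MDS (maximum distance separable) if its distance equals $N-m+1$. A primitive $N$-th root of unity in $\mathbb{F}$ is an element $\omega$ with $\omega^N=1$ and $\omega^j\ne 1$ for $1\le j<N$. The Fourier $N\times N$ matrix over $\mathbb{F}$ determined by such an $\omega$ has $(a,b)$ entry $\omega^{ab}$ for $0\le a,b\le N-1$; denote its rows by $e_0,\ldots,e_{N-1}$. Taking $m$ rows in arithmetic sequence with difference $k$ means taking $e_s,e_{s+k},\ldots,e_{s+(m-1)k}$ for some $s$, with indices modulo $N$. The finite field used may depend on $i$. *)

theory Defs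
  imports
    Complex_Main
    "HOL-Computational_Algebra.Primes"
    "HOL-Algebra.Algebra"
    "Jordan_Normal_Form.Missing_VectorSpace"
begin

section \<open>Linear codes\<close>

text \<open>Words of length $N$ over \<open>F\<close> are the extensional functions
  \<open>{..<N} \<rightarrow>\<^sub>E carrier F\<close>, i.e. the vector space \<open>ring.func_space F {..<N}\<close>.\<close>

abbreviation word_space :: "('a, 'b) ring_scheme \<Rightarrow> nat \<Rightarrow> ('a, nat \<Rightarrow> 'a) module" where
  "word_space F N \<equiv> ring.func_space F {..<N}"

definition code_dim :: "('a, 'b) ring_scheme \<Rightarrow> nat \<Rightarrow> (nat \<Rightarrow> 'a) set \<Rightarrow> nat" where
  "code_dim F N C = vectorspace.dim F ((word_space F N)\<lparr>carrier := C\<rparr>)"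

definition linear_code ::
    "('a, 'b) ring_scheme \<Rightarrow> nat \<Rightarrow> nat \<Rightarrow> (nat \<Rightarrow> 'a) set \<Rightarrow> bool" where
  "linear_code F N m C \<longleftrightarrow> subspace F C (word_space F N) \<and> code_dim F N C = m"

definition code_rate :: "('a, 'b) ring_scheme \<Rightarrow> nat \<Rightarrow> (nat \<Rightarrow> 'a) set \<Rightarrow> real" where
  "code_rate F N C = real (code_dim F N C) / real N"

definition hamming_weight :: "('a, 'b) ring_scheme \<Rightarrow> nat \<Rightarrow> (nat \<Rightarrow> 'a) \<Rightarrow> nat" where
  "hamming_weight F N x = card {b. b < N \<and> x b \<noteq> \<zero>\<^bsub>F\<^esub>}"

definition hamming_dist :: "nat \<Rightarrow> (nat \<Rightarrow> 'a) \<Rightarrow> (nat \<Rightarrow> 'a) \<Rightarrow> nat" where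
  "hamming_dist N x y = card {b. b < N \<and> x b \<noteq> y b}"

definition code_distance :: "('a, 'b) ring_scheme \<Rightarrow> nat \<Rightarrow> (nat \<Rightarrow> 'a) set \<Rightarrow> nat" where
  "code_distance F N C =
     (LEAST w. \<exists>x\<in>C. x \<noteq> \<zero>\<^bsub>word_space F N\<^esub> \<and> w = hamming_weight F N x)"

definition mds_code ::
    "('a, 'b) ring_scheme \<Rightarrow> nat \<Rightarrow> nat \<Rightarrow> (nat \<Rightarrow> 'a) set \<Rightarrow> bool" where
  "mds_code F N m C \<longleftrightarrow> linear_code F N m C \<and> code_distance F N C = N - m + 1"


section \<open>Fourier matrices and the codes generated by their rows\<close>

definition ring_char :: "('a, 'b) ring_scheme \<Rightarrow> nat" where
  "ring_char F =
     (if \<exists>q>0. [(q::nat)] \<cdot>\<^bsub>F\<^esub> \<one>\<^bsub>F\<^esub> = \<zero>\<^bsub>F\<^esub>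
      then (LEAST q::nat. 0 < q \<and> [q] \<cdot>\<^bsub>F\<^esub> \<one>\<^bsub>F\<^esub> = \<zero>\<^bsub>F\<^esub>) else 0)"

definition primitive_root_of_unity :: "('a, 'b) ring_scheme \<Rightarrow> nat \<Rightarrow> 'a \<Rightarrow> bool" where
  "primitive_root_of_unity F N \<omega> \<longleftrightarrow>
     \<omega> \<in> carrier F \<and> \<omega> [^]\<^bsub>F\<^esub> N = \<one>\<^bsub>F\<^esub> \<and>
     (\<forall>j. 1 \<le> j \<and> j < N \<longrightarrow> \<omega> [^]\<^bsub>F\<^esub> j \<noteq> \<one>\<^bsub>F\<^esub>)"

definition fourier_matrix :: "('a, 'b) ring_scheme \<Rightarrow> 'a \<Rightarrow> nat \<Rightarrow> nat \<Rightarrow> 'a" where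
  "fourier_matrix F \<omega> a b = \<omega> [^]\<^bsub>F\<^esub> (a * b)"

definition fourier_row :: "('a, 'b) ring_scheme \<Rightarrow> nat \<Rightarrow> 'a \<Rightarrow> nat \<Rightarrow> nat \<Rightarrow> 'a" where
  "fourier_row F N \<omega> a = (\<lambda>b\<in>{..<N}. fourier_matrix F \<omega> a b)"

text \<open>The rows $e_s, e_{s+k}, \ldots, e_{s+(m-1)k}$, indices modulo $N$.\<close>

definition arith_row ::
    "('a, 'b) ring_scheme \<Rightarrow> nat \<Rightarrow> 'a \<Rightarrow> nat \<Rightarrow> nat \<Rightarrow> nat \<Rightarrow> nat \<Rightarrow> 'a" where
  "arith_row F N \<omega> s k j = fourier_row F N \<omega> ((s + j * k) mod N)"

definition fourier_code ::
    "('a, 'b) ring_scheme \<Rightarrow> nat \<Rightarrow> nat \<Rightarrow> 'a \<Rightarrow> nat \<Rightarrow> nat \<Rightarrow> (nat \<Rightarrow> 'a) set" where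
  "fourier_code F N m \<omega> s k =
     LinearCombinations.module.span F (word_space F N) (arith_row F N \<omega> s k ` {..<m})"

text \<open>The codeword of a message \<open>u\<close>: the row vector \<open>u\<close> times the generator matrix
  formed by the chosen rows.\<close>

definition fourier_encode ::
    "('a, 'b) ring_scheme \<Rightarrow> nat \<Rightarrow> nat \<Rightarrow> 'a \<Rightarrow> nat \<Rightarrow> nat \<Rightarrow> (nat \<Rightarrow> 'a) \<Rightarrow> nat \<Rightarrow> 'a" where
  "fourier_encode F N m \<omega> s k u =
     (\<Oplus>\<^bsub>word_space F N\<^esub> j\<in>{..<m}. u j \<odot>\<^bsub>word_space F N\<^esub> arith_row F N \<omega> s k j)"

definition fourier_data :: "('a, 'b) ring_scheme \<Rightarrow> nat \<Rightarrow> 'a \<Rightarrow> nat \<Rightarrow> bool" where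
  "fourier_data F N \<omega> k \<longleftrightarrow>
     field F \<and> finite (carrier F) \<and> primitive_root_of_unity F N \<omega> \<and> gcd N k = 1"


section \<open>Algorithms and their cost\<close>

text \<open>Algorithms are programs for a unit-cost algebraic random access machine.
  The memory consists of index registers holding natural numbers and of arrays of
  field elements addressed by index expressions. A program is a finite text containing
  no field elements other than 0 and 1, so the same program can be run over any field and for
  any code length. Field elements affect the control flow and the index registers only
  through tests for zero. Every operation, memory access, assignment and test costs one unit.\<close>

datatype iexp =
    IConst nat
  | IReg nat
  | IAdd iexp iexp
  | ISub iexp iexp

datatype fexp =
    FZero
  | FOne
  | FCell nat iexp
  | FAdd fexp fexp
  | FSub fexp fexp
  | FMul fexp fexp
  | FInv fexp

datatype test =
    ILess iexp iexp
  | FIsZero fexp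

datatype prog =
    Skip
  | ISet nat iexp
  | FSet nat iexp fexp
  | Seq prog prog
  | Cond test prog prog
  | While test prog

type_synonym 'a memory = "(nat \<Rightarrow> nat) \<times> (nat \<Rightarrow> nat \<Rightarrow> 'a)"

fun ival :: "iexp \<Rightarrow> 'a memory \<Rightarrow> nat" where
  "ival (IConst c) \<sigma> = c"
| "ival (IReg x) \<sigma> = fst \<sigma> x"
| "ival (IAdd e1 e2) \<sigma> = ival e1 \<sigma> + ival e2 \<sigma>"
| "ival (ISub e1 e2) \<sigma> = ival e1 \<sigma> - ival e2 \<sigma>"

text \<open>Inversion is totalised by letting the inverse of 0 be 0.\<close>

fun fval :: "('a, 'b) ring_scheme \<Rightarrow> fexp \<Rightarrow> 'a memory \<Rightarrow> 'a" where
  "fval F FZero \<sigma> = \<zero>\<^bsub>F\<^esub>"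
| "fval F FOne \<sigma> = \<one>\<^bsub>F\<^esub>"
| "fval F (FCell A e) \<sigma> = snd \<sigma> A (ival e \<sigma>)"
| "fval F (FAdd e1 e2) \<sigma> = fval F e1 \<sigma> \<oplus>\<^bsub>F\<^esub> fval F e2 \<sigma>"
| "fval F (FSub e1 e2) \<sigma> = fval F e1 \<sigma> \<ominus>\<^bsub>F\<^esub> fval F e2 \<sigma>"
| "fval F (FMul e1 e2) \<sigma> = fval F e1 \<sigma> \<otimes>\<^bsub>F\<^esub> fval F e2 \<sigma>"
| "fval F (FInv e) \<sigma> =
     (if fval F e \<sigma> = \<zero>\<^bsub>F\<^esub> then \<zero>\<^bsub>F\<^esub> else inv\<^bsub>F\<^esub> (fval F e \<sigma>))"

fun tval :: "('a, 'b) ring_scheme \<Rightarrow> test \<Rightarrow> 'a memory \<Rightarrow> bool" where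
  "tval F (ILess e1 e2) \<sigma> \<longleftrightarrow> ival e1 \<sigma> < ival e2 \<sigma>"
| "tval F (FIsZero e) \<sigma> \<longleftrightarrow> fval F e \<sigma> = \<zero>\<^bsub>F\<^esub>"

fun icost :: "iexp \<Rightarrow> nat" where
  "icost (IConst c) = 1"
| "icost (IReg x) = 1"
| "icost (IAdd e1 e2) = icost e1 + icost e2 + 1"
| "icost (ISub e1 e2) = icost e1 + icost e2 + 1"

fun fcost :: "fexp \<Rightarrow> nat" where
  "fcost FZero = 1"
| "fcost FOne = 1"
| "fcost (FCell A e) = icost e + 1"
| "fcost (FAdd e1 e2) = fcost e1 + fcost e2 + 1"
| "fcost (FSub e1 e2) = fcost e1 + fcost e2 + 1"
| "fcost (FMul e1 e2) = fcost e1 + fcost e2 + 1"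
| "fcost (FInv e) = fcost e + 1"

fun tcost :: "test \<Rightarrow> nat" where
  "tcost (ILess e1 e2) = icost e1 + icost e2 + 1"
| "tcost (FIsZero e) = fcost e + 1"

text \<open>\<open>exec F c \<sigma> \<tau> \<sigma>'\<close>: over the field \<open>F\<close>, program \<open>c\<close> started in \<open>\<sigma>\<close> halts in
  \<open>\<sigma>'\<close> at total cost \<open>\<tau>\<close>.\<close>

inductive exec ::
    "('a, 'b) ring_scheme \<Rightarrow> prog \<Rightarrow> 'a memory \<Rightarrow> nat \<Rightarrow> 'a memory \<Rightarrow> bool" for F where
  Skip: "exec F Skip \<sigma> 1 \<sigma>"
| ISet: "exec F (ISet x e) \<sigma> (icost e + 1) ((fst \<sigma>)(x := ival e \<sigma>), snd \<sigma>)"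
| FSet: "exec F (FSet A e v) \<sigma> (icost e + fcost v + 1)
           (fst \<sigma>, (snd \<sigma>)(A := (snd \<sigma> A)(ival e \<sigma> := fval F v \<sigma>)))"
| Seq: "exec F c1 \<sigma> \<tau>1 \<sigma>' \<Longrightarrow> exec F c2 \<sigma>' \<tau>2 \<sigma>'' \<Longrightarrow> exec F (Seq c1 c2) \<sigma> (\<tau>1 + \<tau>2) \<sigma>''"
| CondTrue: "tval F t \<sigma> \<Longrightarrow> exec F c1 \<sigma> \<tau> \<sigma>' \<Longrightarrow> exec F (Cond t c1 c2) \<sigma> (tcost t + \<tau>) \<sigma>'"
| CondFalse: "\<not> tval F t \<sigma> \<Longrightarrow> exec F c2 \<sigma> \<tau> \<sigma>' \<Longrightarrow> exec F (Cond t c1 c2) \<sigma> (tcost t + \<tau>) \<sigma>'"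
| WhileFalse: "\<not> tval F t \<sigma> \<Longrightarrow> exec F (While t c) \<sigma> (tcost t) \<sigma>"
| WhileTrue: "tval F t \<sigma> \<Longrightarrow> exec F c \<sigma> \<tau>1 \<sigma>' \<Longrightarrow> exec F (While t c) \<sigma>' \<tau>2 \<sigma>'' \<Longrightarrow>
    exec F (While t c) \<sigma> (tcost t + \<tau>1 + \<tau>2) \<sigma>''"

text \<open>Input convention: registers 0 to 3 hold $N$, $m$, $s \bmod N$ and $k \bmod N$, array 0
  holds \<open>\<omega>\<close> in cell 0, and array 1 holds the input word \<open>x\<close> of length \<open>l\<close>;
  everything else is 0. The output is read from array 2.\<close>

definition load ::
    "('a, 'b) ring_scheme \<Rightarrow> nat \<Rightarrow> nat \<Rightarrow> 'a \<Rightarrow> nat \<Rightarrow> nat \<Rightarrow> nat \<Rightarrow> (nat \<Rightarrow> 'a) \<Rightarrow> 'a memory" where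
  "load F N m \<omega> s k l x =
     ((\<lambda>_. 0)(0 := N, 1 := m, 2 := s mod N, 3 := k mod N),
      (\<lambda>_ _. \<zero>\<^bsub>F\<^esub>)(0 := (\<lambda>_. \<zero>\<^bsub>F\<^esub>)(0 := \<omega>),
                 1 := (\<lambda>j. if j < l then x j else \<zero>\<^bsub>F\<^esub>)))"

definition encodes_within ::
    "('a, 'b) ring_scheme \<Rightarrow> nat \<Rightarrow> nat \<Rightarrow> 'a \<Rightarrow> nat \<Rightarrow> nat \<Rightarrow> prog \<Rightarrow> real \<Rightarrow> bool" where
  "encodes_within F N m \<omega> s k enc T \<longleftrightarrow>
     (\<forall>u \<in> {..<m} \<rightarrow>\<^sub>E carrier F. \<exists>\<tau> \<sigma>.
        exec F enc (load F N m \<omega> s k m u) \<tau> \<sigma> \<and> real \<tau> \<le> T \<and>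
        (\<forall>b<N. snd \<sigma> 2 b = fourier_encode F N m \<omega> s k u b))"

text \<open>A decoder correcting \<open>t\<close> errors halts within the time bound on every received word \<open>y\<close>,
  and recovers the message whenever \<open>y\<close> differs from its codeword in at most \<open>t\<close> positions.\<close>

definition decodes_within ::
    "('a, 'b) ring_scheme \<Rightarrow> nat \<Rightarrow> nat \<Rightarrow> 'a \<Rightarrow> nat \<Rightarrow> nat \<Rightarrow> nat \<Rightarrow> prog \<Rightarrow> real \<Rightarrow> bool" where
  "decodes_within F N m \<omega> s k t dec T \<longleftrightarrow>
     (\<forall>y \<in> {..<N} \<rightarrow>\<^sub>E carrier F. \<exists>\<tau> \<sigma>.
        exec F dec (load F N m \<omega> s k N y) \<tau> \<sigma> \<and> real \<tau> \<le> T \<and>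
        (\<forall>u \<in> {..<m} \<rightarrow>\<^sub>E carrier F.
           hamming_dist N y (fourier_encode F N m \<omega> s k u) \<le> t \<longrightarrow> (\<forall>j<m. snd \<sigma> 2 j = u j)))"

end

theory Submission
  imports Defs "HOL-Number_Theory.Residues"
begin

text \<open>Up to the nonzero factors $\omega^{sb}$, the codeword of a message $u$ lists the values of the polynomial
  $u(X) = \sum_j u_j X^j$ of degree below $m$ at the points $\omega^{kb}$, which are distinct because
  $\gcd(N, k) = 1$. So the code is a generalised Reed--Solomon code, and the bound on the number of
  roots of a polynomial yields dimension and distance. Since the rate is fixed, the error-correcting
  capability grows linearly with the length, so $O(t^2)$ allows $O(N^2)$ operations: encoding evaluates
  naively, and decoding interpolates a bivariate polynomial $h_0(X) + h_1(X) Y$ through the received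
  points with Koetter's algorithm and recovers $u = -h_0 / h_1$ by long division.

  A primitive $N$-th root of unity in an algebraic closure of the prime field is built one prime
  factor at a time, by taking $l$-th roots and nontrivial roots of $1 + X + \cdots + X^{l-1}$; it
  generates a finite subfield, which is copied to the natural numbers.\<close>

section \<open>Cost-bounded total correctness\<close>

text \<open>Both programs and the constant are chosen before \<open>i\<close>, the field and
  \<open>\<omega>\<close>, and programs contain no field constants except 0 and 1. So evaluation
  points and column factors are regenerated from \<open>\<omega>\<close> as running powers. Solving
  the linear system for the interpolation polynomial by elimination would be cubic in the length;
  Koetter's method inserts one point at a time with linear work, which keeps decoding quadratic. The
  decoder must also halt in time on every received word, correctable or not. Hence its loops have
  lengths fixed by N and m, the interpolation invariant mentions no message, and the division is
  proved correct only for those u that satisfy h0 + u * h1 = 0. For such u the polynomial h1 is an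
  error locator: interpolation gives v_c * h0(x_c) + y_c * h1(x_c) = 0, so h1 vanishes wherever y_c
  differs from v_c * u(x_c).\<close>

definition runs_within ::
    "('a, 'b) ring_scheme \<Rightarrow> prog \<Rightarrow> 'a memory \<Rightarrow> nat \<Rightarrow> ('a memory \<Rightarrow> bool) \<Rightarrow> bool" where
  "runs_within F c \<sigma> T Q \<longleftrightarrow> (\<exists>\<tau> \<sigma>'. exec F c \<sigma> \<tau> \<sigma>' \<and> \<tau> \<le> T \<and> Q \<sigma>')"

lemma runs_within_mono:
  assumes "runs_within F c \<sigma> T Q" and "T \<le> T'" and "\<And>\<sigma>'. Q \<sigma>' \<Longrightarrow> Q' \<sigma>'"
  shows "runs_within F c \<sigma> T' Q'"
  using assms unfolding runs_within_def by (meson le_trans)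

lemma runs_within_le:
  "runs_within F c \<sigma> T Q \<Longrightarrow> T \<le> T' \<Longrightarrow> runs_within F c \<sigma> T' Q"
  by (erule runs_within_mono)

lemma runs_within_Seq:
  assumes "runs_within F c1 \<sigma> T1 P" and "\<And>\<sigma>'. P \<sigma>' \<Longrightarrow> runs_within F c2 \<sigma>' T2 Q"
  shows "runs_within F (Seq c1 c2) \<sigma> (T1 + T2) Q"
  using assms unfolding runs_within_def by (meson exec.Seq add_mono)

fun straight :: "prog \<Rightarrow> bool" where
  "straight (Seq c1 c2) \<longleftrightarrow> straight c1 \<and> straight c2"
| "straight (Cond t c1 c2) \<longleftrightarrow> straight c1 \<and> straight c2"
| "straight (While t c) \<longleftrightarrow> False"
| "straight _ \<longleftrightarrow> True"

text \<open>For loop-free code the final memory is a function of the initial one, so the simplifier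
  can compute it and only loops need invariants. The \<open>While\<close> clause is a dummy that
  \<open>straight\<close> excludes.\<close>

fun run :: "('a, 'b) ring_scheme \<Rightarrow> prog \<Rightarrow> 'a memory \<Rightarrow> 'a memory" where
  "run F Skip \<sigma> = \<sigma>"
| "run F (ISet x e) \<sigma> = ((fst \<sigma>)(x := ival e \<sigma>), snd \<sigma>)"
| "run F (FSet A e v) \<sigma> = (fst \<sigma>, (snd \<sigma>)(A := (snd \<sigma> A)(ival e \<sigma> := fval F v \<sigma>)))"
| "run F (Seq c1 c2) \<sigma> = run F c2 (run F c1 \<sigma>)"
| "run F (Cond t c1 c2) \<sigma> = (if tval F t \<sigma> then run F c1 \<sigma> else run F c2 \<sigma>)"
| "run F (While t c) \<sigma> = \<sigma>"

text \<open>A conditional is charged for both branches, which makes the bound independent of the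
  memory.\<close>

fun cost_bound :: "prog \<Rightarrow> nat" where
  "cost_bound Skip = 1"
| "cost_bound (ISet x e) = icost e + 1"
| "cost_bound (FSet A e v) = icost e + fcost v + 1"
| "cost_bound (Seq c1 c2) = cost_bound c1 + cost_bound c2"
| "cost_bound (Cond t c1 c2) = tcost t + cost_bound c1 + cost_bound c2"
| "cost_bound (While t c) = 0"

lemma straight_exec: "straight c \<Longrightarrow> \<exists>\<tau>\<le>cost_bound c. exec F c \<sigma> \<tau> (run F c \<sigma>)"
proof (induction c arbitrary: \<sigma>)
  case Skip
  then show ?case using exec.Skip[of F \<sigma>] by auto
next
  case (ISet x e)
  then show ?case using exec.ISet[of F x e \<sigma>] by auto
next
  case (FSet A e v)
  then show ?case using exec.FSet[of F A e v \<sigma>] by auto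
next
  case (Seq c1 c2)
  obtain \<tau>1 where 1: "\<tau>1 \<le> cost_bound c1" "exec F c1 \<sigma> \<tau>1 (run F c1 \<sigma>)"
    using Seq.IH(1)[of \<sigma>] Seq.prems by auto
  obtain \<tau>2 where 2: "\<tau>2 \<le> cost_bound c2" "exec F c2 (run F c1 \<sigma>) \<tau>2 (run F c2 (run F c1 \<sigma>))"
    using Seq.IH(2)[of "run F c1 \<sigma>"] Seq.prems by auto
  show ?case using exec.Seq[OF 1(2) 2(2)] 1(1) 2(1) by (intro exI[of _ "\<tau>1 + \<tau>2"]) auto
next
  case (Cond t c1 c2)
  obtain \<tau>1 where 1: "\<tau>1 \<le> cost_bound c1" "exec F c1 \<sigma> \<tau>1 (run F c1 \<sigma>)"
    using Cond.IH(1)[of \<sigma>] Cond.prems by auto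
  obtain \<tau>2 where 2: "\<tau>2 \<le> cost_bound c2" "exec F c2 \<sigma> \<tau>2 (run F c2 \<sigma>)"
    using Cond.IH(2)[of \<sigma>] Cond.prems by auto
  show ?case
  proof (cases "tval F t \<sigma>")
    case True
    then show ?thesis using exec.CondTrue[OF True 1(2), of c2] 1(1)
      by (intro exI[of _ "tcost t + \<tau>1"]) auto
  next
    case False
    then show ?thesis using exec.CondFalse[OF False 2(2), of c1] 2(1)
      by (intro exI[of _ "tcost t + \<tau>2"]) auto
  qed
qed simp

lemma runs_within_straight:
  assumes "straight c" and "Q (run F c \<sigma>)"
  shows "runs_within F c \<sigma> (cost_bound c) Q"
  using straight_exec[OF assms(1)] assms(2) unfolding runs_within_def by blast

definition For :: "nat \<Rightarrow> iexp \<Rightarrow> prog \<Rightarrow> prog" where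
  "For x e c = Seq (ISet x (IConst 0))
     (While (ILess (IReg x) e) (Seq c (ISet x (IAdd (IReg x) (IConst 1)))))"

text \<open>The invariant \<open>J j\<close> is taken at the loop head, so the body has to yield
  \<open>J (Suc j)\<close> after the counter has been incremented. Besides \<open>B\<close>, a round
  pays \<open>icost e + 2\<close> for the test and 4 for the increment; the initial assignment and
  the last, failing test account for \<open>icost e + 4\<close>.\<close>

lemma runs_within_For:
  assumes init: "J 0 ((fst \<sigma>)(x := 0), snd \<sigma>)"
    and bound: "\<And>j \<rho>. J j \<rho> \<Longrightarrow> fst \<rho> x = j \<and> ival e \<rho> = n"
    and body: "\<And>j \<rho>. \<lbrakk>j < n; J j \<rho>\<rbrakk> \<Longrightarrow>
      runs_within F c \<rho> B (\<lambda>\<rho>'. J (Suc j) ((fst \<rho>')(x := Suc (fst \<rho>' x)), snd \<rho>'))"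
  shows "runs_within F (For x e c) \<sigma> (icost e + 4 + n * (B + icost e + 6)) (J n)"
proof -
  let ?t = "ILess (IReg x) e"
  let ?c = "Seq c (ISet x (IAdd (IReg x) (IConst 1)))"
  have loop: "runs_within F (While ?t ?c) \<rho> (icost e + 2 + d * (B + icost e + 6)) (J n)"
    if "J j \<rho>" and "j + d = n" for d j \<rho>
    using that
  proof (induction d arbitrary: j \<rho>)
    case 0
    then have "\<not> tval F ?t \<rho>" using bound[of j \<rho>] by simp
    then show ?case using exec.WhileFalse[of F ?t \<rho> ?c] 0 unfolding runs_within_def
      by (intro exI[of _ "tcost ?t"] exI[of _ \<rho>]) auto
  next
    case (Suc d)
    then have t: "tval F ?t \<rho>" using bound[of j \<rho>] by simp
    obtain \<tau> \<rho>' where c: "exec F c \<rho> \<tau> \<rho>'" "\<tau> \<le> B"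
      and J: "J (Suc j) ((fst \<rho>')(x := Suc (fst \<rho>' x)), snd \<rho>')"
      using body[of j \<rho>] Suc.prems unfolding runs_within_def by auto
    have "exec F (ISet x (IAdd (IReg x) (IConst 1))) \<rho>' 4
        ((fst \<rho>')(x := Suc (fst \<rho>' x)), snd \<rho>')"
      using exec.ISet[of F x "IAdd (IReg x) (IConst 1)" \<rho>'] by (simp add: numeral_eq_Suc)
    then have c': "exec F ?c \<rho> (\<tau> + 4) ((fst \<rho>')(x := Suc (fst \<rho>' x)), snd \<rho>')"
      using exec.Seq[OF c(1)] by blast
    obtain \<tau>2 \<rho>2 where w: "exec F (While ?t ?c) ((fst \<rho>')(x := Suc (fst \<rho>' x)), snd \<rho>') \<tau>2 \<rho>2"
      "\<tau>2 \<le> icost e + 2 + d * (B + icost e + 6)" "J n \<rho>2"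
      using Suc.IH[OF J] Suc.prems unfolding runs_within_def by auto
    show ?case unfolding runs_within_def
      using exec.WhileTrue[OF t c' w(1)] w(2,3) c(2)
      by (intro exI[of _ "tcost ?t + (\<tau> + 4) + \<tau>2"] exI[of _ \<rho>2]) simp
  qed
  have "runs_within F (ISet x (IConst 0)) \<sigma> 2 (J 0)"
    using runs_within_straight[of "ISet x (IConst 0)" "J 0" F \<sigma>] init by (simp add: numeral_eq_Suc)
  then have "runs_within F (For x e c) \<sigma> (2 + (icost e + 2 + n * (B + icost e + 6))) (J n)"
    unfolding For_def by (rule runs_within_Seq) (rule loop, auto)
  then show ?thesis by (rule runs_within_mono) auto
qed

section \<open>Encoder and decoder programs\<close>

text \<open>Index registers: 4 and 5 are loop counters, 6 and 7 hold the degrees \<open>a\<close> and \<open>e\<close> of the decoder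
  invariant. Cell 0 of the arrays 3 to 8 holds $\omega^s$, $\omega^k$, their \<open>b\<close>-th powers, the running
  power of the evaluation point and an accumulator. The arrays 10 to 13 hold the coefficients of the
  polynomials \<open>g0\<close>, \<open>g1\<close>, \<open>h0\<close>, \<open>h1\<close> shifted by one cell: coefficient \<open>l\<close> is in cell \<open>l + 1\<close> and cell 0
  stays zero, so that an index truncated to 0 by subtraction reads a zero coefficient. Arrays 20
  and 21 hold the two discrepancies, and 22 to 27 the coefficients of the update
  $g' = c_{22} g + c_{23} h + c_{24} X g$, $h' = c_{25} h + c_{26} g + c_{27} X h$.\<close>

abbreviation scal :: "nat \<Rightarrow> fexp" where
  "scal A \<equiv> FCell A (IConst 0)"

abbreviation put :: "nat \<Rightarrow> fexp \<Rightarrow> prog" where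
  "put A v \<equiv> FSet A (IConst 0) v"

text \<open>Repeated multiplication is cheap enough, because the exponents \<open>s mod N\<close>
  and \<open>k mod N\<close> are below the code length.\<close>

definition power_prog :: "nat \<Rightarrow> nat \<Rightarrow> prog" where
  "power_prog A x = Seq (put A FOne) (For 5 (IReg x) (put A (FMul (scal A) (scal 0))))"

definition encode_inner :: prog where
  "encode_inner = For 5 (IReg 1)
     (Seq (put 8 (FAdd (scal 8) (FMul (FCell 1 (IReg 5)) (scal 7))))
          (put 7 (FMul (scal 7) (scal 6))))"

definition encode_body :: prog where
  "encode_body =
     Seq (Seq (put 7 FOne) (put 8 FZero))
    (Seq encode_inner
    (Seq (FSet 2 (IReg 4) (FMul (scal 5) (scal 8)))
    (Seq (put 5 (FMul (scal 5) (scal 3))) (put 6 (FMul (scal 6) (scal 4))))))"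

definition init_powers :: prog where
  "init_powers = Seq (power_prog 3 2) (Seq (power_prog 4 3) (Seq (put 5 FOne) (put 6 FOne)))"

definition encode_prog :: prog where
  "encode_prog = Seq init_powers (For 4 (IReg 0) encode_body)"

definition discrepancy_prog :: "nat \<Rightarrow> nat \<Rightarrow> nat \<Rightarrow> prog" where
  "discrepancy_prog D A B =
     put D (FAdd (scal D) (FMul (FAdd (FMul (scal 5) (FCell A (IAdd (IReg 5) (IConst 1))))
        (FMul (FCell 1 (IReg 4)) (FCell B (IAdd (IReg 5) (IConst 1))))) (scal 7)))"

definition decode_eval :: prog where
  "decode_eval =
     Seq (Seq (put 7 FOne) (Seq (put 20 FZero) (put 21 FZero)))
      (For 5 (IAdd (IReg 0) (IConst 1))
        (Seq (discrepancy_prog 20 10 11)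
        (Seq (discrepancy_prog 21 12 13) (put 7 (FMul (scal 7) (scal 6))))))"

definition pivot_g :: prog where
  "pivot_g =
     Seq (put 22 (FSub FZero (scal 6))) (Seq (put 23 FZero) (Seq (put 24 FOne)
    (Seq (put 25 FOne) (Seq (put 26 (FSub FZero (FMul (scal 21) (FInv (scal 20)))))
    (Seq (put 27 FZero) (ISet 6 (IAdd (IReg 6) (IConst 1))))))))"

definition pivot_h :: prog where
  "pivot_h =
     Seq (put 22 FOne) (Seq (put 23 (FSub FZero (FMul (scal 20) (FInv (scal 21)))))
    (Seq (put 24 FZero) (Seq (put 25 (FSub FZero (scal 6))) (Seq (put 26 FZero)
    (Seq (put 27 FOne) (ISet 7 (IAdd (IReg 7) (IConst 1))))))))"

text \<open>The pivot is multiplied by X - x_b, and the other polynomial is corrected by a multiple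
  of it. When both discrepancies are nonzero, the polynomial with the smaller leading term must be
  the pivot: the weighted degrees are a and e + m - 1, and the tie a = e + m - 1 goes to Q_g, hence
  the test a < e + m.\<close>

definition decode_pivot :: prog where
  "decode_pivot =
     Cond (FIsZero (scal 21)) pivot_g
      (Cond (FIsZero (scal 20)) pivot_h
        (Cond (ILess (IReg 6) (IAdd (IReg 7) (IReg 1))) pivot_g pivot_h))"

text \<open>The cells are updated from the top down, so that the cell below the current one still holds
  its old value.\<close>

abbreviation cur :: iexp where
  "cur \<equiv> ISub (IAdd (IReg 0) (IConst 1)) (IReg 5)"

text \<open>Each new coefficient depends on the old values of both arrays, so the new entry of
  \<open>A\<close> waits in array 28 until \<open>B\<close> has been written.\<close>

definition update_pair :: "nat \<Rightarrow> nat \<Rightarrow> prog" where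
  "update_pair A B =
     Seq (put 28 (FAdd (FAdd (FMul (scal 22) (FCell A cur)) (FMul (scal 23) (FCell B cur)))
            (FMul (scal 24) (FCell A (ISub cur (IConst 1))))))
    (Seq (FSet B cur (FAdd (FAdd (FMul (scal 25) (FCell B cur)) (FMul (scal 26) (FCell A cur)))
            (FMul (scal 27) (FCell B (ISub cur (IConst 1))))))
         (FSet A cur (scal 28)))"

definition decode_update :: prog where
  "decode_update = For 5 (IAdd (IReg 0) (IConst 1)) (Seq (update_pair 10 12) (update_pair 11 13))"

definition decode_body :: prog where
  "decode_body = Seq decode_eval (Seq decode_pivot (Seq decode_update
     (Seq (put 5 (FMul (scal 5) (scal 3))) (put 6 (FMul (scal 6) (scal 4))))))"

abbreviation tgt :: iexp where
  "tgt \<equiv> ISub (ISub (IReg 1) (IConst 1)) (IReg 4)"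

text \<open>Array 2 is both output and partial quotient: coefficients not yet determined are still
  zero and contribute nothing to the sum. Indices that would be negative are truncated to cell 0 of
  array 13, which is zero.\<close>

definition divide_inner :: prog where
  "divide_inner = For 5 (IReg 1)
     (put 8 (FAdd (scal 8) (FMul (FCell 2 (IReg 5))
        (FCell 13 (ISub (IAdd (IAdd (IReg 7) tgt) (IConst 1)) (IReg 5))))))"

definition divide_body :: prog where
  "divide_body =
     Seq (put 8 (FCell 12 (IAdd (IAdd (IReg 7) tgt) (IConst 1))))
    (Seq divide_inner
         (FSet 2 tgt (FMul (FSub FZero (scal 8)) (FInv (FCell 13 (IAdd (IReg 7) (IConst 1)))))))"

definition decode_prog :: prog where
  "decode_prog =
     Seq init_powers
    (Seq (Seq (FSet 10 (IConst 1) FOne) (FSet 13 (IConst 1) FOne))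
    (Seq (For 4 (IReg 0) decode_body)
         (For 4 (IReg 1) divide_body)))"

definition frame :: "nat set \<Rightarrow> nat set \<Rightarrow> 'a memory \<Rightarrow> 'a memory \<Rightarrow> bool" where
  "frame rs A \<mu> \<mu>' \<longleftrightarrow>
     (\<forall>x. x \<notin> rs \<longrightarrow> fst \<mu>' x = fst \<mu> x) \<and> (\<forall>B. B \<notin> A \<longrightarrow> snd \<mu>' B = snd \<mu> B)"

context ring
begin

definition poly_sum :: "nat \<Rightarrow> (nat \<Rightarrow> 'a) \<Rightarrow> 'a \<Rightarrow> 'a" where
  "poly_sum n p x = (\<Oplus>l\<in>{..<n}. p l \<otimes> x [^] l)"

text \<open>This plays two roles: multiplication by X, and the content of an array that stores
  coefficient l in cell l + 1 above a zero cell 0.\<close>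

abbreviation xmul :: "(nat \<Rightarrow> 'a) \<Rightarrow> nat \<Rightarrow> 'a" where
  "xmul \<equiv> case_nat \<zero>"

lemma poly_sum_0 [simp]: "poly_sum 0 p x = \<zero>"
  by (simp add: poly_sum_def)

lemma poly_sum_Suc:
  assumes "\<And>l. l \<le> n \<Longrightarrow> p l \<in> carrier R" and "x \<in> carrier R"
  shows "poly_sum (Suc n) p x = poly_sum n p x \<oplus> p n \<otimes> x [^] n"
proof -
  have "poly_sum (Suc n) p x = p n \<otimes> x [^] n \<oplus> poly_sum n p x"
    unfolding poly_sum_def lessThan_Suc using assms
    by (subst finsum_insert) (auto intro!: Pi_I)
  also have "\<dots> = poly_sum n p x \<oplus> p n \<otimes> x [^] n"
    unfolding poly_sum_def using assms by (intro a_comm finsum_closed) (auto intro!: Pi_I)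
  finally show ?thesis .
qed

lemma poly_sum_closed [simp]:
  assumes "\<And>l. l < n \<Longrightarrow> p l \<in> carrier R" and "x \<in> carrier R"
  shows "poly_sum n p x \<in> carrier R"
  unfolding poly_sum_def using assms by (intro finsum_closed) (auto intro!: Pi_I)

end

section \<open>Executions of the encoder\<close>

context field
begin

lemma power_prog_runs:
  assumes "snd \<mu> 0 0 \<in> carrier R" and "A \<noteq> 0" and "x \<noteq> 5"
  shows "runs_within R (power_prog A x) \<mu> (8 + 14 * fst \<mu> x)
    (\<lambda>\<mu>'. frame {5} {A} \<mu> \<mu>' \<and> snd \<mu>' A 0 = snd \<mu> 0 0 [^] fst \<mu> x)"
proof -
  let ?\<mu> = "(fst \<mu>, (snd \<mu>)(A := (snd \<mu> A)(0 := \<one>)))"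
  let ?J = "\<lambda>j \<rho>. frame {5} {A} \<mu> \<rho> \<and> fst \<rho> 5 = j \<and> snd \<rho> A 0 = snd \<mu> 0 0 [^] j"
  have 1: "runs_within R (put A FOne) \<mu> (cost_bound (put A FOne)) (\<lambda>\<rho>. \<rho> = ?\<mu>)"
    by (rule runs_within_straight) auto
  have 2: "runs_within R (For 5 (IReg x) (put A (FMul (scal A) (scal 0)))) ?\<mu>
      (icost (IReg x) + 4 + fst \<mu> x * (cost_bound (put A (FMul (scal A) (scal 0))) + icost (IReg x) + 6))
      (?J (fst \<mu> x))"
  proof (rule runs_within_For)
    show "?J 0 ((fst ?\<mu>)(5 := 0), snd ?\<mu>)" by (simp add: frame_def)
  next
    fix j \<rho> assume "?J j \<rho>"
    then show "fst \<rho> 5 = j \<and> ival (IReg x) \<rho> = fst \<mu> x" using assms by (simp add: frame_def)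
  next
    fix j \<rho> assume J: "?J j \<rho>"
    show "runs_within R (put A (FMul (scal A) (scal 0))) \<rho> (cost_bound (put A (FMul (scal A) (scal 0))))
      (\<lambda>\<rho>'. ?J (Suc j) ((fst \<rho>')(5 := Suc (fst \<rho>' 5)), snd \<rho>'))"
      by (rule runs_within_straight) (use J assms in \<open>auto simp: frame_def nat_pow_Suc\<close>)
  qed
  show ?thesis unfolding power_prog_def
    by (rule runs_within_mono[OF runs_within_Seq[OF 1]], erule ssubst, rule 2) auto
qed

lemma init_powers_runs:
  assumes "snd \<mu> 0 0 \<in> carrier R"
  shows "runs_within R init_powers \<mu> (22 + 14 * (fst \<mu> 2 + fst \<mu> 3))
    (\<lambda>\<mu>'. frame {5} {3, 4, 5, 6} \<mu> \<mu>' \<and> snd \<mu>' 3 0 = snd \<mu> 0 0 [^] fst \<mu> 2 \<and>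
       snd \<mu>' 4 0 = snd \<mu> 0 0 [^] fst \<mu> 3 \<and> snd \<mu>' 5 0 = \<one> \<and> snd \<mu>' 6 0 = \<one>)"
proof -
  let ?P = "\<lambda>\<mu>'. frame {5} {3} \<mu> \<mu>' \<and> snd \<mu>' 3 0 = snd \<mu> 0 0 [^] fst \<mu> 2"
  let ?Q = "\<lambda>\<mu>'. frame {5} {3,4} \<mu> \<mu>' \<and> snd \<mu>' 3 0 = snd \<mu> 0 0 [^] fst \<mu> 2 \<and>
     snd \<mu>' 4 0 = snd \<mu> 0 0 [^] fst \<mu> 3"
  have 1: "runs_within R (power_prog 3 2) \<mu> (8 + 14 * fst \<mu> 2) ?P"
    using power_prog_runs[of \<mu> 3 2] assms by auto
  have 2: "runs_within R (power_prog 4 3) \<rho> (8 + 14 * fst \<mu> 3) ?Q" if "?P \<rho>" for \<rho>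
    using that power_prog_runs[of \<rho> 4 3] assms
    by (auto simp: frame_def elim!: runs_within_mono)
  have 3: "runs_within R (Seq (put 5 FOne) (put 6 FOne)) \<rho> (cost_bound (Seq (put 5 FOne) (put 6 FOne)))
    (\<lambda>\<mu>'. frame {5} {3, 4, 5, 6} \<mu> \<mu>' \<and> snd \<mu>' 3 0 = snd \<mu> 0 0 [^] fst \<mu> 2 \<and>
       snd \<mu>' 4 0 = snd \<mu> 0 0 [^] fst \<mu> 3 \<and> snd \<mu>' 5 0 = \<one> \<and> snd \<mu>' 6 0 = \<one>)" if "?Q \<rho>" for \<rho>
    by (rule runs_within_straight) (use that in \<open>auto simp: frame_def\<close>)
  show ?thesis unfolding init_powers_def
    by (rule runs_within_mono[OF runs_within_Seq[OF 1 runs_within_Seq[OF 2 3]]]) auto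
qed

lemma encode_inner_runs:
  assumes u: "\<And>j. snd \<mu> 1 j \<in> carrier R" and x: "snd \<mu> 6 0 \<in> carrier R"
    and "snd \<mu> 7 0 = \<one>" and "snd \<mu> 8 0 = \<zero>"
  shows "runs_within R encode_inner \<mu> (5 + 24 * fst \<mu> 1)
    (\<lambda>\<mu>'. frame {5} {7, 8} \<mu> \<mu>' \<and> snd \<mu>' 8 0 = poly_sum (fst \<mu> 1) (snd \<mu> 1) (snd \<mu> 6 0))"
proof -
  let ?J = "\<lambda>j \<rho>. frame {5} {7, 8} \<mu> \<rho> \<and> fst \<rho> 5 = j \<and> snd \<rho> 7 0 = snd \<mu> 6 0 [^] j \<and>
     snd \<rho> 8 0 = poly_sum j (snd \<mu> 1) (snd \<mu> 6 0)"
  let ?c = "Seq (put 8 (FAdd (scal 8) (FMul (FCell 1 (IReg 5)) (scal 7))))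
          (put 7 (FMul (scal 7) (scal 6)))"
  have "runs_within R (For 5 (IReg 1) ?c) \<mu>
      (icost (IReg 1) + 4 + fst \<mu> 1 * (cost_bound ?c + icost (IReg 1) + 6)) (?J (fst \<mu> 1))"
  proof (rule runs_within_For)
    show "?J 0 ((fst \<mu>)(5 := 0), snd \<mu>)" using assms by (simp add: frame_def)
  next
    fix j \<rho> assume "?J j \<rho>"
    then show "fst \<rho> 5 = j \<and> ival (IReg 1) \<rho> = fst \<mu> 1" using assms by (simp add: frame_def)
  next
    fix j \<rho> assume J: "?J j \<rho>"
    show "runs_within R ?c \<rho> (cost_bound ?c)
      (\<lambda>\<rho>'. ?J (Suc j) ((fst \<rho>')(5 := Suc (fst \<rho>' 5)), snd \<rho>'))"
      by (rule runs_within_straight) (use J assms in \<open>auto simp: frame_def nat_pow_Suc poly_sum_Suc\<close>)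
  qed
  then show ?thesis unfolding encode_inner_def by (rule runs_within_mono) auto
qed

lemma encode_body_runs:
  assumes u: "\<And>j. snd \<mu> 1 j \<in> carrier R" and "snd \<mu> 3 0 \<in> carrier R"
    and "snd \<mu> 4 0 \<in> carrier R" and "snd \<mu> 5 0 \<in> carrier R" and "snd \<mu> 6 0 \<in> carrier R"
  shows "runs_within R encode_body \<mu> (32 + 24 * fst \<mu> 1)
    (\<lambda>\<mu>'. frame {5} {2, 5, 6, 7, 8} \<mu> \<mu>' \<and>
       snd \<mu>' 2 = (snd \<mu> 2)(fst \<mu> 4 := snd \<mu> 5 0 \<otimes> poly_sum (fst \<mu> 1) (snd \<mu> 1) (snd \<mu> 6 0)) \<and>
       snd \<mu>' 5 0 = snd \<mu> 5 0 \<otimes> snd \<mu> 3 0 \<and> snd \<mu>' 6 0 = snd \<mu> 6 0 \<otimes> snd \<mu> 4 0)"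
proof -
  let ?P = "\<lambda>\<rho>. frame {} {7, 8} \<mu> \<rho> \<and> snd \<rho> 7 0 = \<one> \<and> snd \<rho> 8 0 = \<zero>"
  let ?Q = "\<lambda>\<rho>. frame {5} {7, 8} \<mu> \<rho> \<and>
    snd \<rho> 8 0 = poly_sum (fst \<mu> 1) (snd \<mu> 1) (snd \<mu> 6 0)"
  let ?c1 = "Seq (put 7 FOne) (put 8 FZero)"
  let ?c3 = "Seq (FSet 2 (IReg 4) (FMul (scal 5) (scal 8)))
    (Seq (put 5 (FMul (scal 5) (scal 3))) (put 6 (FMul (scal 6) (scal 4))))"
  have 1: "runs_within R ?c1 \<mu> (cost_bound ?c1) ?P"
    by (rule runs_within_straight) (auto simp: frame_def)
  have 2: "runs_within R encode_inner \<rho> (5 + 24 * fst \<mu> 1) ?Q" if "?P \<rho>" for \<rho>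
    by (rule runs_within_mono[OF encode_inner_runs])
      (use that assms in \<open>auto simp: frame_def\<close>)
  have 3: "runs_within R ?c3 \<rho> (cost_bound ?c3) (\<lambda>\<mu>'. frame {5} {2, 5, 6, 7, 8} \<mu> \<mu>' \<and>
       snd \<mu>' 2 = (snd \<mu> 2)(fst \<mu> 4 := snd \<mu> 5 0 \<otimes> poly_sum (fst \<mu> 1) (snd \<mu> 1) (snd \<mu> 6 0)) \<and>
       snd \<mu>' 5 0 = snd \<mu> 5 0 \<otimes> snd \<mu> 3 0 \<and> snd \<mu>' 6 0 = snd \<mu> 6 0 \<otimes> snd \<mu> 4 0)" if "?Q \<rho>" for \<rho>
    by (rule runs_within_straight) (use that in \<open>auto simp: frame_def\<close>)
  show ?thesis unfolding encode_body_def
    by (rule runs_within_mono[OF runs_within_Seq[OF 1 runs_within_Seq[OF 2 3]]]) auto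
qed

lemma encode_prog_runs:
  assumes w: "snd \<mu> 0 0 \<in> carrier R" and u: "\<And>j. snd \<mu> 1 j \<in> carrier R"
  shows "runs_within R encode_prog \<mu>
    (27 + 14 * (fst \<mu> 2 + fst \<mu> 3) + fst \<mu> 0 * (39 + 24 * fst \<mu> 1))
    (\<lambda>\<mu>'. \<forall>b<fst \<mu> 0. snd \<mu>' 2 b = (snd \<mu> 0 0 [^] fst \<mu> 2) [^] b \<otimes>
       poly_sum (fst \<mu> 1) (snd \<mu> 1) ((snd \<mu> 0 0 [^] fst \<mu> 3) [^] b))"
proof -
  let ?v = "snd \<mu> 0 0 [^] fst \<mu> 2" and ?x = "snd \<mu> 0 0 [^] fst \<mu> 3"
  let ?P = "\<lambda>\<mu>'. frame {5} {3, 4, 5, 6} \<mu> \<mu>' \<and> snd \<mu>' 3 0 = ?v \<and> snd \<mu>' 4 0 = ?x \<and>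
    snd \<mu>' 5 0 = \<one> \<and> snd \<mu>' 6 0 = \<one>"
  let ?J = "\<lambda>b \<rho>. frame {4, 5} {2, 3, 4, 5, 6, 7, 8} \<mu> \<rho> \<and> fst \<rho> 4 = b \<and>
    snd \<rho> 3 0 = ?v \<and> snd \<rho> 4 0 = ?x \<and> snd \<rho> 5 0 = ?v [^] b \<and> snd \<rho> 6 0 = ?x [^] b \<and>
    (\<forall>c<b. snd \<rho> 2 c = ?v [^] c \<otimes> poly_sum (fst \<mu> 1) (snd \<mu> 1) (?x [^] c))"
  have loop: "runs_within R (For 4 (IReg 0) encode_body) \<nu>
      (icost (IReg 0) + 4 + fst \<mu> 0 * ((32 + 24 * fst \<mu> 1) + icost (IReg 0) + 6)) (?J (fst \<mu> 0))"
    if P: "?P \<nu>" for \<nu>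
  proof (rule runs_within_For)
    show "?J 0 ((fst \<nu>)(4 := 0), snd \<nu>)" using P by (simp add: frame_def)
  next
    fix j \<rho> assume "?J j \<rho>"
    then show "fst \<rho> 4 = j \<and> ival (IReg 0) \<rho> = fst \<mu> 0" by (simp add: frame_def)
  next
    fix j \<rho> assume J: "?J j \<rho>"
    have eq: "snd \<rho> 1 = snd \<mu> 1" "fst \<rho> 1 = fst \<mu> 1" using J by (auto simp: frame_def)
    show "runs_within R encode_body \<rho> (32 + 24 * fst \<mu> 1)
      (\<lambda>\<rho>'. ?J (Suc j) ((fst \<rho>')(4 := Suc (fst \<rho>' 4)), snd \<rho>'))"
      by (rule runs_within_mono[OF encode_body_runs])
        (use J w u eq in \<open>auto simp: frame_def nat_pow_Suc less_Suc_eq\<close>)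
  qed
  show ?thesis unfolding encode_prog_def
    by (rule runs_within_mono[OF runs_within_Seq[OF init_powers_runs[OF w] loop]]) auto
qed

section \<open>Executions of one interpolation round\<close>

definition finv :: "'a \<Rightarrow> 'a" where
  "finv x = (if x = \<zero> then \<zero> else inv x)"

lemma finv_closed [simp]: "x \<in> carrier R \<Longrightarrow> finv x \<in> carrier R"
  using field_Units by (auto simp: finv_def)

lemma finv_right: "x \<in> carrier R \<Longrightarrow> x \<noteq> \<zero> \<Longrightarrow> x \<otimes> finv x = \<one>"
  using field_Units by (auto simp: finv_def)

lemma fval_FInv: "fval R (FInv e) \<mu> = finv (fval R e \<mu>)"
  by (simp add: finv_def)

lemma discrepancy_run:
  "run R (discrepancy_prog D A B) \<mu> = (fst \<mu>, (snd \<mu>)(D := (snd \<mu> D)(0 := snd \<mu> D 0 \<oplus>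
     (snd \<mu> 5 0 \<otimes> snd \<mu> A (Suc (fst \<mu> 5)) \<oplus> snd \<mu> 1 (fst \<mu> 4) \<otimes> snd \<mu> B (Suc (fst \<mu> 5))) \<otimes> snd \<mu> 7 0)))"
  by (simp add: discrepancy_prog_def)

lemma decode_eval_runs:
  assumes g: "snd \<mu> 10 = xmul g0" "snd \<mu> 11 = xmul g1" "snd \<mu> 12 = xmul h0" "snd \<mu> 13 = xmul h1"
    and c: "\<And>l. g0 l \<in> carrier R" "\<And>l. g1 l \<in> carrier R" "\<And>l. h0 l \<in> carrier R" "\<And>l. h1 l \<in> carrier R"
    and v: "snd \<mu> 5 0 = v" "v \<in> carrier R" and y: "snd \<mu> 1 (fst \<mu> 4) = y" "y \<in> carrier R"
    and x: "snd \<mu> 6 0 = x" "x \<in> carrier R"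
  shows "runs_within R decode_eval \<mu> (18 + 62 * (fst \<mu> 0 + 1))
    (\<lambda>\<mu>'. frame {5} {7, 20, 21} \<mu> \<mu>' \<and>
       snd \<mu>' 20 0 = poly_sum (fst \<mu> 0 + 1) (\<lambda>l. v \<otimes> g0 l \<oplus> y \<otimes> g1 l) x \<and>
       snd \<mu>' 21 0 = poly_sum (fst \<mu> 0 + 1) (\<lambda>l. v \<otimes> h0 l \<oplus> y \<otimes> h1 l) x)"
proof -
  let ?N = "fst \<mu> 0 + 1"
  let ?P = "\<lambda>\<rho>. frame {} {7, 20, 21} \<mu> \<rho> \<and> snd \<rho> 7 0 = \<one> \<and> snd \<rho> 20 0 = \<zero> \<and> snd \<rho> 21 0 = \<zero>"
  let ?J = "\<lambda>j \<rho>. frame {5} {7, 20, 21} \<mu> \<rho> \<and> fst \<rho> 5 = j \<and> snd \<rho> 7 0 = x [^] j \<and>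
    snd \<rho> 20 0 = poly_sum j (\<lambda>l. v \<otimes> g0 l \<oplus> y \<otimes> g1 l) x \<and>
    snd \<rho> 21 0 = poly_sum j (\<lambda>l. v \<otimes> h0 l \<oplus> y \<otimes> h1 l) x"
  let ?start = "Seq (put 7 FOne) (Seq (put 20 FZero) (put 21 FZero))"
  let ?c = "Seq (discrepancy_prog 20 10 11)
        (Seq (discrepancy_prog 21 12 13) (put 7 (FMul (scal 7) (scal 6))))"
  let ?e = "IAdd (IReg 0) (IConst 1)"
  have 1: "runs_within R ?start \<mu> (cost_bound ?start) ?P"
    by (rule runs_within_straight) (auto simp: frame_def)
  have 2: "runs_within R (For 5 ?e ?c) \<nu> (icost ?e + 4 + ?N * (cost_bound ?c + icost ?e + 6)) (?J ?N)"
    if P: "?P \<nu>" for \<nu>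
  proof (rule runs_within_For)
    show "?J 0 ((fst \<nu>)(5 := 0), snd \<nu>)" using P by (simp add: frame_def)
  next
    fix j \<rho> assume "?J j \<rho>"
    then show "fst \<rho> 5 = j \<and> ival ?e \<rho> = ?N" by (simp add: frame_def)
  next
    fix j \<rho> assume J: "?J j \<rho>"
    show "runs_within R ?c \<rho> (cost_bound ?c) (\<lambda>\<rho>'. ?J (Suc j) ((fst \<rho>')(5 := Suc (fst \<rho>' 5)), snd \<rho>'))"
      by (rule runs_within_straight)
        (use J assms in \<open>auto simp: frame_def nat_pow_Suc poly_sum_Suc discrepancy_run discrepancy_prog_def\<close>)
  qed
  show ?thesis unfolding decode_eval_def
    by (rule runs_within_mono[OF runs_within_Seq[OF 1 2]]) (auto simp: discrepancy_prog_def)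
qed

lemma update_pair_run:
  assumes "A \<notin> {22, 23, 24, 25, 26, 27, 28}" and "B \<notin> {22, 23, 24, 25, 26, 27, 28}" and "A \<noteq> B"
    and "c = Suc (fst \<mu> 0) - fst \<mu> 5"
  shows "run R (update_pair A B) \<mu> = (fst \<mu>, (snd \<mu>)
    (28 := (snd \<mu> 28)(0 := snd \<mu> 22 0 \<otimes> snd \<mu> A c \<oplus> snd \<mu> 23 0 \<otimes> snd \<mu> B c \<oplus> snd \<mu> 24 0 \<otimes> snd \<mu> A (c - 1)),
     B := (snd \<mu> B)(c := snd \<mu> 25 0 \<otimes> snd \<mu> B c \<oplus> snd \<mu> 26 0 \<otimes> snd \<mu> A c \<oplus> snd \<mu> 27 0 \<otimes> snd \<mu> B (c - 1)),
     A := (snd \<mu> A)(c := snd \<mu> 22 0 \<otimes> snd \<mu> A c \<oplus> snd \<mu> 23 0 \<otimes> snd \<mu> B c \<oplus> snd \<mu> 24 0 \<otimes> snd \<mu> A (c - 1))))"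
  using assms by (auto simp: update_pair_def intro!: ext)

lemma decode_update_runs:
  assumes arr: "snd \<mu> 10 = xmul g0" "snd \<mu> 11 = xmul g1" "snd \<mu> 12 = xmul h0" "snd \<mu> 13 = xmul h1"
    and deg: "\<And>l. fst \<mu> 0 \<le> l \<Longrightarrow> g0 l = \<zero> \<and> g1 l = \<zero> \<and> h0 l = \<zero> \<and> h1 l = \<zero>"
    and c: "\<And>i. i \<in> {22, 23, 24, 25, 26, 27} \<Longrightarrow> snd \<mu> i 0 \<in> carrier R"
  shows "runs_within R decode_update \<mu> (7 + 165 * (fst \<mu> 0 + 1))
    (\<lambda>\<mu>'. frame {5} {10, 11, 12, 13, 28} \<mu> \<mu>' \<and>
       snd \<mu>' 10 = xmul (\<lambda>l. snd \<mu> 22 0 \<otimes> g0 l \<oplus> snd \<mu> 23 0 \<otimes> h0 l \<oplus> snd \<mu> 24 0 \<otimes> xmul g0 l) \<and>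
       snd \<mu>' 11 = xmul (\<lambda>l. snd \<mu> 22 0 \<otimes> g1 l \<oplus> snd \<mu> 23 0 \<otimes> h1 l \<oplus> snd \<mu> 24 0 \<otimes> xmul g1 l) \<and>
       snd \<mu>' 12 = xmul (\<lambda>l. snd \<mu> 25 0 \<otimes> h0 l \<oplus> snd \<mu> 26 0 \<otimes> g0 l \<oplus> snd \<mu> 27 0 \<otimes> xmul h0 l) \<and>
       snd \<mu>' 13 = xmul (\<lambda>l. snd \<mu> 25 0 \<otimes> h1 l \<oplus> snd \<mu> 26 0 \<otimes> g1 l \<oplus> snd \<mu> 27 0 \<otimes> xmul h1 l))"
proof -
  let ?n = "fst \<mu> 0 + 1"
  let ?e = "IAdd (IReg 0) (IConst 1)"
  let ?c = "Seq (update_pair 10 12) (update_pair 11 13)"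
  define comb where "comb = (\<lambda>k A B l. snd \<mu> k 0 \<otimes> snd \<mu> A l \<oplus> snd \<mu> (k + 1) 0 \<otimes> snd \<mu> B l \<oplus>
    snd \<mu> (k + 2) 0 \<otimes> snd \<mu> A (l - 1))"
  \<comment> \<open>After j rounds the cells above N + 1 - j hold new values and all lower ones,
    including the two that the next round reads, still hold the old values.\<close>
  define upto where "upto = (\<lambda>j k A B l. if ?n - j < l \<and> l \<le> ?n then comb k A B l else snd \<mu> A l)"
  let ?J = "\<lambda>j \<rho>. frame {5} {10, 11, 12, 13, 28} \<mu> \<rho> \<and> fst \<rho> 5 = j \<and>
    snd \<rho> 10 = upto j 22 10 12 \<and> snd \<rho> 11 = upto j 22 11 13 \<and>
    snd \<rho> 12 = upto j 25 12 10 \<and> snd \<rho> 13 = upto j 25 13 11"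
  have "runs_within R (For 5 ?e ?c) \<mu> (icost ?e + 4 + ?n * (cost_bound ?c + icost ?e + 6)) (?J ?n)"
  proof (rule runs_within_For)
    show "?J 0 ((fst \<mu>)(5 := 0), snd \<mu>)" by (auto simp: frame_def upto_def fun_eq_iff)
  next
    fix j \<rho> assume "?J j \<rho>"
    then show "fst \<rho> 5 = j \<and> ival ?e \<rho> = ?n" by (simp add: frame_def)
  next
    fix j \<rho> assume j: "j < ?n" and J: "?J j \<rho>"
    have r0: "fst \<rho> 0 = fst \<mu> 0" and r5: "fst \<rho> 5 = j"
      and k: "\<And>i. i \<in> {22, 23, 24, 25, 26, 27} \<Longrightarrow> snd \<rho> i = snd \<mu> i"
      using J by (auto simp: frame_def)
    have step: "(upto j k A B)(Suc (fst \<mu> 0) - j := comb k A B (Suc (fst \<mu> 0) - j)) = upto (Suc j) k A B" for k A B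
      using j by (auto simp: upto_def fun_eq_iff)
    have at: "upto j k A B (Suc (fst \<mu> 0) - j) = snd \<mu> A (Suc (fst \<mu> 0) - j)"
      "upto j k A B (Suc (fst \<mu> 0) - j - 1) = snd \<mu> A (Suc (fst \<mu> 0) - j - 1)" for k A B
      by (auto simp: upto_def)
    have C: "snd \<mu> 22 0 \<otimes> snd \<mu> A l \<oplus> snd \<mu> 23 0 \<otimes> snd \<mu> B l \<oplus> snd \<mu> 24 0 \<otimes> snd \<mu> A (l - 1) = comb 22 A B l"
      "snd \<mu> 25 0 \<otimes> snd \<mu> A l \<oplus> snd \<mu> 26 0 \<otimes> snd \<mu> B l \<oplus> snd \<mu> 27 0 \<otimes> snd \<mu> A (l - 1) = comb 25 A B l"
      for A B l by (auto simp: comb_def)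
    show "runs_within R ?c \<rho> (cost_bound ?c) (\<lambda>\<rho>'. ?J (Suc j) ((fst \<rho>')(5 := Suc (fst \<rho>' 5)), snd \<rho>'))"
    proof (rule runs_within_straight)
      show "straight ?c" by (simp add: update_pair_def)
      have frame: "frame {5} {10, 11, 12, 13, 28} \<mu> ((fst (run R ?c \<rho>))(5 := Suc (fst (run R ?c \<rho>) 5)), snd (run R ?c \<rho>))"
        using J by (simp add: update_pair_run frame_def)
      show "?J (Suc j) ((fst (run R ?c \<rho>))(5 := Suc (fst (run R ?c \<rho>) 5)), snd (run R ?c \<rho>))"
        using J by (intro conjI frame)
          (simp_all only: run.simps update_pair_run[OF _ _ _ refl] r0 r5 k insert_iff simp_thms fst_conv snd_conv
            fun_upd_apply at C num.simps numeral_eq_iff empty_iff if_True if_False flip: step)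
    qed
  qed
  then show ?thesis unfolding decode_update_def
  proof (rule runs_within_mono)
    show "icost ?e + 4 + ?n * (cost_bound ?c + icost ?e + 6) \<le> 7 + 165 * (fst \<mu> 0 + 1)"
      by (simp add: update_pair_def)
  next
    fix \<mu>' assume J: "?J ?n \<mu>'"
    have *: "upto ?n k A B = xmul (\<lambda>l. snd \<mu> k 0 \<otimes> p l \<oplus> snd \<mu> (k + 1) 0 \<otimes> q l \<oplus> snd \<mu> (k + 2) 0 \<otimes> xmul p l)"
      if "snd \<mu> A = xmul p" and "snd \<mu> B = xmul q" and "\<And>l. fst \<mu> 0 \<le> l \<Longrightarrow> p l = \<zero> \<and> q l = \<zero>"
        and "k \<in> {22, 25}" for k A B p q
    proof
      fix l
      show "upto ?n k A B l = xmul (\<lambda>l. snd \<mu> k 0 \<otimes> p l \<oplus> snd \<mu> (k + 1) 0 \<otimes> q l \<oplus> snd \<mu> (k + 2) 0 \<otimes> xmul p l) l"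
      proof (cases "l \<le> ?n")
        case True
        then show ?thesis using that(1,2) by (auto simp: upto_def comb_def split: nat.split)
      next
        \<comment> \<open>Cells above N + 1 are never written. They agree with the claimed
          polynomial because the inputs have degree below N, so that even after multiplication by X
          nothing reaches beyond cell N + 1.\<close>
        case False
        then obtain l' where l': "l = Suc l'" "fst \<mu> 0 < l'" by (cases l) auto
        moreover have "xmul p l' = \<zero>" using l' that(3)[of "l' - 1"] by (cases l') auto
        ultimately show ?thesis using that(1,2,4) that(3)[of l'] c
          by (auto simp: upto_def)
      qed
    qed
    show "frame {5} {10, 11, 12, 13, 28} \<mu> \<mu>' \<and>
       snd \<mu>' 10 = xmul (\<lambda>l. snd \<mu> 22 0 \<otimes> g0 l \<oplus> snd \<mu> 23 0 \<otimes> h0 l \<oplus> snd \<mu> 24 0 \<otimes> xmul g0 l) \<and>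
       snd \<mu>' 11 = xmul (\<lambda>l. snd \<mu> 22 0 \<otimes> g1 l \<oplus> snd \<mu> 23 0 \<otimes> h1 l \<oplus> snd \<mu> 24 0 \<otimes> xmul g1 l) \<and>
       snd \<mu>' 12 = xmul (\<lambda>l. snd \<mu> 25 0 \<otimes> h0 l \<oplus> snd \<mu> 26 0 \<otimes> g0 l \<oplus> snd \<mu> 27 0 \<otimes> xmul h0 l) \<and>
       snd \<mu>' 13 = xmul (\<lambda>l. snd \<mu> 25 0 \<otimes> h1 l \<oplus> snd \<mu> 26 0 \<otimes> g1 l \<oplus> snd \<mu> 27 0 \<otimes> xmul h1 l)"
      using J *[OF arr(1,3), of 22] *[OF arr(2,4), of 22] *[OF arr(3,1), of 25] *[OF arr(4,2), of 25] deg
      by simp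
  qed
qed

end

section \<open>Polynomials as coefficient sequences\<close>

context cring
begin

lemma poly_sum_cong:
  "(\<And>l. l < n \<Longrightarrow> p l = q l) \<Longrightarrow> (\<And>l. l < n \<Longrightarrow> q l \<in> carrier R) \<Longrightarrow> x \<in> carrier R \<Longrightarrow>
   poly_sum n p x = poly_sum n q x"
  unfolding poly_sum_def by (intro finsum_cong') auto

lemma poly_sum_add:
  assumes "\<And>l. p l \<in> carrier R" and "\<And>l. q l \<in> carrier R" and "x \<in> carrier R"
  shows "poly_sum n (\<lambda>l. p l \<oplus> q l) x = poly_sum n p x \<oplus> poly_sum n q x"
proof (induction n)
  case (Suc n)
  then show ?case using assms by (simp add: poly_sum_Suc l_distr a_ac)
qed simp

lemma poly_sum_smult:
  assumes "\<And>l. p l \<in> carrier R" and "c \<in> carrier R" and "x \<in> carrier R"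
  shows "poly_sum n (\<lambda>l. c \<otimes> p l) x = c \<otimes> poly_sum n p x"
proof (induction n)
  case (Suc n)
  then show ?case using assms by (simp add: poly_sum_Suc r_distr m_assoc)
qed (use assms in simp)

lemma xmul_closed [simp]: "(\<And>l. p l \<in> carrier R) \<Longrightarrow> xmul p l \<in> carrier R"
  by (cases l) auto

lemma poly_sum_xmul_Suc:
  assumes "\<And>l. p l \<in> carrier R" and "x \<in> carrier R"
  shows "poly_sum (Suc n) (xmul p) x = x \<otimes> poly_sum n p x"
proof (induction n)
  case 0
  then show ?case using assms by (simp add: poly_sum_Suc)
next
  case (Suc n)
  have "poly_sum (Suc (Suc n)) (xmul p) x = poly_sum (Suc n) (xmul p) x \<oplus> p n \<otimes> x [^] Suc n"
    using assms by (subst poly_sum_Suc) auto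
  also have "\<dots> = x \<otimes> poly_sum (Suc n) p x"
    using assms by (simp add: Suc poly_sum_Suc r_distr nat_pow_Suc m_ac)
  finally show ?case .
qed

lemma poly_sum_extend:
  assumes "\<And>l. p l \<in> carrier R" and "x \<in> carrier R" and "\<And>l. d \<le> l \<Longrightarrow> p l = \<zero>" and "d \<le> n"
  shows "poly_sum n p x = poly_sum d p x"
  using \<open>d \<le> n\<close>
proof (induction n rule: dec_induct)
  case (step n)
  then show ?case using assms by (simp add: poly_sum_Suc)
qed simp

text \<open>The vanishing condition reserves one free position, so that no coefficient is pushed out
  of the first n terms.\<close>

lemma poly_sum_xmul:
  assumes "\<And>l. p l \<in> carrier R" and "x \<in> carrier R" and "\<And>l. n \<le> Suc l \<Longrightarrow> p l = \<zero>"
  shows "poly_sum n (xmul p) x = x \<otimes> poly_sum n p x"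
proof (cases n)
  case 0
  then show ?thesis using assms by simp
next
  case (Suc k)
  then show ?thesis using assms poly_sum_extend[of p x k n] by (simp add: poly_sum_xmul_Suc)
qed

text \<open>The term \<open>xmul q (Suc l - i)\<close> is q_(l-i) for i \<le> l and zero otherwise:
  truncated subtraction lands on the zero that \<open>xmul\<close> puts in front. So these are the
  coefficients of X^i q.\<close>

lemma poly_sum_shift:
  assumes "\<And>l. q l \<in> carrier R" and "x \<in> carrier R" and "\<And>l. n \<le> l + i \<Longrightarrow> q l = \<zero>"
  shows "poly_sum n (\<lambda>l. xmul q (Suc l - i)) x = x [^] i \<otimes> poly_sum n q x"
  using assms(3)
proof (induction i)
  case 0
  then show ?case using assms(1,2) by simp
next
  case (Suc i)
  have eq: "(\<lambda>l. xmul q (Suc l - Suc i)) = xmul (\<lambda>l. xmul q (Suc l - i))"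
    by (auto simp: fun_eq_iff split: nat.split)
  have "xmul q (Suc l - i) = \<zero>" if "n \<le> Suc l" for l
    using that Suc.prems[of "l - i"] by (cases "i \<le> l") (auto simp: Suc_diff_le not_le)
  then have "poly_sum n (\<lambda>l. xmul q (Suc l - Suc i)) x = x \<otimes> poly_sum n (\<lambda>l. xmul q (Suc l - i)) x"
    unfolding eq using assms(1,2) by (intro poly_sum_xmul) auto
  then show ?case using Suc.IH Suc.prems assms(1,2) by (simp add: nat_pow_Suc m_ac)
qed

text \<open>The coefficients of the product u * q, with indices written as the division loop reads
  them. Only the first m entries of u enter, since a message is constrained only there.\<close>

definition conv :: "nat \<Rightarrow> (nat \<Rightarrow> 'a) \<Rightarrow> (nat \<Rightarrow> 'a) \<Rightarrow> nat \<Rightarrow> 'a" where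
  "conv m u q l = (\<Oplus>i\<in>{..<m}. u i \<otimes> xmul q (Suc l - i))"

lemma conv_closed [simp]:
  assumes "\<And>i. i < m \<Longrightarrow> u i \<in> carrier R" and "\<And>l. q l \<in> carrier R"
  shows "conv m u q l \<in> carrier R"
  unfolding conv_def using assms by (intro finsum_closed) (auto intro!: Pi_I)

lemma conv_Suc:
  assumes "\<And>i. i \<le> m \<Longrightarrow> u i \<in> carrier R" and "\<And>l. q l \<in> carrier R"
  shows "conv (Suc m) u q l = conv m u q l \<oplus> u m \<otimes> xmul q (Suc l - m)"
proof -
  have "conv (Suc m) u q l = u m \<otimes> xmul q (Suc l - m) \<oplus> conv m u q l"
    unfolding conv_def lessThan_Suc using assms by (subst finsum_insert) (auto intro!: Pi_I)
  then show ?thesis using assms by (simp add: a_comm)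
qed

lemma conv_eq_0:
  assumes "\<And>i. i < m \<Longrightarrow> u i \<in> carrier R" and "\<And>i. i < m \<Longrightarrow> xmul q (Suc l - i) = \<zero>"
  shows "conv m u q l = \<zero>"
  unfolding conv_def using assms by (intro add.finprod_one_eqI) auto

lemma poly_sum_conv:
  assumes u: "\<And>i. i < m \<Longrightarrow> u i \<in> carrier R" and q: "\<And>l. q l \<in> carrier R" and x: "x \<in> carrier R"
    and z: "\<And>l. n \<le> l + m \<Longrightarrow> q l = \<zero>"
  shows "poly_sum n (conv m u q) x = poly_sum m u x \<otimes> poly_sum n q x"
  using u z
proof (induction m)
  case 0
  have "poly_sum n (conv 0 u q) x = poly_sum n (\<lambda>_. \<zero>) x" by (simp add: conv_def[abs_def])
  also have "\<dots> = \<zero>" unfolding poly_sum_def using x by (intro add.finprod_one_eqI) auto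
  finally show ?case using q x by simp
next
  case (Suc m)
  have IH: "poly_sum n (conv m u q) x = poly_sum m u x \<otimes> poly_sum n q x"
    using Suc.prems by (intro Suc.IH) auto
  have "poly_sum n (conv (Suc m) u q) x = poly_sum n (\<lambda>l. conv m u q l \<oplus> u m \<otimes> xmul q (Suc l - m)) x"
    using Suc.prems(1) q x by (intro poly_sum_cong conv_Suc) auto
  also have "\<dots> = poly_sum n (conv m u q) x \<oplus> u m \<otimes> (x [^] m \<otimes> poly_sum n q x)"
  proof -
    have "poly_sum n (\<lambda>l. xmul q (Suc l - m)) x = x [^] m \<otimes> poly_sum n q x"
      using q x Suc.prems(2) by (intro poly_sum_shift) auto
    then show ?thesis using Suc.prems(1) q x by (simp add: poly_sum_add poly_sum_smult)
  qed
  also have "\<dots> = poly_sum (Suc m) u x \<otimes> poly_sum n q x"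
    using Suc.prems(1) q x by (simp add: IH poly_sum_Suc l_distr m_assoc)
  finally show ?case .
qed

end

text \<open>A transfer of the root bound for \<open>UP R\<close> to coefficient functions: a nonzero
  polynomial of degree below d cannot vanish at d points.\<close>

lemma (in field) poly_sum_roots:
  assumes fin: "finite (carrier R)" and p: "\<And>l. p l \<in> carrier R"
    and Z: "Z \<subseteq> carrier R" "d \<le> card Z" and root: "\<And>z. z \<in> Z \<Longrightarrow> poly_sum d p z = \<zero>" and "l < d"
  shows "p l = \<zero>"
proof (rule ccontr)
  assume nz: "p l \<noteq> \<zero>"
  \<comment> \<open>The coefficients of p from d on are arbitrary; cutting them off gives an element
    of \<open>UP R\<close> with the same values under \<open>poly_sum d\<close>.\<close>
  define f where "f = (\<lambda>l. if l < d then p l else \<zero>)"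
  have fv: "f i = (if i < d then p i else \<zero>)" for i by (simp add: f_def)
  have f: "f \<in> up R"
    unfolding up_def bound_def using p by (auto simp: fv intro!: exI[of _ d])
  then have fc: "f \<in> carrier (UP R)" and co: "\<And>i. up_ring.coeff (UP R) f i = f i"
    unfolding UP_def by simp_all
  interpret UP: UP_domain R "UP R" by unfold_locales
  have fl: "up_ring.coeff (UP R) f l \<noteq> \<zero>" using nz \<open>l < d\<close> by (simp add: co fv)
  then have f0: "f \<noteq> \<zero>\<^bsub>UP R\<^esub>" using UP.coeff_zero by metis
  have deg: "deg R f < d"
  proof -
    have "deg R f \<le> d - 1"
      using fc \<open>l < d\<close> by (intro UP.deg_aboveI) (auto simp: co fv)
    then show ?thesis using \<open>l < d\<close> by simp
  qed
  have ev: "UnivPoly.eval R R id z f = poly_sum d p z" if z: "z \<in> carrier R" for z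
  proof -
    have fp: "f i \<in> carrier R" for i using p by (simp add: fv)
    have "poly_sum d p z = poly_sum d f z"
      using p z by (intro poly_sum_cong) (auto simp: fv)
    also have "\<dots> = poly_sum (Suc (deg R f)) f z"
      using deg fp z UP.deg_aboveD[OF _ fc] by (intro poly_sum_extend) (auto simp: co)
    also have "\<dots> = UnivPoly.eval R R id z f"
      unfolding poly_sum_def UnivPoly.eval_def
      using fc fp by (simp add: co lessThan_Suc_atMost)
    finally show ?thesis by simp
  qed
  have "card Z \<le> card {a \<in> carrier R. UnivPoly.eval R R id a f = \<zero>}"
    using fin Z root ev by (intro card_mono) auto
  also have "\<dots> \<le> deg R f" using UP.roots_bound[OF fc f0 fin] by simp
  finally show False using deg Z by simp
qed

section \<open>Interpolation of the error locator\<close>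

context field
begin

text \<open>This is v_c * Q(x_c, y_c / v_c) for Q = p + q Y. Scaling by v_c clears the denominator
  without changing the zeros when v_c is nonzero. The N + 1 terms suffice because after b points the
  degrees are at most b \<le> N.\<close>

definition discrepancy :: "nat \<Rightarrow> (nat \<Rightarrow> 'a) \<Rightarrow> (nat \<Rightarrow> 'a) \<Rightarrow> (nat \<Rightarrow> 'a) \<Rightarrow> nat \<Rightarrow>
    (nat \<Rightarrow> 'a) \<Rightarrow> (nat \<Rightarrow> 'a) \<Rightarrow> 'a" where
  "discrepancy N v y x c p q = poly_sum (N + 1) (\<lambda>l. v c \<otimes> p l \<oplus> y c \<otimes> q l) (x c)"

text \<open>With $Q_g(X, Y) = g_0(X) + g_1(X) Y$ and likewise $Q_h$, both interpolate the points
  $(x_c, y_c / v_c)$ for $c < b$. For the weighted degree in which $Y$ counts $m - 1$, the leading term of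
  $Q_g$ is $X^a$ and that of $Q_h$ is $X^e Y$, ties being won by the term with $Y$; the two leading
  terms lie in different components, so neither polynomial can become zero.\<close>

definition koetter :: "nat \<Rightarrow> nat \<Rightarrow> (nat \<Rightarrow> 'a) \<Rightarrow> (nat \<Rightarrow> 'a) \<Rightarrow> (nat \<Rightarrow> 'a) \<Rightarrow> nat \<Rightarrow>
    (nat \<Rightarrow> 'a) \<Rightarrow> (nat \<Rightarrow> 'a) \<Rightarrow> (nat \<Rightarrow> 'a) \<Rightarrow> (nat \<Rightarrow> 'a) \<Rightarrow> nat \<Rightarrow> nat \<Rightarrow> bool" where
  "koetter N m v y x b g0 g1 h0 h1 a e \<longleftrightarrow>
     (\<forall>l. g0 l \<in> carrier R \<and> g1 l \<in> carrier R \<and> h0 l \<in> carrier R \<and> h1 l \<in> carrier R) \<and>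
     (\<forall>l>b. g0 l = \<zero> \<and> g1 l = \<zero> \<and> h0 l = \<zero> \<and> h1 l = \<zero>) \<and>
     g0 a \<noteq> \<zero> \<and> (\<forall>l>a. g0 l = \<zero>) \<and> (\<forall>l. a < l + m \<longrightarrow> g1 l = \<zero>) \<and>
     h1 e \<noteq> \<zero> \<and> (\<forall>l>e. h1 l = \<zero>) \<and> (\<forall>l. e + m \<le> l \<longrightarrow> h0 l = \<zero>) \<and>
     a + e \<le> b \<and>
     (\<forall>c<b. discrepancy N v y x c g0 g1 = \<zero> \<and> discrepancy N v y x c h0 h1 = \<zero>)"

lemma discrepancy_closed:
  assumes "\<And>l. p l \<in> carrier R" "\<And>l. q l \<in> carrier R"
    and "v c \<in> carrier R" "y c \<in> carrier R" "x c \<in> carrier R"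
  shows "discrepancy N v y x c p q \<in> carrier R"
  unfolding discrepancy_def using assms by simp

text \<open>At the point x_c, multiplication by X acts as multiplication by x_c, so an update
  becomes a scalar combination of old discrepancies. With coefficients (-x_b, 0, 1) the factor is
  x_c - x_b, which is zero for c = b. The degree condition leaves room for the product with
  X.\<close>

lemma discrepancy_comb:
  assumes c: "\<And>l. p l \<in> carrier R" "\<And>l. q l \<in> carrier R" "\<And>l. p' l \<in> carrier R" "\<And>l. q' l \<in> carrier R"
    and s: "v c \<in> carrier R" "y c \<in> carrier R" "x c \<in> carrier R"
    and k: "k1 \<in> carrier R" "k2 \<in> carrier R" "k3 \<in> carrier R"
    and deg: "\<And>l. N \<le> l \<Longrightarrow> p l = \<zero> \<and> q l = \<zero>"
  shows "discrepancy N v y x c (\<lambda>l. k1 \<otimes> p l \<oplus> k2 \<otimes> p' l \<oplus> k3 \<otimes> xmul p l)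
      (\<lambda>l. k1 \<otimes> q l \<oplus> k2 \<otimes> q' l \<oplus> k3 \<otimes> xmul q l) =
    (k1 \<oplus> k3 \<otimes> x c) \<otimes> discrepancy N v y x c p q \<oplus> k2 \<otimes> discrepancy N v y x c p' q'"
proof -
  define P where "P = (\<lambda>l. v c \<otimes> p l \<oplus> y c \<otimes> q l)"
  define P' where "P' = (\<lambda>l. v c \<otimes> p' l \<oplus> y c \<otimes> q' l)"
  have Pc [simp]: "P l \<in> carrier R" "P' l \<in> carrier R" for l using c s by (auto simp: P_def P'_def)
  have "poly_sum (N + 1) (\<lambda>l. v c \<otimes> (k1 \<otimes> p l \<oplus> k2 \<otimes> p' l \<oplus> k3 \<otimes> xmul p l) \<oplus>
      y c \<otimes> (k1 \<otimes> q l \<oplus> k2 \<otimes> q' l \<oplus> k3 \<otimes> xmul q l)) (x c) =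
    poly_sum (N + 1) (\<lambda>l. (k1 \<otimes> P l \<oplus> k2 \<otimes> P' l) \<oplus> k3 \<otimes> xmul P l) (x c)"
  proof (rule poly_sum_cong)
    fix l
    have "xmul P l = v c \<otimes> xmul p l \<oplus> y c \<otimes> xmul q l"
      using s by (cases l) (auto simp: P_def)
    moreover have "xmul p l \<in> carrier R" "xmul q l \<in> carrier R" using c by auto
    ultimately show "v c \<otimes> (k1 \<otimes> p l \<oplus> k2 \<otimes> p' l \<oplus> k3 \<otimes> xmul p l) \<oplus>
      y c \<otimes> (k1 \<otimes> q l \<oplus> k2 \<otimes> q' l \<oplus> k3 \<otimes> xmul q l) = (k1 \<otimes> P l \<oplus> k2 \<otimes> P' l) \<oplus> k3 \<otimes> xmul P l"
      using c[of l] s k unfolding P_def P'_def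
      by (simp only:) (simp add: r_distr m_lcomm a_ac)
  qed (use k s in auto)
  also have "\<dots> = k1 \<otimes> poly_sum (N + 1) P (x c) \<oplus> k2 \<otimes> poly_sum (N + 1) P' (x c) \<oplus>
      k3 \<otimes> (x c \<otimes> poly_sum (N + 1) P (x c))"
  proof -
    have "poly_sum (N + 1) (xmul P) (x c) = x c \<otimes> poly_sum (N + 1) P (x c)"
      by (intro poly_sum_xmul Pc s) (use s deg in \<open>auto simp: P_def\<close>)
    then show ?thesis using k s by (simp only: poly_sum_add poly_sum_smult Pc xmul_closed m_closed a_closed)
  qed
  also have "\<dots> = (k1 \<oplus> k3 \<otimes> x c) \<otimes> poly_sum (N + 1) P (x c) \<oplus> k2 \<otimes> poly_sum (N + 1) P' (x c)"
    using k s by (simp add: l_distr m_assoc a_ac)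
  finally show ?thesis unfolding discrepancy_def P_def P'_def .
qed

lemma koetter_init:
  assumes "0 < m"
  shows "koetter N m v y x 0 (\<lambda>l. if l = 0 then \<one> else \<zero>) (\<lambda>_. \<zero>) (\<lambda>_. \<zero>) (\<lambda>l. if l = 0 then \<one> else \<zero>) 0 0"
  using assms by (auto simp: koetter_def)

text \<open>Multiplying Q_g by X - x_b adds the new zero and keeps the old ones, while Q_h is
  corrected by the multiple \<open>k\<close> of Q_g that cancels its discrepancy. Case
  \<open>k = \<zero>\<close> also covers a Q_h that already vanishes at the new point, whatever the
  degrees are.\<close>

lemma koetter_pivot_g:
  assumes K: "koetter N m v y x b g0 g1 h0 h1 a e" and b: "b < N"
    and s: "\<And>c. c < N \<Longrightarrow> v c \<in> carrier R \<and> y c \<in> carrier R \<and> x c \<in> carrier R"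
    and k: "k \<in> carrier R"
    and d: "discrepancy N v y x b h0 h1 \<oplus> k \<otimes> discrepancy N v y x b g0 g1 = \<zero>"
    and deg: "k = \<zero> \<or> a < e + m"
  shows "koetter N m v y x (Suc b)
    (\<lambda>l. \<ominus> x b \<otimes> g0 l \<oplus> \<zero> \<otimes> h0 l \<oplus> \<one> \<otimes> xmul g0 l) (\<lambda>l. \<ominus> x b \<otimes> g1 l \<oplus> \<zero> \<otimes> h1 l \<oplus> \<one> \<otimes> xmul g1 l)
    (\<lambda>l. \<one> \<otimes> h0 l \<oplus> k \<otimes> g0 l \<oplus> \<zero> \<otimes> xmul h0 l) (\<lambda>l. \<one> \<otimes> h1 l \<oplus> k \<otimes> g1 l \<oplus> \<zero> \<otimes> xmul h1 l) (Suc a) e"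
proof -
  have c [simp]: "g0 l \<in> carrier R" "g1 l \<in> carrier R" "h0 l \<in> carrier R" "h1 l \<in> carrier R" for l
    using K by (auto simp: koetter_def)
  have xb [simp]: "x b \<in> carrier R" using s b by auto
  have z: "g0 l = \<zero> \<and> g1 l = \<zero> \<and> h0 l = \<zero> \<and> h1 l = \<zero>" if "b < l" for l
    using K that by (auto simp: koetter_def)
  have D: "discrepancy N v y x c (\<lambda>l. \<ominus> x b \<otimes> g0 l \<oplus> \<zero> \<otimes> h0 l \<oplus> \<one> \<otimes> xmul g0 l)
      (\<lambda>l. \<ominus> x b \<otimes> g1 l \<oplus> \<zero> \<otimes> h1 l \<oplus> \<one> \<otimes> xmul g1 l) = \<zero> \<and>
      discrepancy N v y x c (\<lambda>l. \<one> \<otimes> h0 l \<oplus> k \<otimes> g0 l \<oplus> \<zero> \<otimes> xmul h0 l)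
      (\<lambda>l. \<one> \<otimes> h1 l \<oplus> k \<otimes> g1 l \<oplus> \<zero> \<otimes> xmul h1 l) = \<zero>" if "c < Suc b" for c
  proof -
    have sc: "v c \<in> carrier R" "y c \<in> carrier R" "x c \<in> carrier R" using s that b by auto
    have zN: "g0 l = \<zero> \<and> g1 l = \<zero>" "h0 l = \<zero> \<and> h1 l = \<zero>" if "N \<le> l" for l using z that b by auto
    have Dg: "discrepancy N v y x c g0 g1 \<in> carrier R" and Dh: "discrepancy N v y x c h0 h1 \<in> carrier R"
      using sc by (auto intro!: discrepancy_closed)
    have "c = b \<or> discrepancy N v y x c g0 g1 = \<zero> \<and> discrepancy N v y x c h0 h1 = \<zero>"
      using K that by (auto simp: koetter_def less_Suc_eq)
    moreover have "discrepancy N v y x c (\<lambda>l. \<ominus> x b \<otimes> g0 l \<oplus> \<zero> \<otimes> h0 l \<oplus> \<one> \<otimes> xmul g0 l)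
      (\<lambda>l. \<ominus> x b \<otimes> g1 l \<oplus> \<zero> \<otimes> h1 l \<oplus> \<one> \<otimes> xmul g1 l) =
      (\<ominus> x b \<oplus> \<one> \<otimes> x c) \<otimes> discrepancy N v y x c g0 g1 \<oplus> \<zero> \<otimes> discrepancy N v y x c h0 h1"
      using zN by (intro discrepancy_comb sc c) auto
    moreover have "discrepancy N v y x c (\<lambda>l. \<one> \<otimes> h0 l \<oplus> k \<otimes> g0 l \<oplus> \<zero> \<otimes> xmul h0 l)
      (\<lambda>l. \<one> \<otimes> h1 l \<oplus> k \<otimes> g1 l \<oplus> \<zero> \<otimes> xmul h1 l) =
      (\<one> \<oplus> \<zero> \<otimes> x c) \<otimes> discrepancy N v y x c h0 h1 \<oplus> k \<otimes> discrepancy N v y x c g0 g1"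
      using zN k by (intro discrepancy_comb sc c) auto
    ultimately show ?thesis using sc k Dg Dh d by (elim disjE) (simp_all add: l_neg)
  qed
  have "xmul p l = \<zero>" if "\<And>l. j < l \<Longrightarrow> p l = \<zero>" and "Suc j < l" for p :: "nat \<Rightarrow> 'a" and j l
    using that by (cases l) auto
  note xz = this
  have g1: "xmul g1 l = \<zero> \<and> g1 l = \<zero>" if "Suc a < l + m" for l
    using K that by (cases l) (auto simp: koetter_def)
  \<comment> \<open>For nonzero k, Q_g has the smaller leading term: g0 ends at a < e + m, and g1
    vanishes from e on. Adding k Q_g thus preserves both degree bounds of Q_h and its leading
    coefficient h1_e.\<close>
  have kz: "k \<otimes> g0 l = \<zero>" if "e + m \<le> l" for l using K that deg k by (auto simp: koetter_def)
  have kz1: "k \<otimes> g1 l = \<zero>" if "e \<le> l" for l using K that deg k by (auto simp: koetter_def)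
  show ?thesis unfolding koetter_def
    using K k z D xz[of b g0] xz[of b g1] xz[of a g0] g1 kz kz1
    by (auto simp: koetter_def)
qed

text \<open>The mirror case. A nonzero \<open>k\<close> now needs e + m \<le> a, the opposite order
  of the leading terms, so that the leading coefficient g0_a survives the addition of k Q_h.\<close>

lemma koetter_pivot_h:
  assumes K: "koetter N m v y x b g0 g1 h0 h1 a e" and b: "b < N"
    and s: "\<And>c. c < N \<Longrightarrow> v c \<in> carrier R \<and> y c \<in> carrier R \<and> x c \<in> carrier R"
    and k: "k \<in> carrier R"
    and d: "discrepancy N v y x b g0 g1 \<oplus> k \<otimes> discrepancy N v y x b h0 h1 = \<zero>"
    and deg: "k = \<zero> \<or> e + m \<le> a"
  shows "koetter N m v y x (Suc b)
    (\<lambda>l. \<one> \<otimes> g0 l \<oplus> k \<otimes> h0 l \<oplus> \<zero> \<otimes> xmul g0 l) (\<lambda>l. \<one> \<otimes> g1 l \<oplus> k \<otimes> h1 l \<oplus> \<zero> \<otimes> xmul g1 l)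
    (\<lambda>l. \<ominus> x b \<otimes> h0 l \<oplus> \<zero> \<otimes> g0 l \<oplus> \<one> \<otimes> xmul h0 l) (\<lambda>l. \<ominus> x b \<otimes> h1 l \<oplus> \<zero> \<otimes> g1 l \<oplus> \<one> \<otimes> xmul h1 l) a (Suc e)"
proof -
  have c [simp]: "g0 l \<in> carrier R" "g1 l \<in> carrier R" "h0 l \<in> carrier R" "h1 l \<in> carrier R" for l
    using K by (auto simp: koetter_def)
  have xb [simp]: "x b \<in> carrier R" using s b by auto
  have z: "g0 l = \<zero> \<and> g1 l = \<zero> \<and> h0 l = \<zero> \<and> h1 l = \<zero>" if "b < l" for l
    using K that by (auto simp: koetter_def)
  have D: "discrepancy N v y x c (\<lambda>l. \<ominus> x b \<otimes> h0 l \<oplus> \<zero> \<otimes> g0 l \<oplus> \<one> \<otimes> xmul h0 l)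
      (\<lambda>l. \<ominus> x b \<otimes> h1 l \<oplus> \<zero> \<otimes> g1 l \<oplus> \<one> \<otimes> xmul h1 l) = \<zero> \<and>
      discrepancy N v y x c (\<lambda>l. \<one> \<otimes> g0 l \<oplus> k \<otimes> h0 l \<oplus> \<zero> \<otimes> xmul g0 l)
      (\<lambda>l. \<one> \<otimes> g1 l \<oplus> k \<otimes> h1 l \<oplus> \<zero> \<otimes> xmul g1 l) = \<zero>" if "c < Suc b" for c
  proof -
    have sc: "v c \<in> carrier R" "y c \<in> carrier R" "x c \<in> carrier R" using s that b by auto
    have zN: "g0 l = \<zero> \<and> g1 l = \<zero>" "h0 l = \<zero> \<and> h1 l = \<zero>" if "N \<le> l" for l using z that b by auto
    have Dg: "discrepancy N v y x c g0 g1 \<in> carrier R" and Dh: "discrepancy N v y x c h0 h1 \<in> carrier R"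
      using sc by (auto intro!: discrepancy_closed)
    have "c = b \<or> discrepancy N v y x c g0 g1 = \<zero> \<and> discrepancy N v y x c h0 h1 = \<zero>"
      using K that by (auto simp: koetter_def less_Suc_eq)
    moreover have "discrepancy N v y x c (\<lambda>l. \<ominus> x b \<otimes> h0 l \<oplus> \<zero> \<otimes> g0 l \<oplus> \<one> \<otimes> xmul h0 l)
      (\<lambda>l. \<ominus> x b \<otimes> h1 l \<oplus> \<zero> \<otimes> g1 l \<oplus> \<one> \<otimes> xmul h1 l) =
      (\<ominus> x b \<oplus> \<one> \<otimes> x c) \<otimes> discrepancy N v y x c h0 h1 \<oplus> \<zero> \<otimes> discrepancy N v y x c g0 g1"
      using zN by (intro discrepancy_comb sc c) auto
    moreover have "discrepancy N v y x c (\<lambda>l. \<one> \<otimes> g0 l \<oplus> k \<otimes> h0 l \<oplus> \<zero> \<otimes> xmul g0 l)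
      (\<lambda>l. \<one> \<otimes> g1 l \<oplus> k \<otimes> h1 l \<oplus> \<zero> \<otimes> xmul g1 l) =
      (\<one> \<oplus> \<zero> \<otimes> x c) \<otimes> discrepancy N v y x c g0 g1 \<oplus> k \<otimes> discrepancy N v y x c h0 h1"
      using zN k by (intro discrepancy_comb sc c) auto
    ultimately show ?thesis using sc k Dg Dh d by (elim disjE) (simp_all add: l_neg)
  qed
  have "xmul p l = \<zero>" if "\<And>l. j < l \<Longrightarrow> p l = \<zero>" and "Suc j < l" for p :: "nat \<Rightarrow> 'a" and j l
    using that by (cases l) auto
  note xz = this
  have h0: "xmul h0 l = \<zero> \<and> h0 l = \<zero>" if "Suc (e + m) \<le> l" for l
    using K that by (cases l) (auto simp: koetter_def)
  have kz: "k \<otimes> h0 l = \<zero>" if "a \<le> l" for l using K that deg k by (auto simp: koetter_def)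
  have kz1: "k \<otimes> h1 l = \<zero>" if "a < l + m" for l using K that deg k by (auto simp: koetter_def)
  show ?thesis unfolding koetter_def
    using K k z D xz[of b h0] xz[of b h1] xz[of e h1] h0 kz kz1
    by (auto simp: koetter_def)
qed

text \<open>Substituting $Y = u(X)$ gives a polynomial that vanishes at the at least $N - t$ error-free
  points. For $Q_g$ it has degree exactly $a$, whence $a \ge N - t$ and $e \le N - a \le t$; then for $Q_h$ it has
  degree below $e + m \le N - t$, so it is zero.\<close>

lemma koetter_key_equation:
  assumes K: "koetter N m v y x N g0 g1 h0 h1 a e" and fin: "finite (carrier R)"
    and s: "\<And>c. c < N \<Longrightarrow> v c \<in> carrier R \<and> v c \<noteq> \<zero> \<and> y c \<in> carrier R \<and> x c \<in> carrier R"
    and inj: "inj_on x {..<N}" and m: "0 < m" "m \<le> N"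
    and u: "\<And>i. i < m \<Longrightarrow> u i \<in> carrier R"
    and t: "card {c. c < N \<and> y c \<noteq> v c \<otimes> poly_sum m u (x c)} \<le> t" and tN: "2 * t \<le> N - m"
  shows "h0 l \<oplus> conv m u h1 l = \<zero>"
proof -
  have c [simp]: "g0 l \<in> carrier R" "g1 l \<in> carrier R" "h0 l \<in> carrier R" "h1 l \<in> carrier R" for l
    using K by (auto simp: koetter_def)
  define G where "G = {c. c < N \<and> y c = v c \<otimes> poly_sum m u (x c)}"
  have GN: "G \<subseteq> {..<N}" by (auto simp: G_def)
  have "{..<N} - G = {c. c < N \<and> y c \<noteq> v c \<otimes> poly_sum m u (x c)}" by (auto simp: G_def)
  then have "N - card G \<le> t"
    using t card_Diff_subset[of G "{..<N}"] GN finite_subset[OF GN] by simp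
  moreover have xG: "card (x ` G) = card G" using inj GN by (intro card_image inj_on_subset[OF inj])
  ultimately have Z: "N - t \<le> card (x ` G)" "x ` G \<subseteq> carrier R" using s by (auto simp: G_def)
  \<comment> \<open>The degree bound d is kept general: d = a + 1 for Q_g leads to a contradiction
    with its nonzero leading coefficient, and d = e + m for Q_h gives the result.\<close>
  have van: "p l \<oplus> conv m u q l = \<zero>"
    if pc: "\<And>l. p l \<in> carrier R" "\<And>l. q l \<in> carrier R"
      and zN: "\<And>l. N < l \<Longrightarrow> p l = \<zero> \<and> q l = \<zero>"
      and D: "\<And>c. c < N \<Longrightarrow> discrepancy N v y x c p q = \<zero>"
      and dN: "d \<le> N - t" and zd: "\<And>l. d \<le> l \<Longrightarrow> p l \<oplus> conv m u q l = \<zero>"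
    for p q d l
  proof (cases "l < d")
    case True
    have "poly_sum d (\<lambda>l. p l \<oplus> conv m u q l) z = \<zero>" if zG: "z \<in> x ` G" for z
    proof -
      obtain c where cG: "c < N" "y c = v c \<otimes> poly_sum m u (x c)" and zx: "z = x c"
        using zG by (auto simp: G_def)
      have sc: "v c \<in> carrier R" "v c \<noteq> \<zero>" "x c \<in> carrier R" using s cG by auto
      \<comment> \<open>Enough terms for the product u * q, whose factors have fewer than m and at
        most N + 1 coefficients.\<close>
      define n where "n = N + 1 + m"
      have U: "poly_sum m u (x c) \<in> carrier R" using u sc by simp
      have "\<zero> = poly_sum (N + 1) (\<lambda>l. v c \<otimes> p l \<oplus> y c \<otimes> q l) (x c)"
        using D[OF cG(1)] by (simp add: discrepancy_def)
      also have "\<dots> = v c \<otimes> poly_sum (N + 1) p (x c) \<oplus> y c \<otimes> poly_sum (N + 1) q (x c)"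
        using pc sc cG U by (simp add: poly_sum_add poly_sum_smult)
      also have "\<dots> = v c \<otimes> poly_sum n p (x c) \<oplus> v c \<otimes> (poly_sum m u (x c) \<otimes> poly_sum n q (x c))"
      proof -
        have "poly_sum n p (x c) = poly_sum (N + 1) p (x c)" "poly_sum n q (x c) = poly_sum (N + 1) q (x c)"
          using pc sc zN by (auto intro!: poly_sum_extend simp: n_def)
        then show ?thesis using cG(2) sc pc U by (simp add: m_assoc)
      qed
      also have "\<dots> = v c \<otimes> poly_sum n (\<lambda>l. p l \<oplus> conv m u q l) (x c)"
      proof -
        have "poly_sum n (conv m u q) (x c) = poly_sum m u (x c) \<otimes> poly_sum n q (x c)"
          using u pc sc zN by (intro poly_sum_conv) (auto simp: n_def)
        then show ?thesis using pc sc u U by (simp add: poly_sum_add r_distr)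
      qed
      also have "poly_sum n (\<lambda>l. p l \<oplus> conv m u q l) (x c) = poly_sum d (\<lambda>l. p l \<oplus> conv m u q l) (x c)"
        using pc u sc zd dN by (intro poly_sum_extend) (auto simp: n_def)
      finally show ?thesis
        using sc zx pc u integral[of "v c" "poly_sum d (\<lambda>l. p l \<oplus> conv m u q l) z"] by auto
    qed
    note root = this
    have "(\<lambda>l. p l \<oplus> conv m u q l) l = \<zero>"
    proof (rule poly_sum_roots[OF fin _ Z(2) _ root True])
      show "p l \<oplus> conv m u q l \<in> carrier R" for l using pc u by simp
      show "d \<le> card (x ` G)" using Z dN by linarith
    qed
    then show ?thesis .
  next
    case False
    then show ?thesis using zd by auto
  qed
  have cg: "conv m u g1 l = \<zero>" if "a \<le> l" for l
  proof (rule conv_eq_0[OF u])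
    fix i assume "i < m"
    then show "xmul g1 (Suc l - i) = \<zero>"
      using K that by (cases "Suc l - i") (auto simp: koetter_def)
  qed
  have a: "N - t \<le> a"
  proof (rule ccontr)
    assume "\<not> N - t \<le> a"
    then have "g0 a \<oplus> conv m u g1 a = \<zero>"
      using K cg by (intro van[of g0 g1 "Suc a" a]) (auto simp: koetter_def)
    then show False using K cg[of a] by (auto simp: koetter_def)
  qed
  have ch: "conv m u h1 l = \<zero>" if "e + m \<le> l" for l
  proof (rule conv_eq_0[OF u])
    fix i assume "i < m"
    then show "xmul h1 (Suc l - i) = \<zero>"
      using K that by (cases "Suc l - i") (auto simp: koetter_def)
  qed
  have "e + m \<le> N - t" using a K m tN by (auto simp: koetter_def)
  then show ?thesis
    using K ch by (intro van[of h0 h1 "e + m" l]) (auto simp: koetter_def)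
qed

end

section \<open>Correctness of the decoder\<close>

context field
begin

text \<open>The multiplier \<open>k\<close> is hidden behind an existential quantifier together with
  just those facts that \<open>koetter_pivot_g\<close> and \<open>koetter_pivot_h\<close> require of
  it.\<close>

definition pivoted :: "nat \<Rightarrow> 'a \<Rightarrow> 'a \<Rightarrow> 'a \<Rightarrow> 'a memory \<Rightarrow> 'a memory \<Rightarrow> bool" where
  "pivoted m x dg dh \<mu> \<mu>' \<longleftrightarrow> frame {6, 7} {22, 23, 24, 25, 26, 27} \<mu> \<mu>' \<and>
     ((\<exists>k\<in>carrier R. dh \<oplus> k \<otimes> dg = \<zero> \<and> (k = \<zero> \<or> fst \<mu> 6 < fst \<mu> 7 + m) \<and>
        snd \<mu>' 22 0 = \<ominus> x \<and> snd \<mu>' 23 0 = \<zero> \<and> snd \<mu>' 24 0 = \<one> \<and>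
        snd \<mu>' 25 0 = \<one> \<and> snd \<mu>' 26 0 = k \<and> snd \<mu>' 27 0 = \<zero> \<and>
        fst \<mu>' 6 = Suc (fst \<mu> 6) \<and> fst \<mu>' 7 = fst \<mu> 7) \<or>
      (\<exists>k\<in>carrier R. dg \<oplus> k \<otimes> dh = \<zero> \<and> (k = \<zero> \<or> fst \<mu> 7 + m \<le> fst \<mu> 6) \<and>
        snd \<mu>' 22 0 = \<one> \<and> snd \<mu>' 23 0 = k \<and> snd \<mu>' 24 0 = \<zero> \<and>
        snd \<mu>' 25 0 = \<ominus> x \<and> snd \<mu>' 26 0 = \<zero> \<and> snd \<mu>' 27 0 = \<one> \<and>
        fst \<mu>' 6 = fst \<mu> 6 \<and> fst \<mu>' 7 = Suc (fst \<mu> 7)))"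

lemma cancel_quotient:
  assumes "p \<in> carrier R" and "q \<in> carrier R" and "p \<noteq> \<zero>"
  shows "q \<oplus> (\<ominus> (q \<otimes> finv p)) \<otimes> p = \<zero>"
proof -
  have "q \<otimes> finv p \<otimes> p = q"
    using assms finv_right[of p] by (simp add: m_assoc m_comm[of "finv p" p])
  then show ?thesis using assms by (simp add: l_minus r_neg)
qed

lemma pivot_g_run:
  assumes "snd \<mu> 6 0 = x" "snd \<mu> 20 0 = dg" "snd \<mu> 21 0 = dh"
    and "x \<in> carrier R" "dg \<in> carrier R" "dh \<in> carrier R"
    and "dh = \<zero> \<or> dg \<noteq> \<zero> \<and> fst \<mu> 6 < fst \<mu> 7 + m"
  shows "pivoted m x dg dh \<mu> (run R pivot_g \<mu>)"
proof -
  have 1: "dh \<oplus> (\<ominus> (dh \<otimes> finv dg)) \<otimes> dg = \<zero>"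
    using assms cancel_quotient[of dg dh] by (cases "dh = \<zero>") auto
  have 2: "\<ominus> (dh \<otimes> finv dg) = \<zero> \<or> fst \<mu> 6 < fst \<mu> 7 + m" using assms by auto
  have 3: "frame {6, 7} {22, 23, 24, 25, 26, 27} \<mu> (run R pivot_g \<mu>)"
    by (simp add: pivot_g_def frame_def)
  show ?thesis unfolding pivoted_def
    by (rule conjI[OF 3], rule disjI1, rule bexI[of _ "\<ominus> (dh \<otimes> finv dg)"], intro conjI)
      (use assms 1 2 in \<open>simp_all add: pivot_g_def fval_FInv minus_eq del: fval.simps(7)\<close>)
qed

lemma pivot_h_run:
  assumes "snd \<mu> 6 0 = x" "snd \<mu> 20 0 = dg" "snd \<mu> 21 0 = dh"
    and "x \<in> carrier R" "dg \<in> carrier R" "dh \<in> carrier R"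
    and "dg = \<zero> \<or> dh \<noteq> \<zero> \<and> fst \<mu> 7 + m \<le> fst \<mu> 6"
  shows "pivoted m x dg dh \<mu> (run R pivot_h \<mu>)"
proof -
  have 1: "dg \<oplus> (\<ominus> (dg \<otimes> finv dh)) \<otimes> dh = \<zero>"
    using assms cancel_quotient[of dh dg] by (cases "dg = \<zero>") auto
  have 2: "\<ominus> (dg \<otimes> finv dh) = \<zero> \<or> fst \<mu> 7 + m \<le> fst \<mu> 6" using assms by auto
  have 3: "frame {6, 7} {22, 23, 24, 25, 26, 27} \<mu> (run R pivot_h \<mu>)"
    by (simp add: pivot_h_def frame_def)
  show ?thesis unfolding pivoted_def
    by (rule conjI[OF 3], rule disjI2, rule bexI[of _ "\<ominus> (dg \<otimes> finv dh)"], intro conjI)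
      (use assms 1 2 in \<open>simp_all add: pivot_h_def fval_FInv minus_eq del: fval.simps(7)\<close>)
qed

lemma decode_pivot_runs:
  assumes "snd \<mu> 6 0 = x" "snd \<mu> 20 0 = dg" "snd \<mu> 21 0 = dh" "fst \<mu> 1 = m"
    and "x \<in> carrier R" "dg \<in> carrier R" "dh \<in> carrier R"
  shows "runs_within R decode_pivot \<mu> 140 (pivoted m x dg dh \<mu>)"
proof -
  have "runs_within R decode_pivot \<mu> (cost_bound decode_pivot) (pivoted m x dg dh \<mu>)"
  proof (rule runs_within_straight)
    show "straight decode_pivot" by (simp add: decode_pivot_def pivot_g_def pivot_h_def)
    have g: "pivoted m x dg dh \<mu> (run R pivot_g \<mu>)" if "dh = \<zero> \<or> dg \<noteq> \<zero> \<and> fst \<mu> 6 < fst \<mu> 7 + m"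
      by (rule pivot_g_run[OF assms(1-3,5-7) that])
    have h: "pivoted m x dg dh \<mu> (run R pivot_h \<mu>)" if "dg = \<zero> \<or> dh \<noteq> \<zero> \<and> fst \<mu> 7 + m \<le> fst \<mu> 6"
      by (rule pivot_h_run[OF assms(1-3,5-7) that])
    show "pivoted m x dg dh \<mu> (run R decode_pivot \<mu>)"
    \<comment> \<open>The nested tests of the program select \<open>pivot_g\<close> in exactly this
      case.\<close>
    proof (cases "dh = \<zero> \<or> dg \<noteq> \<zero> \<and> fst \<mu> 6 < fst \<mu> 7 + m")
      case True
      then have "run R decode_pivot \<mu> = run R pivot_g \<mu>"
        using assms(1-4) by (auto simp: decode_pivot_def)
      then show ?thesis using g[OF True] by simp
    next
      case False
      then have "run R decode_pivot \<mu> = run R pivot_h \<mu>"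
        using assms(1-4) by (auto simp: decode_pivot_def)
      then show ?thesis using h False by auto
    qed
  qed
  then show ?thesis
    by (rule runs_within_mono) (simp_all add: decode_pivot_def pivot_g_def pivot_h_def)
qed

text \<open>Array 2 is kept at zero for the later division, which starts from an empty quotient
  stored there.\<close>

definition decode_inv :: "nat \<Rightarrow> nat \<Rightarrow> 'a \<Rightarrow> 'a \<Rightarrow> (nat \<Rightarrow> 'a) \<Rightarrow> nat \<Rightarrow> 'a memory \<Rightarrow> bool" where
  "decode_inv N m v x y b \<mu> \<longleftrightarrow>
     fst \<mu> 0 = N \<and> fst \<mu> 1 = m \<and> snd \<mu> 1 = y \<and> snd \<mu> 2 = (\<lambda>_. \<zero>) \<and> snd \<mu> 3 0 = v \<and> snd \<mu> 4 0 = x \<and>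
     snd \<mu> 5 0 = v [^] b \<and> snd \<mu> 6 0 = x [^] b \<and>
     (\<exists>g0 g1 h0 h1. snd \<mu> 10 = xmul g0 \<and> snd \<mu> 11 = xmul g1 \<and> snd \<mu> 12 = xmul h0 \<and> snd \<mu> 13 = xmul h1 \<and>
        koetter N m (\<lambda>c. v [^] c) y (\<lambda>c. x [^] c) b g0 g1 h0 h1 (fst \<mu> 6) (fst \<mu> 7))"

lemma decode_body_runs:
  assumes I: "decode_inv N m v x y b \<mu>" and b4: "fst \<mu> 4 = b" and b: "b < N"
    and c: "v \<in> carrier R" "x \<in> carrier R" "\<And>c. y c \<in> carrier R"
  shows "runs_within R decode_body \<mu> (180 + 227 * (N + 1))
    (\<lambda>\<mu>'. decode_inv N m v x y (Suc b) \<mu>' \<and> fst \<mu>' 4 = b)"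
proof -
  obtain g0 g1 h0 h1 where arr: "snd \<mu> 10 = xmul g0" "snd \<mu> 11 = xmul g1" "snd \<mu> 12 = xmul h0" "snd \<mu> 13 = xmul h1"
    and K: "koetter N m (\<lambda>c. v [^] c) y (\<lambda>c. x [^] c) b g0 g1 h0 h1 (fst \<mu> 6) (fst \<mu> 7)"
    using I by (auto simp: decode_inv_def)
  have st: "fst \<mu> 0 = N" "fst \<mu> 1 = m" "snd \<mu> 1 = y" "snd \<mu> 2 = (\<lambda>_. \<zero>)" "snd \<mu> 3 0 = v" "snd \<mu> 4 0 = x"
    "snd \<mu> 5 0 = v [^] b" "snd \<mu> 6 0 = x [^] b"
    using I by (auto simp: decode_inv_def)
  have cl: "\<And>l. g0 l \<in> carrier R" "\<And>l. g1 l \<in> carrier R" "\<And>l. h0 l \<in> carrier R" "\<And>l. h1 l \<in> carrier R"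
    using K by (auto simp: koetter_def)
  have z: "g0 l = \<zero> \<and> g1 l = \<zero> \<and> h0 l = \<zero> \<and> h1 l = \<zero>" if "N \<le> l" for l
    using K b that by (auto simp: koetter_def)
  define dg where "dg = discrepancy N (\<lambda>c. v [^] c) y (\<lambda>c. x [^] c) b g0 g1"
  define dh where "dh = discrepancy N (\<lambda>c. v [^] c) y (\<lambda>c. x [^] c) b h0 h1"
  have dc: "dg \<in> carrier R" "dh \<in> carrier R"
    unfolding dg_def dh_def using cl c by (auto intro!: discrepancy_closed)
  let ?P1 = "\<lambda>\<rho>. frame {5} {7, 20, 21} \<mu> \<rho> \<and> snd \<rho> 20 0 = dg \<and> snd \<rho> 21 0 = dh"
  \<comment> \<open>The memory before the pivot step is kept as a witness, because
    \<open>pivoted\<close> compares the degree registers with their former values.\<close>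
  let ?P2 = "\<lambda>\<rho>. frame {5, 6, 7} {7, 20, 21, 22, 23, 24, 25, 26, 27} \<mu> \<rho> \<and>
    (\<exists>\<nu>. ?P1 \<nu> \<and> pivoted m (x [^] b) dg dh \<nu> \<rho>)"
  let ?kg = "\<lambda>g0 g1 h0 h1 a e. koetter N m (\<lambda>c. v [^] c) y (\<lambda>c. x [^] c) (Suc b) g0 g1 h0 h1 a e"
  let ?P3 = "\<lambda>\<rho>. frame {5, 6, 7} {7, 10, 11, 12, 13, 20, 21, 22, 23, 24, 25, 26, 27, 28} \<mu> \<rho> \<and>
    (\<exists>g0 g1 h0 h1. snd \<rho> 10 = xmul g0 \<and> snd \<rho> 11 = xmul g1 \<and> snd \<rho> 12 = xmul h0 \<and> snd \<rho> 13 = xmul h1 \<and>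
       ?kg g0 g1 h0 h1 (fst \<rho> 6) (fst \<rho> 7))"
  have 1: "runs_within R decode_eval \<mu> (18 + 62 * (fst \<mu> 0 + 1)) ?P1"
    by (rule runs_within_mono[OF decode_eval_runs[OF arr cl]])
      (use st c b4 in \<open>auto simp: dg_def dh_def discrepancy_def\<close>)
  have 2: "runs_within R decode_pivot \<nu> 140 ?P2" if P1: "?P1 \<nu>" for \<nu>
  proof (rule runs_within_mono[OF decode_pivot_runs[of \<nu> "x [^] b" dg dh m]])
    fix \<rho> assume pv: "pivoted m (x [^] b) dg dh \<nu> \<rho>"
    then have "frame {5, 6, 7} {7, 20, 21, 22, 23, 24, 25, 26, 27} \<mu> \<rho>"
      using P1 by (auto simp: frame_def pivoted_def)
    then show "?P2 \<rho>" using P1 pv by blast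
  qed (use P1 st c dc in \<open>auto simp: frame_def\<close>)
  have 3: "runs_within R decode_update \<nu> (7 + 165 * (N + 1)) ?P3" if P2: "?P2 \<nu>" for \<nu>
  proof -
    obtain \<mu>1 where P1: "?P1 \<mu>1" and pv: "pivoted m (x [^] b) dg dh \<mu>1 \<nu>" using P2 by auto
    have r: "fst \<mu>1 6 = fst \<mu> 6" "fst \<mu>1 7 = fst \<mu> 7" using P1 by (auto simp: frame_def)
    have arr': "snd \<nu> 10 = xmul g0" "snd \<nu> 11 = xmul g1" "snd \<nu> 12 = xmul h0" "snd \<nu> 13 = xmul h1" "fst \<nu> 0 = N"
      using P2 arr st by (auto simp: frame_def)
    have cc: "snd \<nu> i 0 \<in> carrier R" if "i \<in> {22, 23, 24, 25, 26, 27}" for i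
      using pv that c by (auto simp: pivoted_def)
    have s: "v [^] i \<in> carrier R \<and> y i \<in> carrier R \<and> x [^] i \<in> carrier R" for i :: nat using c by auto
    note pg = koetter_pivot_g[OF K b s, folded dg_def dh_def]
    note ph = koetter_pivot_h[OF K b s, folded dg_def dh_def]
    have kk: "?kg (\<lambda>l. snd \<nu> 22 0 \<otimes> g0 l \<oplus> snd \<nu> 23 0 \<otimes> h0 l \<oplus> snd \<nu> 24 0 \<otimes> xmul g0 l)
      (\<lambda>l. snd \<nu> 22 0 \<otimes> g1 l \<oplus> snd \<nu> 23 0 \<otimes> h1 l \<oplus> snd \<nu> 24 0 \<otimes> xmul g1 l)
      (\<lambda>l. snd \<nu> 25 0 \<otimes> h0 l \<oplus> snd \<nu> 26 0 \<otimes> g0 l \<oplus> snd \<nu> 27 0 \<otimes> xmul h0 l)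
      (\<lambda>l. snd \<nu> 25 0 \<otimes> h1 l \<oplus> snd \<nu> 26 0 \<otimes> g1 l \<oplus> snd \<nu> 27 0 \<otimes> xmul h1 l) (fst \<nu> 6) (fst \<nu> 7)"
    proof (rule disjE[OF conjunct2[OF pv[unfolded pivoted_def r]]], goal_cases)
      case 1
      then obtain k where k: "k \<in> carrier R" "dh \<oplus> k \<otimes> dg = \<zero>" "k = \<zero> \<or> fst \<mu> 6 < fst \<mu> 7 + m"
        and e: "snd \<nu> 22 0 = \<ominus> (x [^] b)" "snd \<nu> 23 0 = \<zero>" "snd \<nu> 24 0 = \<one>" "snd \<nu> 25 0 = \<one>" "snd \<nu> 26 0 = k"
          "snd \<nu> 27 0 = \<zero>" "fst \<nu> 6 = Suc (fst \<mu> 6)" "fst \<nu> 7 = fst \<mu> 7"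
        by blast
      show ?thesis unfolding e by (rule pg[OF k])
    next
      case 2
      then obtain k where k: "k \<in> carrier R" "dg \<oplus> k \<otimes> dh = \<zero>" "k = \<zero> \<or> fst \<mu> 7 + m \<le> fst \<mu> 6"
        and e: "snd \<nu> 22 0 = \<one>" "snd \<nu> 23 0 = k" "snd \<nu> 24 0 = \<zero>" "snd \<nu> 25 0 = \<ominus> (x [^] b)" "snd \<nu> 26 0 = \<zero>"
          "snd \<nu> 27 0 = \<one>" "fst \<nu> 6 = fst \<mu> 6" "fst \<nu> 7 = Suc (fst \<mu> 7)"
        by blast
      show ?thesis unfolding e by (rule ph[OF k])
    qed
    show ?thesis
    proof (rule runs_within_mono[OF decode_update_runs[OF arr'(1-4)]])
      show "snd \<nu> i 0 \<in> carrier R" if "i \<in> {22, 23, 24, 25, 26, 27}" for i by (rule cc[OF that])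
      show "g0 l = \<zero> \<and> g1 l = \<zero> \<and> h0 l = \<zero> \<and> h1 l = \<zero>" if "fst \<nu> 0 \<le> l" for l
        using z that arr'(5) by simp
      show "7 + 165 * (fst \<nu> 0 + 1) \<le> 7 + 165 * (N + 1)" using arr'(5) by simp
    next
      fix \<rho> assume Q: "frame {5} {10, 11, 12, 13, 28} \<nu> \<rho> \<and>
         snd \<rho> 10 = xmul (\<lambda>l. snd \<nu> 22 0 \<otimes> g0 l \<oplus> snd \<nu> 23 0 \<otimes> h0 l \<oplus> snd \<nu> 24 0 \<otimes> xmul g0 l) \<and>
         snd \<rho> 11 = xmul (\<lambda>l. snd \<nu> 22 0 \<otimes> g1 l \<oplus> snd \<nu> 23 0 \<otimes> h1 l \<oplus> snd \<nu> 24 0 \<otimes> xmul g1 l) \<and>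
         snd \<rho> 12 = xmul (\<lambda>l. snd \<nu> 25 0 \<otimes> h0 l \<oplus> snd \<nu> 26 0 \<otimes> g0 l \<oplus> snd \<nu> 27 0 \<otimes> xmul h0 l) \<and>
         snd \<rho> 13 = xmul (\<lambda>l. snd \<nu> 25 0 \<otimes> h1 l \<oplus> snd \<nu> 26 0 \<otimes> g1 l \<oplus> snd \<nu> 27 0 \<otimes> xmul h1 l)"
      have r6: "fst \<rho> 6 = fst \<nu> 6" "fst \<rho> 7 = fst \<nu> 7" using Q by (auto simp: frame_def)
      have "frame {5, 6, 7} {7, 10, 11, 12, 13, 20, 21, 22, 23, 24, 25, 26, 27, 28} \<mu> \<rho>"
        using Q P2 by (auto simp: frame_def)
      moreover have "?kg (\<lambda>l. snd \<nu> 22 0 \<otimes> g0 l \<oplus> snd \<nu> 23 0 \<otimes> h0 l \<oplus> snd \<nu> 24 0 \<otimes> xmul g0 l)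
        (\<lambda>l. snd \<nu> 22 0 \<otimes> g1 l \<oplus> snd \<nu> 23 0 \<otimes> h1 l \<oplus> snd \<nu> 24 0 \<otimes> xmul g1 l)
        (\<lambda>l. snd \<nu> 25 0 \<otimes> h0 l \<oplus> snd \<nu> 26 0 \<otimes> g0 l \<oplus> snd \<nu> 27 0 \<otimes> xmul h0 l)
        (\<lambda>l. snd \<nu> 25 0 \<otimes> h1 l \<oplus> snd \<nu> 26 0 \<otimes> g1 l \<oplus> snd \<nu> 27 0 \<otimes> xmul h1 l) (fst \<rho> 6) (fst \<rho> 7)"
        unfolding r6 by (rule kk)
      ultimately show "?P3 \<rho>" using conjunct2[OF Q] by (elim conjE) (intro conjI exI, assumption+)
    qed
  qed
  let ?last = "Seq (put 5 (FMul (scal 5) (scal 3))) (put 6 (FMul (scal 6) (scal 4)))"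
  have 4: "runs_within R ?last \<nu> (cost_bound ?last) (\<lambda>\<mu>'. decode_inv N m v x y (Suc b) \<mu>' \<and> fst \<mu>' 4 = b)"
    if P3: "?P3 \<nu>" for \<nu>
  proof (rule runs_within_straight)
    have f: "frame {5, 6, 7} {7, 10, 11, 12, 13, 20, 21, 22, 23, 24, 25, 26, 27, 28} \<mu> \<nu>"
      by (rule conjunct1[OF P3])
    from conjunct2[OF P3] obtain G0 G1 H0 H1 where A: "snd \<nu> 10 = xmul G0" "snd \<nu> 11 = xmul G1"
      "snd \<nu> 12 = xmul H0" "snd \<nu> 13 = xmul H1" "?kg G0 G1 H0 H1 (fst \<nu> 6) (fst \<nu> 7)"
      by (elim exE conjE)
    show "decode_inv N m v x y (Suc b) (run R ?last \<nu>) \<and> fst (run R ?last \<nu>) 4 = b"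
      unfolding decode_inv_def
      by (intro conjI exI[of _ G0] exI[of _ G1] exI[of _ H0] exI[of _ H1])
        (use A f st b4 in \<open>simp_all add: frame_def nat_pow_Suc\<close>)
  qed simp
  show ?thesis unfolding decode_body_def
    by (rule runs_within_le[OF runs_within_Seq[OF 1 runs_within_Seq[OF 2 runs_within_Seq[OF 3 4]]]]; (assumption | simp add: st))
qed

text \<open>In coefficient e + l of u * q, where q has degree at most e, the terms with i < l meet
  coefficients of q beyond e and vanish, and i = l contributes u_l q_e. So u_l is determined by the
  entries of u above l, and division proceeds from the top.\<close>

lemma conv_peel:
  assumes u: "\<And>i. i < m \<Longrightarrow> u i \<in> carrier R" and q: "\<And>l. q l \<in> carrier R"
    and e: "\<And>l. e < l \<Longrightarrow> q l = \<zero>" and l: "l < m"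
  shows "conv m u q (e + l) = conv m (\<lambda>i. if l < i \<and> i < m then u i else \<zero>) q (e + l) \<oplus> u l \<otimes> q e"
proof -
  let ?w = "\<lambda>i. if l < i \<and> i < m then u i else \<zero>"
  have "conv m u q (e + l) = (\<Oplus>i\<in>{..<m}. ?w i \<otimes> xmul q (Suc (e + l) - i) \<oplus> (if l = i then u l \<otimes> q e else \<zero>))"
    unfolding conv_def
  proof (rule finsum_cong')
    fix i assume i: "i \<in> {..<m}"
    consider "i < l" | "i = l" | "l < i" by linarith
    then show "u i \<otimes> xmul q (Suc (e + l) - i) =
        ?w i \<otimes> xmul q (Suc (e + l) - i) \<oplus> (if l = i then u l \<otimes> q e else \<zero>)"
    proof cases
      case 1
      then have "Suc (e + l) - i = Suc (e + l - i)" and "e < e + l - i" by auto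
      then show ?thesis using 1 i u e by simp
    qed (use i u q in auto)
  qed (use u q in \<open>auto intro!: Pi_I\<close>)
  also have "\<dots> = (\<Oplus>i\<in>{..<m}. ?w i \<otimes> xmul q (Suc (e + l) - i)) \<oplus> (\<Oplus>i\<in>{..<m}. if l = i then u l \<otimes> q e else \<zero>)"
    using u q l by (intro finsum_addf) (auto intro!: Pi_I)
  also have "(\<Oplus>i\<in>{..<m}. if l = i then u l \<otimes> q e else \<zero>) = u l \<otimes> q e"
    using u q l by (intro finsum_singleton) auto
  finally show ?thesis by (simp add: conv_def)
qed

lemma divide_inner_runs:
  assumes h1: "snd \<mu> 13 = xmul h1" "\<And>l. h1 l \<in> carrier R" and w: "\<And>i. snd \<mu> 2 i \<in> carrier R"
    and s: "snd \<mu> 8 0 = s" "s \<in> carrier R" and m: "fst \<mu> 1 = m"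
  shows "runs_within R divide_inner \<mu> (5 + 27 * m)
    (\<lambda>\<mu>'. frame {5} {8} \<mu> \<mu>' \<and> snd \<mu>' 8 0 = s \<oplus> conv m (snd \<mu> 2) h1 (fst \<mu> 7 + (m - 1 - fst \<mu> 4)))"
proof -
  let ?l = "fst \<mu> 7 + (m - 1 - fst \<mu> 4)"
  let ?J = "\<lambda>j \<rho>. frame {5} {8} \<mu> \<rho> \<and> fst \<rho> 5 = j \<and> snd \<rho> 8 0 = s \<oplus> conv j (snd \<mu> 2) h1 ?l"
  let ?p = "put 8 (FAdd (scal 8) (FMul (FCell 2 (IReg 5))
        (FCell 13 (ISub (IAdd (IAdd (IReg 7) tgt) (IConst 1)) (IReg 5)))))"
  have "runs_within R (For 5 (IReg 1) ?p) \<mu> (icost (IReg 1) + 4 + m * (cost_bound ?p + icost (IReg 1) + 6)) (?J m)"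
  proof (rule runs_within_For[where J = ?J])
    show "?J 0 ((fst \<mu>)(5 := 0), snd \<mu>)" using s by (simp add: frame_def conv_def)
  next
    fix j \<rho> assume "?J j \<rho>"
    then show "fst \<rho> 5 = j \<and> ival (IReg 1) \<rho> = m" using m by (simp add: frame_def)
  next
    fix j \<rho> assume J: "?J j \<rho>"
    have eq: "fst \<rho> 1 = m" "fst \<rho> 7 = fst \<mu> 7" "fst \<rho> 4 = fst \<mu> 4" "fst \<rho> 5 = j" "snd \<rho> 2 = snd \<mu> 2"
      "snd \<rho> 13 = xmul h1" "snd \<rho> 8 0 = s \<oplus> conv j (snd \<mu> 2) h1 ?l"
      using J m h1 by (auto simp: frame_def)
    have cx: "xmul h1 (Suc ?l - j) \<in> carrier R" "conv j (snd \<mu> 2) h1 ?l \<in> carrier R" using h1 w by auto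
    have "frame {5} {8} \<mu> ((fst (run R ?p \<rho>))(5 := Suc (fst (run R ?p \<rho>) 5)), snd (run R ?p \<rho>))"
      using J by (auto simp: frame_def)
    moreover have "snd (run R ?p \<rho>) 8 0 = s \<oplus> conv (Suc j) (snd \<mu> 2) h1 ?l"
      using eq cx s w h1 by (simp add: conv_Suc a_assoc)
    ultimately show "runs_within R ?p \<rho> (cost_bound ?p) (\<lambda>\<rho>'. ?J (Suc j) ((fst \<rho>')(5 := Suc (fst \<rho>' 5)), snd \<rho>'))"
      using eq(4) by (intro runs_within_straight) (simp_all del: run.simps, simp)
  qed
  then show ?thesis unfolding divide_inner_def by (rule runs_within_mono) auto
qed

text \<open>The quotient is described for every u that satisfies the key equation, and nothing is
  claimed if there is none. The loop therefore also runs, with values in the field, on words with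
  too many errors.\<close>

definition divide_inv :: "nat \<Rightarrow> nat \<Rightarrow> (nat \<Rightarrow> 'a) \<Rightarrow> (nat \<Rightarrow> 'a) \<Rightarrow> nat \<Rightarrow> 'a memory \<Rightarrow> bool" where
  "divide_inv m e h0 h1 b \<mu> \<longleftrightarrow> fst \<mu> 1 = m \<and> fst \<mu> 7 = e \<and> fst \<mu> 4 = b \<and>
     snd \<mu> 12 = xmul h0 \<and> snd \<mu> 13 = xmul h1 \<and> (\<forall>i. snd \<mu> 2 i \<in> carrier R) \<and>
     (\<forall>u. (\<forall>i<m. u i \<in> carrier R) \<and> (\<forall>l. h0 l \<oplus> conv m u h1 l = \<zero>) \<longrightarrow>
        snd \<mu> 2 = (\<lambda>i. if m \<le> i + b \<and> i < m then u i else \<zero>))"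

lemma divide_body_runs:
  assumes I: "divide_inv m e h0 h1 b \<mu>" and b: "b < m"
    and c: "\<And>l. h0 l \<in> carrier R" "\<And>l. h1 l \<in> carrier R"
    and e: "h1 e \<noteq> \<zero>" "\<And>l. e < l \<Longrightarrow> h1 l = \<zero>"
  shows "runs_within R divide_body \<mu> (33 + 27 * m)
    (\<lambda>\<mu>'. divide_inv m e h0 h1 (Suc b) ((fst \<mu>')(4 := Suc (fst \<mu>' 4)), snd \<mu>'))"
proof -
  let ?l = "m - 1 - b"
  let ?s = "h0 (e + ?l) \<oplus> conv m (snd \<mu> 2) h1 (e + ?l)"
  have st: "fst \<mu> 1 = m" "fst \<mu> 7 = e" "fst \<mu> 4 = b" "snd \<mu> 12 = xmul h0" "snd \<mu> 13 = xmul h1"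
    "\<And>i. snd \<mu> 2 i \<in> carrier R"
    using I by (auto simp: divide_inv_def)
  have sc: "?s \<in> carrier R" using c st by simp
  let ?first = "put 8 (FCell 12 (IAdd (IAdd (IReg 7) tgt) (IConst 1)))"
  let ?P1 = "\<lambda>\<rho>. frame {} {8} \<mu> \<rho> \<and> snd \<rho> 8 0 = h0 (e + ?l)"
  let ?P2 = "\<lambda>\<rho>. frame {5} {8} \<mu> \<rho> \<and> snd \<rho> 8 0 = ?s"
  let ?last = "FSet 2 tgt (FMul (FSub FZero (scal 8)) (FInv (FCell 13 (IAdd (IReg 7) (IConst 1)))))"
  have 1: "runs_within R ?first \<mu> (cost_bound ?first) ?P1"
    by (rule runs_within_straight) (use st in \<open>auto simp: frame_def\<close>)
  have 2: "runs_within R divide_inner \<rho> (5 + 27 * m) ?P2" if P1: "?P1 \<rho>" for \<rho>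
  proof -
    have eq: "snd \<rho> 13 = xmul h1" "snd \<rho> 2 = snd \<mu> 2" "fst \<rho> 1 = m" "fst \<rho> 7 = e" "fst \<rho> 4 = b"
      using P1 st by (auto simp: frame_def)
    show ?thesis
      by (rule runs_within_mono[OF divide_inner_runs[of \<rho> h1 "h0 (e + ?l)" m]])
        (use P1 st c eq in \<open>auto simp: frame_def\<close>)
  qed
  have 3: "runs_within R ?last \<rho> (cost_bound ?last)
     (\<lambda>\<mu>'. divide_inv m e h0 h1 (Suc b) ((fst \<mu>')(4 := Suc (fst \<mu>' 4)), snd \<mu>'))" if P2: "?P2 \<rho>" for \<rho>
  proof (rule runs_within_straight)
    have eq: "snd \<rho> 13 = xmul h1" "snd \<rho> 12 = xmul h0" "snd \<rho> 2 = snd \<mu> 2" "fst \<rho> 1 = m" "fst \<rho> 7 = e" "fst \<rho> 4 = b"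
      "snd \<rho> 8 0 = ?s"
      using P2 st by (auto simp: frame_def)
    have r: "run R ?last \<rho> = (fst \<rho>, (snd \<rho>)(2 := (snd \<mu> 2)(?l := \<ominus> ?s \<otimes> finv (h1 e))))"
      using eq sc by (simp add: fval_FInv minus_eq del: fval.simps(7))
    have "(snd \<mu> 2)(?l := \<ominus> ?s \<otimes> finv (h1 e)) = (\<lambda>i. if m \<le> i + Suc b \<and> i < m then u i else \<zero>)"
      if u: "\<forall>i<m. u i \<in> carrier R" and key: "\<forall>l. h0 l \<oplus> conv m u h1 l = \<zero>" for u
    proof -
      \<comment> \<open>The entries found so far are those of u above position m - 1 - b, which is
        what \<open>conv_peel\<close> needs to isolate the next unknown.\<close>
      have w: "snd \<mu> 2 = (\<lambda>i. if m \<le> i + b \<and> i < m then u i else \<zero>)"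
        using I u key by (auto simp: divide_inv_def)
      also have w': "\<dots> = (\<lambda>i. if ?l < i \<and> i < m then u i else \<zero>)" using b by (auto simp: fun_eq_iff)
      finally have "conv m u h1 (e + ?l) = conv m (snd \<mu> 2) h1 (e + ?l) \<oplus> u ?l \<otimes> h1 e"
        using u c e b conv_peel[of m u h1 e ?l] by simp
      moreover have "conv m (snd \<mu> 2) h1 (e + ?l) \<in> carrier R" "u ?l \<otimes> h1 e \<in> carrier R"
        using c st u b by auto
      ultimately have "?s \<oplus> u ?l \<otimes> h1 e = h0 (e + ?l) \<oplus> conv m u h1 (e + ?l)"
        using c by (simp only: a_assoc)
      then have "?s \<oplus> u ?l \<otimes> h1 e = \<zero>" using key by simp
      then have "\<ominus> ?s = u ?l \<otimes> h1 e" using sc c u b by (intro minus_equality) (auto simp: a_comm)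
      then have "\<ominus> ?s \<otimes> finv (h1 e) = u ?l" using c u b e finv_right[of "h1 e"] by (simp add: m_assoc)
      then show ?thesis unfolding w using b by (auto simp: fun_eq_iff)
    qed
    then show "divide_inv m e h0 h1 (Suc b) ((fst (run R ?last \<rho>))(4 := Suc (fst (run R ?last \<rho>) 4)), snd (run R ?last \<rho>))"
      unfolding r using eq st sc c by (simp add: divide_inv_def)
  qed simp
  show ?thesis unfolding divide_body_def
    by (rule runs_within_mono[OF runs_within_Seq[OF 1 runs_within_Seq[OF 2 3]]]) auto
qed

text \<open>The distance assumption is absent here: the conclusion only says that the program
  interpolates and then divides exactly when division is possible. That a nearby codeword makes it
  possible is the separate statement \<open>koetter_key_equation\<close>.\<close>

lemma decode_prog_runs:
  fixes \<mu> :: "'a memory"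
  assumes w: "snd \<mu> 0 0 = w" "w \<in> carrier R" and y: "\<And>j. snd \<mu> 1 j \<in> carrier R"
    and N: "fst \<mu> 0 = N" and m: "fst \<mu> 1 = m" "0 < m" and r: "fst \<mu> 6 = 0" "fst \<mu> 7 = 0"
    and z: "\<And>A. A \<in> {2, 10, 11, 12, 13} \<Longrightarrow> snd \<mu> A = (\<lambda>_. \<zero>)"
  shows "runs_within R decode_prog \<mu>
    (50 + 14 * (fst \<mu> 2 + fst \<mu> 3) + N * (187 + 227 * (N + 1)) + m * (40 + 27 * m))
    (\<lambda>\<mu>'. \<exists>g0 g1 h0 h1 a e. koetter N m (\<lambda>c. (w [^] fst \<mu> 2) [^] c) (snd \<mu> 1) (\<lambda>c. (w [^] fst \<mu> 3) [^] c) N g0 g1 h0 h1 a e \<and>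
      (\<forall>u. (\<forall>i<m. u i \<in> carrier R) \<and> (\<forall>l. h0 l \<oplus> conv m u h1 l = \<zero>) \<longrightarrow> (\<forall>j<m. snd \<mu>' 2 j = u j)))"
proof -
  let ?v = "w [^] fst \<mu> 2" and ?x = "w [^] fst \<mu> 3"
  let ?P1 = "\<lambda>\<mu>'. frame {5} {3, 4, 5, 6} \<mu> \<mu>' \<and> snd \<mu>' 3 0 = ?v \<and> snd \<mu>' 4 0 = ?x \<and>
    snd \<mu>' 5 0 = \<one> \<and> snd \<mu>' 6 0 = \<one>"
  let ?ini = "Seq (FSet 10 (IConst 1) FOne) (FSet 13 (IConst 1) FOne)"
  let ?P2 = "decode_inv N m ?v ?x (snd \<mu> 1) 0"
  let ?P3 = "\<lambda>\<rho>. decode_inv N m ?v ?x (snd \<mu> 1) N \<rho>"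
  have 1: "runs_within R init_powers \<mu> (22 + 14 * (fst \<mu> 2 + fst \<mu> 3)) ?P1"
    using init_powers_runs[of \<mu>] w by simp
  have 2: "runs_within R ?ini \<nu> (cost_bound ?ini) ?P2" if P: "?P1 \<nu>" for \<nu>
  proof (rule runs_within_straight)
    \<comment> \<open>In the shifted layout a one in cell 1 is the constant polynomial 1, so the
      initial pair is Q_g = 1 and Q_h = Y.\<close>
    have "(\<lambda>_. \<zero>)(1 := \<one>) = xmul (\<lambda>l. if l = 0 then \<one> else \<zero>)" "(\<lambda>_. \<zero>) = xmul (\<lambda>_. \<zero>)"
      by (auto simp: fun_eq_iff split: nat.split)
    then show "?P2 (run R ?ini \<nu>)"
      using P N m r z koetter_init[OF m(2), of N "\<lambda>c. ?v [^] c" "snd \<mu> 1" "\<lambda>c. ?x [^] c"]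
      unfolding decode_inv_def
      by (intro conjI exI[of _ "\<lambda>l. if l = 0 then \<one> else \<zero>"] exI[of _ "\<lambda>_. \<zero>"]) (auto simp: frame_def)
  qed simp
  let ?J = "\<lambda>b \<rho>. decode_inv N m ?v ?x (snd \<mu> 1) b \<rho> \<and> fst \<rho> 4 = b"
  have upd: "decode_inv N m ?v ?x (snd \<mu> 1) b ((fst \<rho>)(4 := k), snd \<rho>) = decode_inv N m ?v ?x (snd \<mu> 1) b \<rho>" for b \<rho> k
    by (simp add: decode_inv_def)
  have 3: "runs_within R (For 4 (IReg 0) decode_body) \<nu>
      (icost (IReg 0) + 4 + N * ((180 + 227 * (N + 1)) + icost (IReg 0) + 6)) (?J N)" if P: "?P2 \<nu>" for \<nu>
  proof (rule runs_within_For[where J = ?J])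
    show "?J 0 ((fst \<nu>)(4 := 0), snd \<nu>)" using P upd by simp
  next
    fix j \<rho> assume "?J j \<rho>"
    then show "fst \<rho> 4 = j \<and> ival (IReg 0) \<rho> = N" by (simp add: decode_inv_def)
  next
    fix j \<rho> assume j: "j < N" and J: "?J j \<rho>"
    show "runs_within R decode_body \<rho> (180 + 227 * (N + 1)) (\<lambda>\<rho>'. ?J (Suc j) ((fst \<rho>')(4 := Suc (fst \<rho>' 4)), snd \<rho>'))"
      by (rule runs_within_mono[OF decode_body_runs[of N m ?v ?x "snd \<mu> 1" j]]) (use J j w y upd in auto)
  qed
  let ?Q = "\<lambda>\<mu>'. \<exists>g0 g1 h0 h1 a e. koetter N m (\<lambda>c. ?v [^] c) (snd \<mu> 1) (\<lambda>c. ?x [^] c) N g0 g1 h0 h1 a e \<and>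
      (\<forall>u. (\<forall>i<m. u i \<in> carrier R) \<and> (\<forall>l. h0 l \<oplus> conv m u h1 l = \<zero>) \<longrightarrow> (\<forall>j<m. snd \<mu>' 2 j = u j))"
  have 4: "runs_within R (For 4 (IReg 1) divide_body) \<nu>
      (icost (IReg 1) + 4 + m * ((33 + 27 * m) + icost (IReg 1) + 6)) ?Q" if P: "?J N \<nu>" for \<nu>
  proof -
    obtain g0 g1 h0 h1 where K: "koetter N m (\<lambda>c. ?v [^] c) (snd \<mu> 1) (\<lambda>c. ?x [^] c) N g0 g1 h0 h1 (fst \<nu> 6) (fst \<nu> 7)"
      and arr: "snd \<nu> 12 = xmul h0" "snd \<nu> 13 = xmul h1"
      using P by (auto simp: decode_inv_def)
    let ?e = "fst \<nu> 7"
    have st: "fst \<nu> 1 = m" "snd \<nu> 2 = (\<lambda>_. \<zero>)" using P by (auto simp: decode_inv_def)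
    have h: "\<And>l. h0 l \<in> carrier R" "\<And>l. h1 l \<in> carrier R" "h1 ?e \<noteq> \<zero>" "\<And>l. ?e < l \<Longrightarrow> h1 l = \<zero>"
      using K by (auto simp: koetter_def)
    have "runs_within R (For 4 (IReg 1) divide_body) \<nu>
      (icost (IReg 1) + 4 + m * ((33 + 27 * m) + icost (IReg 1) + 6)) (divide_inv m ?e h0 h1 m)"
    proof (rule runs_within_For[where J = "divide_inv m ?e h0 h1"])
      show "divide_inv m ?e h0 h1 0 ((fst \<nu>)(4 := 0), snd \<nu>)"
        using st arr by (auto simp: divide_inv_def fun_eq_iff)
    next
      fix j \<rho> assume "divide_inv m ?e h0 h1 j \<rho>"
      then show "fst \<rho> 4 = j \<and> ival (IReg 1) \<rho> = m" by (simp add: divide_inv_def)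
    next
      fix j \<rho> assume j: "j < m" and J: "divide_inv m ?e h0 h1 j \<rho>"
      show "runs_within R divide_body \<rho> (33 + 27 * m)
        (\<lambda>\<rho>'. divide_inv m ?e h0 h1 (Suc j) ((fst \<rho>')(4 := Suc (fst \<rho>' 4)), snd \<rho>'))"
        by (rule divide_body_runs[OF J j h])
    qed
    then show ?thesis
    proof (rule runs_within_mono)
      fix \<rho> assume D: "divide_inv m ?e h0 h1 m \<rho>"
      have "\<forall>u. (\<forall>i<m. u i \<in> carrier R) \<and> (\<forall>l. h0 l \<oplus> conv m u h1 l = \<zero>) \<longrightarrow> (\<forall>j<m. snd \<rho> 2 j = u j)"
        using D by (auto simp: divide_inv_def)
      then show "?Q \<rho>" using K by blast
    qed simp
  qed
  show ?thesis unfolding decode_prog_def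
    by (rule runs_within_le[OF runs_within_Seq[OF 1 runs_within_Seq[OF 2 runs_within_Seq[OF 3 4]]]]; (assumption | simp))
qed

end

section \<open>Codes generated by rows of a Fourier matrix\<close>

context field
begin

lemma root_of_unity_nonzero:
  assumes "primitive_root_of_unity R N w" and "0 < N"
  shows "w \<in> carrier R" and "w \<noteq> \<zero>"
proof -
  show w: "w \<in> carrier R" using assms by (simp add: primitive_root_of_unity_def)
  show "w \<noteq> \<zero>"
    using assms nat_pow_zero[of N] one_not_zero by (auto simp: primitive_root_of_unity_def)
qed

lemma pow_nonzero: "x \<in> carrier R \<Longrightarrow> x \<noteq> \<zero> \<Longrightarrow> x [^] (n :: nat) \<noteq> \<zero>"
  by (induction n) (auto simp: nat_pow_Suc integral_iff)

lemma root_of_unity_pow_mod: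
  assumes "primitive_root_of_unity R N w"
  shows "w [^] (j mod N) = w [^] j"
proof -
  have w: "w \<in> carrier R" "w [^] N = \<one>" using assms by (auto simp: primitive_root_of_unity_def)
  have "w [^] j = w [^] (N * (j div N) + j mod N)" by simp
  also have "\<dots> = (w [^] N) [^] (j div N) \<otimes> w [^] (j mod N)"
    using w(1) by (simp only: nat_pow_mult nat_pow_pow)
  finally show ?thesis using w by simp
qed

lemma root_of_unity_dvd:
  assumes "primitive_root_of_unity R N w" and "0 < N" and "w [^] j = \<one>"
  shows "N dvd j"
proof (rule ccontr)
  assume "\<not> N dvd j"
  then have "1 \<le> j mod N" "j mod N < N" using assms(2) by (auto simp: dvd_eq_mod_eq_0)
  then have "w [^] (j mod N) \<noteq> \<one>" using assms(1) by (auto simp: primitive_root_of_unity_def)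
  then show False using root_of_unity_pow_mod[OF assms(1)] assms(3) by simp
qed

lemma root_of_unity_points_inj:
  assumes w: "primitive_root_of_unity R N w" "0 < N" and k: "coprime N k"
  shows "inj_on (\<lambda>b. (w [^] k) [^] b) {..<N}"
proof -
  note wc = root_of_unity_nonzero[OF w]
  have neq: False if "b < c" "c < N" "(w [^] k) [^] b = (w [^] k) [^] c" for b c
  proof -
    have "(w [^] k) [^] b \<otimes> w [^] (k * (c - b)) = w [^] (k * b + k * (c - b))"
      using wc by (simp add: nat_pow_pow nat_pow_mult)
    also have "k * b + k * (c - b) = k * c" using that(1) by (simp flip: distrib_left)
    also have "w [^] (k * c) = (w [^] k) [^] b \<otimes> \<one>" using that(3) wc by (simp add: nat_pow_pow)
    finally have "(w [^] k) [^] b \<otimes> w [^] (k * (c - b)) = (w [^] k) [^] b \<otimes> \<one>" .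
    then have "w [^] (k * (c - b)) = \<one>"
      using wc m_lcancel[of "(w [^] k) [^] b" "w [^] (k * (c - b))" \<one>]
        pow_nonzero[of "w [^] k" b] pow_nonzero[of w k] by auto
    then have "N dvd k * (c - b)" by (rule root_of_unity_dvd[OF w])
    then have "N dvd c - b" using k by (simp add: coprime_dvd_mult_right_iff)
    then show False using that dvd_imp_le[of N "c - b"] by simp
  qed
  show ?thesis
  proof (rule inj_onI)
    fix b c assume "b \<in> {..<N}" "c \<in> {..<N}" "(w [^] k) [^] b = (w [^] k) [^] c"
    then show "b = c" using neq[of b c] neq[of c b] by (cases b c rule: linorder_cases) auto
  qed
qed

text \<open>Splitting the exponent (s + j k) b exhibits the generator matrix as a Vandermonde matrix
  in the points w^(k b) with column b scaled by w^(s b). Reduction of row indices modulo N is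
  harmless since w^N = 1.\<close>

lemma arith_row_apply:
  assumes w: "primitive_root_of_unity R N w" and b: "b < N"
  shows "arith_row R N w s k j b = (w [^] s) [^] b \<otimes> ((w [^] k) [^] b) [^] j"
proof -
  have wc: "w \<in> carrier R" using w by (simp add: primitive_root_of_unity_def)
  have "arith_row R N w s k j b = (w [^] ((s + j * k) mod N)) [^] b"
    using b wc by (simp add: arith_row_def fourier_row_def fourier_matrix_def nat_pow_pow)
  also have "\<dots> = (w [^] (s + j * k)) [^] b" by (simp add: root_of_unity_pow_mod[OF w])
  also have "\<dots> = (w [^] s) [^] b \<otimes> ((w [^] k) [^] b) [^] j"
    using wc by (simp add: nat_pow_pow nat_pow_mult algebra_simps)
  finally show ?thesis .
qed

lemma arith_row_carrier:
  assumes "w \<in> carrier R"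
  shows "arith_row R N w s k j \<in> carrier (func_space {..<N})"
  using assms by (auto simp: arith_row_def fourier_row_def fourier_matrix_def func_space_def)

lemma func_space_finsum_apply:
  assumes "finite A" and "f \<in> A \<rightarrow> carrier (func_space S)" and "b \<in> S"
  shows "(\<Oplus>\<^bsub>func_space S\<^esub> j\<in>A. f j) b = (\<Oplus>j\<in>A. f j b)"
proof -
  interpret W: module R "func_space S" by (rule func_space_is_module)
  show ?thesis
    using assms(1,2)
  proof (induction A)
    case empty
    have "(\<Oplus>\<^bsub>func_space S\<^esub> j\<in>{}. f j) = \<zero>\<^bsub>func_space S\<^esub>" by simp
    then show ?case using \<open>b \<in> S\<close> by (simp only: finsum_empty) (simp add: func_space_def)
  next
    case (insert j A)
    have fb: "f i b \<in> carrier R" if "i \<in> insert j A" for i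
      using insert.prems that \<open>b \<in> S\<close> by (auto simp: func_space_def)
    have "(\<Oplus>\<^bsub>func_space S\<^esub> j\<in>insert j A. f j) = f j \<oplus>\<^bsub>func_space S\<^esub> (\<Oplus>\<^bsub>func_space S\<^esub> j\<in>A. f j)"
      using insert by (intro W.finsum_insert) auto
    moreover have "(f j \<oplus>\<^bsub>func_space S\<^esub> (\<Oplus>\<^bsub>func_space S\<^esub> j\<in>A. f j)) b = f j b \<oplus> (\<Oplus>\<^bsub>func_space S\<^esub> j\<in>A. f j) b"
      using \<open>b \<in> S\<close> by (simp add: func_space_def)
    moreover have "(\<Oplus>j\<in>insert j A. f j b) = f j b \<oplus> (\<Oplus>j\<in>A. f j b)"
      using insert fb by (intro finsum_insert) auto
    ultimately show ?case using insert by auto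
  qed
qed

lemma fourier_encode_apply:
  assumes w: "primitive_root_of_unity R N w" and b: "b < N" and u: "\<And>j. j < m \<Longrightarrow> u j \<in> carrier R"
  shows "fourier_encode R N m w s k u b = (w [^] s) [^] b \<otimes> poly_sum m u ((w [^] k) [^] b)"
proof -
  have wc: "w \<in> carrier R" using w by (simp add: primitive_root_of_unity_def)
  interpret W: module R "func_space {..<N}" by (rule func_space_is_module)
  let ?x = "(w [^] k) [^] b"
  have "fourier_encode R N m w s k u b =
      (\<Oplus>j\<in>{..<m}. (u j \<odot>\<^bsub>func_space {..<N}\<^esub> arith_row R N w s k j) b)"
    unfolding fourier_encode_def using u b arith_row_carrier[OF wc]
    by (intro func_space_finsum_apply) (auto intro!: W.smult_closed)
  also have "\<dots> = (\<Oplus>j\<in>{..<m}. (w [^] s) [^] b \<otimes> (u j \<otimes> ?x [^] j))"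
  proof (rule finsum_cong')
    fix j assume "j \<in> {..<m}"
    then show "(u j \<odot>\<^bsub>func_space {..<N}\<^esub> arith_row R N w s k j) b = (w [^] s) [^] b \<otimes> (u j \<otimes> ?x [^] j)"
      using b u[of j] wc arith_row_apply[OF w b] by (simp add: func_space_def m_lcomm)
  qed (use u wc in \<open>auto intro!: Pi_I\<close>)
  also have "\<dots> = (w [^] s) [^] b \<otimes> poly_sum m u ?x"
    unfolding poly_sum_def using u wc by (intro finsum_rdistr[symmetric]) (auto intro!: Pi_I)
  finally show ?thesis .
qed

text \<open>The product of the factors X - x_b. For d = m - 1 it is a message whose codeword attains
  the minimum distance.\<close>

lemma exists_poly_with_roots:
  assumes x: "\<And>b. b < d \<Longrightarrow> x b \<in> carrier R"
  shows "\<exists>p. (\<forall>l. p l \<in> carrier R) \<and> p d = \<one> \<and> (\<forall>l>d. p l = \<zero>) \<and> (\<forall>b<d. poly_sum (Suc d) p (x b) = \<zero>)"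
  using x
proof (induction d)
  case 0
  then show ?case by (intro exI[of _ "\<lambda>l. if l = 0 then \<one> else \<zero>"]) auto
next
  case (Suc d)
  then obtain p where p: "\<And>l. p l \<in> carrier R" "p d = \<one>" "\<And>l. d < l \<Longrightarrow> p l = \<zero>"
    and r: "\<And>b. b < d \<Longrightarrow> poly_sum (Suc d) p (x b) = \<zero>" by fastforce
  have xd: "x d \<in> carrier R" using Suc.prems by simp
  let ?q = "\<lambda>l. \<ominus> x d \<otimes> p l \<oplus> xmul p l"
  have "poly_sum (Suc (Suc d)) ?q (x b) = \<zero>" if "b < Suc d" for b
  proof -
    have xb: "x b \<in> carrier R" using that Suc.prems by simp
    have P: "poly_sum (Suc d) p (x b) \<in> carrier R" using p xb by simp
    have "poly_sum (Suc (Suc d)) p (x b) = poly_sum (Suc d) p (x b)"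
      using p xb by (intro poly_sum_extend) auto
    moreover have "poly_sum (Suc (Suc d)) (xmul p) (x b) = x b \<otimes> poly_sum (Suc d) p (x b)"
      using p xb by (intro poly_sum_xmul_Suc) auto
    moreover have "poly_sum (Suc (Suc d)) ?q (x b) =
        \<ominus> x d \<otimes> poly_sum (Suc (Suc d)) p (x b) \<oplus> poly_sum (Suc (Suc d)) (xmul p) (x b)"
      using p xb xd by (simp only: poly_sum_add poly_sum_smult xmul_closed m_closed a_inv_closed)
    ultimately have "poly_sum (Suc (Suc d)) ?q (x b) =
        \<ominus> x d \<otimes> poly_sum (Suc d) p (x b) \<oplus> x b \<otimes> poly_sum (Suc d) p (x b)" by simp
    then show ?thesis using P xb xd r that by (cases "b = d") (auto simp: l_minus l_neg)
  qed
  moreover have "xmul p l = \<zero>" if "Suc d < l" for l using that p(3) by (cases l) auto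
  ultimately show ?case using p xd by (intro exI[of _ ?q]) auto
qed

end

section \<open>The code of one arithmetic sequence of rows\<close>

locale fourier_rows = field +
  fixes N m :: nat and w :: 'a and s k :: nat
  assumes finite_carrier: "finite (carrier R)"
    and prim: "primitive_root_of_unity R N w" and coprime: "coprime N k"
    and m_pos: "0 < m" and m_le: "m \<le> N"
begin

abbreviation pt :: "nat \<Rightarrow> 'a" where
  "pt b \<equiv> (w [^] k) [^] b"

abbreviation enc :: "(nat \<Rightarrow> 'a) \<Rightarrow> nat \<Rightarrow> 'a" where
  "enc \<equiv> fourier_encode R N m w s k"

abbreviation row :: "nat \<Rightarrow> nat \<Rightarrow> 'a" where
  "row \<equiv> arith_row R N w s k"

lemma N_pos: "0 < N" using m_pos m_le by simp

lemma w_carrier [simp]: "w \<in> carrier R" and w_nonzero: "w \<noteq> \<zero>"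
  using root_of_unity_nonzero[OF prim N_pos] by auto

lemma inj_pt: "inj_on pt {..<N}"
  by (rule root_of_unity_points_inj[OF prim N_pos coprime])

lemma scale_nonzero: "(w [^] s) [^] (b :: nat) \<noteq> \<zero>"
  using w_nonzero by (intro pow_nonzero) auto

lemma enc_eq_0_iff:
  assumes "\<And>j. j < m \<Longrightarrow> u j \<in> carrier R" and "b < N"
  shows "enc u b = \<zero> \<longleftrightarrow> poly_sum m u (pt b) = \<zero>"
  using assms scale_nonzero by (simp add: fourier_encode_apply[OF prim] integral_iff)

text \<open>The source of both parameters of the code: with all positions it gives linear
  independence of the rows, and with the zero positions of a codeword it gives the weight
  bound.\<close>

lemma coeffs_zero:
  assumes u: "\<And>j. j < m \<Longrightarrow> u j \<in> carrier R" and B: "B \<subseteq> {..<N}" "m \<le> card B"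
    and z: "\<And>b. b \<in> B \<Longrightarrow> enc u b = \<zero>" and j: "j < m"
  shows "u j = \<zero>"
proof -
  let ?u = "\<lambda>j. if j < m then u j else \<zero>"
  have "?u j = \<zero>"
  proof (rule poly_sum_roots[OF finite_carrier _ _ _ _ j])
    show "?u l \<in> carrier R" for l using u by simp
    show "pt ` B \<subseteq> carrier R" by auto
    show "m \<le> card (pt ` B)"
      using B card_image[OF inj_on_subset[OF inj_pt B(1)]] by simp
    fix z' assume "z' \<in> pt ` B"
    then obtain b where b: "b \<in> B" "z' = pt b" by auto
    have "poly_sum m u (pt b) = \<zero>" using z[OF b(1)] enc_eq_0_iff[OF u] b B by auto
    moreover have "poly_sum m ?u (pt b) = poly_sum m u (pt b)" using u by (intro poly_sum_cong) auto
    ultimately show "poly_sum m ?u z' = \<zero>" using b by simp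
  qed
  then show ?thesis using j by simp
qed

text \<open>The code is the span of a set of rows; injectivity lets linear combinations over that
  set be indexed by messages, and makes the basis have m elements.\<close>

lemma row_inj: "inj_on row {..<m}"
proof (rule inj_onI)
  fix i j assume ij: "i \<in> {..<m}" "j \<in> {..<m}" and eq: "row i = row j"
  show "i = j"
  \<comment> \<open>Rows are told apart by their entries in column 1, where row j is a nonzero
    factor times the j-th evaluation point. For N = 1 that column is missing, but then there is only
    one row.\<close>
  proof (cases "N = 1")
    case True
    then show ?thesis using ij m_le by auto
  next
    case False
    then have "1 < N" using N_pos by simp
    then have "(w [^] s) [^] (1::nat) \<otimes> pt 1 [^] i = (w [^] s) [^] (1::nat) \<otimes> pt 1 [^] j"
      using eq arith_row_apply[OF prim, of 1] by metis
    then have "pt i = pt j"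
      using scale_nonzero[of 1] by (simp add: m_lcancel)
    then show ?thesis using inj_onD[OF inj_pt, of i j] ij m_le by auto
  qed
qed

sublocale W: vectorspace R "func_space {..<N}"
  by (intro vectorspace.intro func_space_is_module field_axioms)

lemma rows_carrier: "row ` {..<m} \<subseteq> carrier (func_space {..<N})"
  using arith_row_carrier[of w] by auto

lemma lincomb_rows:
  assumes "a \<in> row ` {..<m} \<rightarrow> carrier R"
  shows "W.lincomb a (row ` {..<m}) = enc (a \<circ> row)"
  unfolding W.lincomb_def fourier_encode_def
  using assms rows_carrier row_inj
  by (subst W.M.finsum_reindex) (auto intro!: W.smult_closed simp: Pi_iff image_subset_iff)

lemma code_eq: "fourier_code R N m w s k = enc ` {u. \<forall>j<m. u j \<in> carrier R}"
proof
  show "fourier_code R N m w s k \<subseteq> enc ` {u. \<forall>j<m. u j \<in> carrier R}"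
    unfolding fourier_code_def W.finite_span[OF finite_imageI[OF finite_lessThan] rows_carrier]
    using lincomb_rows by (auto simp: Pi_iff)
  show "enc ` {u. \<forall>j<m. u j \<in> carrier R} \<subseteq> fourier_code R N m w s k"
  proof
    fix x assume "x \<in> enc ` {u. \<forall>j<m. u j \<in> carrier R}"
    then obtain u where u: "\<And>j. j < m \<Longrightarrow> u j \<in> carrier R" and x: "x = enc u" by auto
    \<comment> \<open>Coefficients of a linear combination are indexed by row vectors, so the
      message is transported along the inverse of \<open>row\<close>.\<close>
    define a where "a = u \<circ> inv_into {..<m} row"
    have ar: "a (row j) = u j" if "j < m" for j using that row_inj by (simp add: a_def)
    then have a: "a \<in> row ` {..<m} \<rightarrow> carrier R" using u by auto
    have "enc (a \<circ> row) = enc u"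
      unfolding fourier_encode_def using u ar rows_carrier
      by (intro W.M.finsum_cong') (auto intro!: W.smult_closed)
    then show "x \<in> fourier_code R N m w s k"
      unfolding fourier_code_def W.finite_span[OF finite_imageI[OF finite_lessThan] rows_carrier]
      using a lincomb_rows[OF a] x by (intro CollectI exI[of _ a] conjI) simp_all
  qed
qed

lemma linear_code: "linear_code R N m (fourier_code R N m w s k)"
proof -
  let ?S = "row ` {..<m}" and ?C = "fourier_code R N m w s k"
  have sub: "subspace R ?C (func_space {..<N})"
    unfolding fourier_code_def by (rule W.span_is_subspace[OF rows_carrier])
  interpret C: vectorspace R "(func_space {..<N})\<lparr>carrier := ?C\<rparr>"
    by (rule W.subspace_is_vs[OF sub])
  have SC: "?S \<subseteq> ?C" unfolding fourier_code_def by (rule W.in_own_span[OF rows_carrier])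
  have sm: "submodule R ?C (func_space {..<N})" using sub by simp
  have "W.lin_indpt ?S"
  proof (rule W.finite_lin_indpt2)
    fix a assume a: "a \<in> ?S \<rightarrow> carrier R" and 0: "W.lincomb a ?S = \<zero>\<^bsub>func_space {..<N}\<^esub>"
    have "enc (a \<circ> row) b = \<zero>" if "b < N" for b
      using 0 that unfolding lincomb_rows[OF a] by (simp add: func_space_def)
    then have "(a \<circ> row) j = \<zero>" if "j < m" for j
      using that a m_le by (intro coeffs_zero[of "a \<circ> row" "{..<N}"]) auto
    then show "\<forall>v\<in>?S. a v = \<zero>" by auto
  qed (use rows_carrier in auto)
  then have "C.basis ?S"
    unfolding C.basis_def using W.span_li_not_depend[OF SC sm] SC
    by (auto simp: fourier_code_def)
  then have "C.dim = card ?S" by (intro C.dim_basis) auto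
  then show ?thesis
    using sub card_image[OF row_inj] by (simp add: linear_code_def code_dim_def)
qed

lemma weight_ge:
  assumes u: "\<And>j. j < m \<Longrightarrow> u j \<in> carrier R" and nz: "i < m" "u i \<noteq> \<zero>"
  shows "N - m + 1 \<le> hamming_weight R N (enc u)"
proof -
  let ?Z = "{b. b < N \<and> enc u b = \<zero>}"
  have "card ?Z < m"
  proof (rule ccontr)
    assume "\<not> card ?Z < m"
    then have "u i = \<zero>" using nz(1) by (intro coeffs_zero[OF u, where B = ?Z]) auto
    then show False using nz(2) by simp
  qed
  moreover have "{b. b < N \<and> enc u b \<noteq> \<zero>} = {..<N} - ?Z" by auto
  then have "hamming_weight R N (enc u) = N - card ?Z"
    unfolding hamming_weight_def by (simp add: card_Diff_subset subset_eq)
  ultimately show ?thesis using m_le by simp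
qed

lemma distance: "code_distance R N (fourier_code R N m w s k) = N - m + 1"
  unfolding code_distance_def
proof (rule Least_equality)
  \<comment> \<open>The zeros are placed at the first m - 1 points. The codeword is then supported
    on the remaining N - m + 1 positions, which matches the lower bound.\<close>
  obtain p where p: "\<And>l. p l \<in> carrier R" "p (m - 1) = \<one>" "\<And>b. b < m - 1 \<Longrightarrow> poly_sum m p (pt b) = \<zero>"
    using exists_poly_with_roots[of "m - 1" pt] m_pos by auto
  have ge: "N - m + 1 \<le> hamming_weight R N (enc p)"
    using p m_pos by (intro weight_ge[of p "m - 1"]) auto
  have "{b. b < N \<and> enc p b \<noteq> \<zero>} \<subseteq> {m - 1..<N}"
    using p enc_eq_0_iff[of p] by (auto simp: not_less[symmetric])
  then have "hamming_weight R N (enc p) \<le> card {m - 1..<N}"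
    unfolding hamming_weight_def by (intro card_mono) auto
  then have eq: "hamming_weight R N (enc p) = N - m + 1" using ge m_pos m_le by simp
  have "enc p \<noteq> \<zero>\<^bsub>func_space {..<N}\<^esub>"
  proof
    assume 0: "enc p = \<zero>\<^bsub>func_space {..<N}\<^esub>"
    have "enc p b = \<zero>" if "b < N" for b
      using that unfolding 0 by (simp add: func_space_def)
    then have "hamming_weight R N (enc p) = 0" by (auto simp: hamming_weight_def)
    then show False using eq by simp
  qed
  moreover have "enc p \<in> fourier_code R N m w s k" unfolding code_eq using p by auto
  ultimately show "\<exists>x\<in>fourier_code R N m w s k. x \<noteq> \<zero>\<^bsub>func_space {..<N}\<^esub> \<and> N - m + 1 = hamming_weight R N x"
    using eq by metis
next
  fix d assume "\<exists>x\<in>fourier_code R N m w s k. x \<noteq> \<zero>\<^bsub>func_space {..<N}\<^esub> \<and> d = hamming_weight R N x"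
  then obtain u where u: "\<And>j. j < m \<Longrightarrow> u j \<in> carrier R" and nz: "enc u \<noteq> \<zero>\<^bsub>func_space {..<N}\<^esub>"
    and d: "d = hamming_weight R N (enc u)" unfolding code_eq by auto
  have "\<exists>i<m. u i \<noteq> \<zero>"
  proof (rule ccontr)
    assume "\<not> (\<exists>i<m. u i \<noteq> \<zero>)"
    then have 0: "u i = \<zero>" if "i < m" for i using that by auto
    have "enc u = \<zero>\<^bsub>func_space {..<N}\<^esub>"
      unfolding fourier_encode_def using 0 rows_carrier
      by (intro W.M.finsum_all0) auto
    then show False using nz by simp
  qed
  then show "N - m + 1 \<le> d" using weight_ge[OF u] d by auto
qed

lemma mds: "mds_code R N m (fourier_code R N m w s k)"
  using linear_code distance by (simp add: mds_code_def)

lemma encodes: "encodes_within R N m w s k encode_prog (1000 * real N ^ 2)"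
  unfolding encodes_within_def
proof
  fix u assume u: "u \<in> {..<m} \<rightarrow>\<^sub>E carrier R"
  let ?\<mu> = "load R N m w s k m u"
  have st: "snd ?\<mu> 0 0 = w" "fst ?\<mu> 0 = N" "fst ?\<mu> 1 = m" "fst ?\<mu> 2 = s mod N" "fst ?\<mu> 3 = k mod N"
    "snd ?\<mu> 1 = (\<lambda>j. if j < m then u j else \<zero>)"
    by (auto simp: load_def)
  have "runs_within R encode_prog ?\<mu>
    (27 + 14 * (s mod N + k mod N) + N * (39 + 24 * m))
    (\<lambda>\<mu>'. \<forall>b<N. snd \<mu>' 2 b = (w [^] (s mod N)) [^] b \<otimes>
       poly_sum m (\<lambda>j. if j < m then u j else \<zero>) ((w [^] (k mod N)) [^] b))"
  proof -
    have "snd ?\<mu> 0 0 \<in> carrier R" unfolding st by simp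
    moreover have "snd ?\<mu> 1 j \<in> carrier R" for j unfolding st using u by auto
    ultimately show ?thesis using encode_prog_runs[of ?\<mu>] unfolding st by blast
  qed
  then obtain \<tau> \<mu>' where e: "exec R encode_prog ?\<mu> \<tau> \<mu>'"
    and t: "\<tau> \<le> 27 + 14 * (s mod N + k mod N) + N * (39 + 24 * m)"
    and out': "\<forall>b<N. snd \<mu>' 2 b = (w [^] s) [^] b \<otimes> poly_sum m (\<lambda>j. if j < m then u j else \<zero>) (pt b)"
    unfolding runs_within_def root_of_unity_pow_mod[OF prim] by (elim exE conjE)
  have out: "snd \<mu>' 2 b = (w [^] s) [^] b \<otimes> poly_sum m (\<lambda>j. if j < m then u j else \<zero>) (pt b)"
    if "b < N" for b using out' that by simp
  have "snd \<mu>' 2 b = enc u b" if b: "b < N" for b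
  proof -
    have "poly_sum m (\<lambda>j. if j < m then u j else \<zero>) (pt b) = poly_sum m u (pt b)"
      using u by (intro poly_sum_cong) auto
    moreover have "enc u b = (w [^] s) [^] b \<otimes> poly_sum m u (pt b)"
      using u by (intro fourier_encode_apply[OF prim b]) auto
    ultimately show ?thesis using out[OF b] by simp
  qed
  moreover have "real \<tau> \<le> 1000 * real N ^ 2"
  proof -
    \<comment> \<open>Every term is crudely raised to a multiple of N^2. The coefficients add up to
      118, and 1000 is used so as to share one bound with the decoder.\<close>
    have "s mod N \<le> N * N" "k mod N \<le> N * N"
      using N_pos by (auto intro!: order_trans[OF less_imp_le[OF mod_less_divisor] le_square])
    then have "\<tau> \<le> 27 * (N * N) + 14 * (N * N + N * N) + N * (39 * N + 24 * N)"
      using t m_le N_pos by (elim order_trans) (intro add_mono mult_mono; simp)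
    also have "\<dots> \<le> 1000 * N ^ 2" by (simp add: power2_eq_square)
    finally have "real \<tau> \<le> real (1000 * N ^ 2)" by (simp only: of_nat_le_iff)
    then show ?thesis by simp
  qed
  ultimately show "\<exists>\<tau> \<mu>'. exec R encode_prog ?\<mu> \<tau> \<mu>' \<and> real \<tau> \<le> 1000 * real N ^ 2 \<and> (\<forall>b<N. snd \<mu>' 2 b = enc u b)"
    using e by blast
qed

lemma decodes:
  assumes t: "2 * t \<le> N - m"
  shows "decodes_within R N m w s k t decode_prog (1000 * real N ^ 2)"
  unfolding decodes_within_def
proof
  fix y assume y: "y \<in> {..<N} \<rightarrow>\<^sub>E carrier R"
  let ?\<mu> = "load R N m w s k N y" and ?y = "\<lambda>j. if j < N then y j else \<zero>"
  have st: "snd ?\<mu> 0 0 = w" "fst ?\<mu> 0 = N" "fst ?\<mu> 1 = m" "fst ?\<mu> 2 = s mod N" "fst ?\<mu> 3 = k mod N"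
    "snd ?\<mu> 1 = ?y" "fst ?\<mu> 6 = 0" "fst ?\<mu> 7 = 0"
    and st2: "\<And>A. A \<in> {2, 10, 11, 12, 13} \<Longrightarrow> snd ?\<mu> A = (\<lambda>_. \<zero>)"
    by (auto simp: load_def)
  have yN: "y j \<in> carrier R" if "j < N" for j using y that by auto
  then have yc: "?y j \<in> carrier R" for j by simp
  have "runs_within R decode_prog ?\<mu>
    (50 + 14 * (s mod N + k mod N) + N * (187 + 227 * (N + 1)) + m * (40 + 27 * m))
    (\<lambda>\<mu>'. \<exists>g0 g1 h0 h1 a e. koetter N m (\<lambda>c. (w [^] s) [^] c) ?y pt N g0 g1 h0 h1 a e \<and>
      (\<forall>u. (\<forall>i<m. u i \<in> carrier R) \<and> (\<forall>l. h0 l \<oplus> conv m u h1 l = \<zero>) \<longrightarrow> (\<forall>j<m. snd \<mu>' 2 j = u j)))"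
  proof -
    have "snd ?\<mu> 1 j \<in> carrier R" for j unfolding st using yc .
    from decode_prog_runs[OF st(1) w_carrier this st(2,3) m_pos st(7,8) st2]
    show ?thesis unfolding st root_of_unity_pow_mod[OF prim] .
  qed
  then obtain \<tau> \<mu>' g0 g1 h0 h1 a e where ex: "exec R decode_prog ?\<mu> \<tau> \<mu>'"
    and \<tau>: "\<tau> \<le> 50 + 14 * (s mod N + k mod N) + N * (187 + 227 * (N + 1)) + m * (40 + 27 * m)"
    and K: "koetter N m (\<lambda>c. (w [^] s) [^] c) ?y pt N g0 g1 h0 h1 a e"
    and out': "\<forall>u. (\<forall>i<m. u i \<in> carrier R) \<and> (\<forall>l. h0 l \<oplus> conv m u h1 l = \<zero>) \<longrightarrow> (\<forall>j<m. snd \<mu>' 2 j = u j)"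
    unfolding runs_within_def by (elim exE conjE)
  have out: "\<forall>j<m. snd \<mu>' 2 j = u j"
    if "\<forall>i<m. u i \<in> carrier R" "\<forall>l. h0 l \<oplus> conv m u h1 l = \<zero>" for u
    using out' that by simp
  have "\<forall>j<m. snd \<mu>' 2 j = u j"
    if u: "u \<in> {..<m} \<rightarrow>\<^sub>E carrier R" and dist: "hamming_dist N y (enc u) \<le> t" for u
  proof (rule out)
    show uc: "\<forall>i<m. u i \<in> carrier R" using u by auto
    have "{c. c < N \<and> ?y c \<noteq> (w [^] s) [^] c \<otimes> poly_sum m u (pt c)} = {c. c < N \<and> y c \<noteq> enc u c}"
      using uc fourier_encode_apply[OF prim, of _ m u s k] by auto
    then have card: "card {c. c < N \<and> ?y c \<noteq> (w [^] s) [^] c \<otimes> poly_sum m u (pt c)} \<le> t"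
      using dist by (simp add: hamming_dist_def)
    show "\<forall>l. h0 l \<oplus> conv m u h1 l = \<zero>"
    proof
      show "h0 l \<oplus> conv m u h1 l = \<zero>" for l
        by (rule koetter_key_equation[OF K finite_carrier _ inj_pt m_pos m_le _ card t])
          (use uc yN scale_nonzero in simp_all)
    qed
  qed
  moreover have "real \<tau> \<le> 1000 * real N ^ 2"
  proof -
    have "s mod N \<le> N * N" "k mod N \<le> N * N"
      using N_pos by (auto intro!: order_trans[OF less_imp_le[OF mod_less_divisor] le_square])
    \<comment> \<open>The same estimate; here the coefficients of N^2 sum to 786, below the common
      bound 1000.\<close>
    then have "\<tau> \<le> 50 * (N * N) + 14 * (N * N + N * N) + N * (187 * N + 227 * (N + N)) + N * (40 * N + 27 * N)"
      using \<tau> m_le N_pos by (elim order_trans) (intro add_mono mult_mono; simp)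
    also have "\<dots> \<le> 1000 * N ^ 2" by (simp add: power2_eq_square)
    finally have "real \<tau> \<le> real (1000 * N ^ 2)" by (simp only: of_nat_le_iff)
    then show ?thesis by simp
  qed
  ultimately show "\<exists>\<tau> \<mu>'. exec R decode_prog ?\<mu> \<tau> \<mu>' \<and> real \<tau> \<le> 1000 * real N ^ 2 \<and>
      (\<forall>u\<in>{..<m} \<rightarrow>\<^sub>E carrier R. hamming_dist N y (enc u) \<le> t \<longrightarrow> (\<forall>j<m. snd \<mu>' 2 j = u j))"
    using ex by blast
qed

end

section \<open>Finite fields with prescribed roots of unity\<close>

lemma (in field) primitive_root_of_unityI:
  assumes "w \<in> carrier R" and "w [^] N = \<one>" and "\<And>j. w [^] j = \<one> \<Longrightarrow> N dvd j"
  shows "primitive_root_of_unity R N w"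
proof -
  have "w [^] j \<noteq> \<one>" if "1 \<le> j" "j < N" for j
    using assms(3)[of j] that dvd_imp_le[of N j] by auto
  then show ?thesis using assms by (simp add: primitive_root_of_unity_def)
qed

text \<open>By Bezout, with a i = b j + 1, the power x^(a i) is both one and x. Stated for monoids,
  it applies to roots of unity and, in the additive structure, to multiples of one.\<close>

lemma (in monoid) pow_coprime_eq_one:
  assumes "x \<in> carrier G" and "x [^] (i::nat) = \<one>" and "x [^] (j::nat) = \<one>" and "coprime i j"
  shows "x = \<one>"
proof (cases "i = 0")
  case True
  then show ?thesis using assms by simp
next
  case False
  obtain a b where ab: "a * i = b * j + 1"
    using bezout_nat[OF False, of j] assms(4) by (auto simp: mult.commute)
  have "\<one> = (x [^] i) [^] a" using assms by simp
  also have "\<dots> = (x [^] j) [^] b \<otimes> x"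
    using assms(1) ab by (simp add: nat_pow_pow mult.commute[of i] mult.commute[of j] nat_pow_Suc)
  finally show ?thesis using assms by simp
qed

section \<open>Roots of unity in an algebraically closed field\<close>

context algebraically_closed
begin

lemma exists_root_of_degree_pos:
  assumes "p \<in> carrier (poly_ring L)" and "0 < degree p"
  obtains x where "x \<in> carrier L" and "eval p x = \<zero>"
proof -
  have "size (roots p) = degree p"
    using roots_over_carrier[OF assms(1)] by (simp add: splitted_def)
  then obtain x where "x \<in># roots p" using assms(2) by (metis multiset_nonemptyE size_empty less_numeral_extra(3))
  then have "is_root p x" using roots_mem_iff_is_root[OF assms(1)] by simp
  then show ?thesis using that by (auto simp: is_root_def)
qed

lemma exists_nth_root:
  assumes "a \<in> carrier L" and "0 < n"
  obtains x where "x \<in> carrier L" and "x [^] (n::nat) = a"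
proof -
  \<comment> \<open>Coefficient lists start with the leading coefficient, so appending the constant
    term to X^(n-1) makes the list of X^n - a.\<close>
  let ?q = "monom \<one> (n - 1)"
  let ?p = "?q @ [\<ominus> a]"
  have q: "set ?q \<subseteq> carrier L" by (auto simp: monom_def)
  have "?p \<in> carrier (poly_ring L)"
    using assms q unfolding sym[OF univ_poly_carrier] polynomial_def by (simp add: monom_def)
  moreover have "0 < degree ?p" using assms by (simp add: monom_def)
  ultimately obtain x where x: "x \<in> carrier L" "eval ?p x = \<zero>"
    using exists_root_of_degree_pos by blast
  have "eval ?p x = x [^] (n - 1) \<otimes> x \<oplus> \<ominus> a"
    using eval_append_aux[OF q _ x(1), of "\<ominus> a"] eval_monom[OF one_closed x(1), of "n - 1"] assms x by simp
  also have "x [^] (n - 1) \<otimes> x = x [^] n" using assms(2) by (metis Suc_diff_1 nat_pow_Suc)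
  finally have "x [^] n \<oplus> \<ominus> a = \<zero>" using x(2) by simp
  then have "x [^] n = a" using x(1) assms(1) by (metis a_minus_def nat_pow_closed r_right_minus_eq)
  then show ?thesis using that x(1) by blast
qed

text \<open>A root of S = 1 + X + ... + X^(n-1) cannot be one, because S takes there the nonzero
  value n. The identity x S + 1 = S + x^n, a form of the geometric sum without subtraction, then
  gives x^n = 1.\<close>

lemma exists_nontrivial_root_of_unity:
  assumes "1 < n" and nz: "[(n::nat)] \<cdot> \<one> \<noteq> \<zero>"
  obtains x where "x \<in> carrier L" and "x [^] n = \<one>" and "x \<noteq> \<one>"
proof -
  let ?p = "replicate n \<one>"
  have set: "set ?p \<subseteq> carrier L" by auto
  have "?p \<in> carrier (poly_ring L)"
    using assms unfolding sym[OF univ_poly_carrier] polynomial_def by (cases n) auto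
  moreover have "0 < degree ?p" using assms by simp
  ultimately obtain x where x: "x \<in> carrier L" "eval ?p x = \<zero>"
    using exists_root_of_degree_pos by blast
  have ec: "eval (replicate i \<one>) z \<in> carrier L" if "z \<in> carrier L" for i z
    using that by (intro eval_in_carrier) auto
  have geo: "x \<otimes> eval (replicate i \<one>) x \<oplus> \<one> = eval (replicate i \<one>) x \<oplus> x [^] i" for i
  proof (induction i)
    case 0
    then show ?case using x by simp
  next
    case (Suc i)
    have "x \<otimes> eval (replicate (Suc i) \<one>) x \<oplus> \<one> = x [^] Suc i \<oplus> (x \<otimes> eval (replicate i \<one>) x \<oplus> \<one>)"
      using x ec[of x i] by (simp add: r_distr nat_pow_Suc m_comm a_assoc)
    also have "\<dots> = eval (replicate (Suc i) \<one>) x \<oplus> x [^] Suc i"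
      unfolding Suc using x ec[of x i] by (simp add: a_ac)
    finally show ?case .
  qed
  have at1: "eval (replicate i \<one>) \<one> = [i] \<cdot> \<one>" for i
  proof (induction i)
    case (Suc i)
    then show ?case using ec[of \<one> i] by (simp add: a_comm)
  qed simp
  have "x [^] n = \<one>" using geo[of n] x by simp
  moreover have "x \<noteq> \<one>" using at1[of n] nz x by auto
  ultimately show ?thesis using that x(1) by blast
qed

text \<open>If l divides M, an l-th root of w has order l M. Otherwise such a root might still have
  order M, and w is instead multiplied by an element of order l, which is coprime to M.\<close>

lemma primitive_root_of_unity_mult_prime:
  assumes l: "Factorial_Ring.prime (l::nat)" and nz: "[l] \<cdot> \<one> \<noteq> \<zero>" and M: "0 < M"
    and w: "primitive_root_of_unity L M w"
  shows "\<exists>z. primitive_root_of_unity L (l * M) z"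
proof -
  have wc: "w \<in> carrier L" "w [^] M = \<one>" using w by (auto simp: primitive_root_of_unity_def)
  have wd: "M dvd j" if "w [^] j = \<one>" for j using root_of_unity_dvd[OF w M that] .
  show ?thesis
  proof (cases "l dvd M")
    case True
    obtain z where z: "z \<in> carrier L" "z [^] l = w"
      using exists_nth_root[OF wc(1), of l] prime_gt_0_nat[OF l] by blast
    have "primitive_root_of_unity L (l * M) z"
    proof (rule primitive_root_of_unityI[OF z(1)])
      have "z [^] (l * M) = w [^] M" unfolding z(2)[symmetric] using z(1) by (simp add: nat_pow_pow)
      then show "z [^] (l * M) = \<one>" using wc by simp
      fix j :: nat assume j: "z [^] j = \<one>"
      have "w [^] j = (z [^] j) [^] l"
        unfolding z(2)[symmetric] using z(1) by (simp add: nat_pow_pow mult.commute)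
      then have "M dvd j" using j by (intro wd) simp
      \<comment> \<open>Divisibility by M is used twice: here it makes j a multiple l i, since l
        divides M, and then w^i = z^j = 1 yields M dvd i.\<close>
      then have "l dvd j" using True by (rule dvd_trans[rotated])
      then obtain i where i: "j = l * i" by auto
      have "w [^] i = z [^] j" unfolding i z(2)[symmetric] using z(1) by (simp add: nat_pow_pow)
      then have "M dvd i" using j by (intro wd) simp
      then show "l * M dvd j" using i by simp
    qed
    then show ?thesis by blast
  next
    case False
    then have cop: "coprime l M" using l by (simp add: prime_imp_coprime)
    obtain y where y: "y \<in> carrier L" "y [^] l = \<one>" "y \<noteq> \<one>"
      using exists_nontrivial_root_of_unity[OF prime_gt_1_nat[OF l] nz] by blast
    have "primitive_root_of_unity L (l * M) (w \<otimes> y)"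
    proof (rule primitive_root_of_unityI)
      show "w \<otimes> y \<in> carrier L" using wc y by simp
      have "(w \<otimes> y) [^] (l * M) = (w [^] M) [^] l \<otimes> (y [^] l) [^] M"
        using wc(1) y(1) by (simp add: nat_pow_distrib nat_pow_pow mult.commute)
      then show "(w \<otimes> y) [^] (l * M) = \<one>" using wc y by simp
      fix j :: nat assume j: "(w \<otimes> y) [^] j = \<one>"
      \<comment> \<open>Raising to the l-th power removes y, so M divides j l and, by coprimality,
        j. The factor w then drops out, leaving y^j = 1.\<close>
      have "w [^] (j * l) = (w [^] j) [^] l \<otimes> (y [^] l) [^] j" using wc y by (simp add: nat_pow_pow)
      also have "\<dots> = ((w \<otimes> y) [^] j) [^] l"
        using wc(1) y(1) by (simp add: nat_pow_distrib nat_pow_pow mult.commute)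
      finally have "w [^] (j * l) = \<one>" using j by simp
      then have "M dvd j * l" by (rule wd)
      moreover have "coprime M l" using cop by (subst coprime_commute)
      ultimately have Mj: "M dvd j" by (simp add: coprime_dvd_mult_left_iff)
      then obtain i where "j = M * i" by auto
      then have "w [^] j = (w [^] M) [^] i" using wc(1) by (simp add: nat_pow_pow)
      then have "w [^] j = \<one>" using wc(2) by simp
      then have "y [^] j = \<one>" using j wc y by (simp add: nat_pow_distrib)
      then have "l dvd j"
        using pow_coprime_eq_one[OF y(1,2), of j] y(3) prime_imp_coprime[OF l, of j] by auto
      then show "l * M dvd j" using Mj by (rule semiring_gcd_class.divides_mult[OF _ _ cop])
    qed
    then show ?thesis by blast
  qed
qed

end

lemma (in domain) multiple_of_one_nonzero:
  assumes p: "[p] \<cdot> \<one> = \<zero>" and "coprime p (q::nat)"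
  shows "[q] \<cdot> \<one> \<noteq> \<zero>"
  using add.pow_coprime_eq_one[of \<one> p q] assms by auto

lemma (in algebraically_closed) exists_primitive_root_of_unity:
  assumes p: "Factorial_Ring.prime (p::nat)" "[p] \<cdot> \<one> = \<zero>" and "0 < N" and "\<not> p dvd N"
  shows "\<exists>w. primitive_root_of_unity L N w"
  using assms(3,4)
proof (induction N rule: less_induct)
  case (less N)
  show ?case
  proof (cases "N = 1")
    case True
    then show ?thesis by (auto simp: primitive_root_of_unity_def intro!: exI[of _ \<one>])
  next
    case False
    then obtain l where l: "Factorial_Ring.prime l" "l dvd N" using prime_factor_nat by blast
    then obtain M where M: "N = l * M" by auto
    have "0 < M" "M < N" "\<not> p dvd M" using less.prems l M prime_gt_1_nat[OF l(1)] by auto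
    then obtain w where w: "primitive_root_of_unity L M w" using less.IH by blast
    have "p \<noteq> l" using l less.prems by auto
    then have "coprime p l" using p l by (simp add: primes_coprime)
    then have "[l] \<cdot> \<one> \<noteq> \<zero>" using multiple_of_one_nonzero[OF p(2)] by simp
    then show ?thesis
      using primitive_root_of_unity_mult_prime[OF l(1) _ \<open>0 < M\<close> w] M by simp
  qed
qed

section \<open>Finite fields of given characteristic, realised on the natural numbers\<close>

lemma (in field) ring_char_eq:
  assumes "Factorial_Ring.prime (p::nat)" and "[p] \<cdot> \<one> = \<zero>"
  shows "ring_char R = p"
proof -
  have "(LEAST q::nat. 0 < q \<and> [q] \<cdot> \<one> = \<zero>) = p"
  proof (rule Least_equality)
    fix q :: nat assume q: "0 < q \<and> [q] \<cdot> \<one> = \<zero>"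
    then have "\<not> coprime p q" using multiple_of_one_nonzero[OF assms(2)] by blast
    then show "p \<le> q" using assms(1) q by (meson dvd_imp_le prime_imp_coprime)
  qed (use assms prime_gt_0_nat in auto)
  then show ?thesis using assms prime_gt_0_nat unfolding ring_char_def by auto
qed

text \<open>As w^(n+1) = 1, powers of w can be reduced to exponents up to n, so elements are named
  by n + 1 coefficients from the finite set K.\<close>

lemma (in field) finite_simple_extension:
  assumes K: "subfield K R" "finite K" and w: "w \<in> carrier R" "w [^] Suc n = \<one>"
  shows "finite (simple_extension K w)"
proof -
  let ?T = "(\<lambda>c. poly_sum (Suc n) c w) ` ({..<Suc n} \<rightarrow>\<^sub>E K)"
  have KR: "K \<subseteq> carrier R" and K0: "\<zero> \<in> K" and Kadd: "\<And>a b. a \<in> K \<Longrightarrow> b \<in> K \<Longrightarrow> a \<oplus> b \<in> K"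
    using subfieldE(1)[OF K(1)] subringE by (auto dest: subringE(1) subringE(2) subringE(7))
  have "\<exists>c. (\<forall>l. c l \<in> K) \<and> x = poly_sum (Suc n) c w" if "x \<in> simple_extension K w" for x
    using that
  proof (induction rule: simple_extension.induct)
    case zero
    have "poly_sum (Suc n) (\<lambda>_. \<zero>) w = \<zero>"
      unfolding poly_sum_def using w by (intro add.finprod_one_eqI) auto
    then show ?case using K0 by (metis (full_types))
  next
    case (lin k1 k2)
    then obtain c where c: "\<And>l. c l \<in> K" and k1: "k1 = poly_sum (Suc n) c w" by blast
    have cR [simp]: "c l \<in> carrier R" "k2 \<in> carrier R" for l using c KR lin by auto
    \<comment> \<open>A Horner step k1 w + k2 rotates the coefficients: the top one returns as
      constant term because w^(n+1) = 1, and k2 is added to it.\<close>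
    let ?d = "\<lambda>l. if l = 0 then c n \<oplus> k2 else \<zero>"
    let ?c = "\<lambda>l. xmul c l \<oplus> ?d l"
    have pc: "poly_sum (Suc n) (xmul c) w \<in> carrier R" using w by (intro poly_sum_closed) auto
    have dd: "poly_sum (Suc n) ?d w = c n \<oplus> k2"
    proof -
      have "poly_sum (Suc n) ?d w = poly_sum 1 ?d w" using w by (intro poly_sum_extend) auto
      then show ?thesis using w by (simp add: poly_sum_Suc)
    qed
    have "k1 \<otimes> w \<oplus> k2 = poly_sum (Suc (Suc n)) (xmul c) w \<oplus> k2"
      unfolding k1 using w by (subst poly_sum_xmul_Suc) (auto simp: m_comm)
    also have "poly_sum (Suc (Suc n)) (xmul c) w = poly_sum (Suc n) (xmul c) w \<oplus> c n"
      using w by (subst poly_sum_Suc) auto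
    also have "poly_sum (Suc n) (xmul c) w \<oplus> c n \<oplus> k2 = poly_sum (Suc n) (xmul c) w \<oplus> poly_sum (Suc n) ?d w"
      using pc by (simp add: dd a_assoc)
    also have "\<dots> = poly_sum (Suc n) ?c w" using w by (intro poly_sum_add[symmetric]) auto
    finally have "k1 \<otimes> w \<oplus> k2 = poly_sum (Suc n) ?c w" .
    moreover have "?c l \<in> K" for l using c lin K0 Kadd by (cases l) auto
    ultimately show ?case by (intro exI[of _ ?c] conjI allI)
  qed
  then have "simple_extension K w \<subseteq> ?T"
  proof (intro subsetI)
    fix x assume "x \<in> simple_extension K w"
    then obtain c where c: "\<And>l. c l \<in> K" and x: "x = poly_sum (Suc n) c w"
      using \<open>\<And>x. x \<in> simple_extension K w \<Longrightarrow> \<exists>c. (\<forall>l. c l \<in> K) \<and> x = poly_sum (Suc n) c w\<close> by blast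
    have "poly_sum (Suc n) (restrict c {..<Suc n}) w = x"
      unfolding x using c KR w by (intro poly_sum_cong) auto
    then show "x \<in> ?T" using c by (intro image_eqI[of _ _ "restrict c {..<Suc n}"]) auto
  qed
  moreover have "finite ?T" using K(2) by (intro finite_imageI finite_PiE) auto
  ultimately show ?thesis by (rule finite_subset)
qed

lemma ring_hom_pow:
  assumes "h \<in> ring_hom R S" and "monoid R" and "x \<in> carrier R"
  shows "h (x [^]\<^bsub>R\<^esub> (n::nat)) = h x [^]\<^bsub>S\<^esub> n"
proof -
  interpret monoid R by fact
  show ?thesis
  proof (induction n)
    case 0
    then show ?case using ring_hom_one[OF assms(1)] by (simp add: nat_pow_def)
  next
    case (Suc n)
    then show ?case using ring_hom_mult[OF assms(1), of "x [^]\<^bsub>R\<^esub> n" x] assms(3)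
        nat_pow_closed[OF assms(3), of n] by (simp add: nat_pow_def)
  qed
qed

lemma ring_hom_multiple_of_one:
  assumes "h \<in> ring_hom R S" and "ring R" and "ring S"
  shows "h ([(n::nat)] \<cdot>\<^bsub>R\<^esub> \<one>\<^bsub>R\<^esub>) = [n] \<cdot>\<^bsub>S\<^esub> \<one>\<^bsub>S\<^esub>"
proof -
  interpret ring_hom_ring R S h using assms by (simp add: ring_hom_ringI2)
  show ?thesis by (induction n) auto
qed

lemma exists_finite_field_with_root_of_unity:
  assumes p: "Factorial_Ring.prime (p::nat)" and N: "0 < N" "\<not> p dvd N"
  shows "\<exists>(F :: nat ring) w. field F \<and> finite (carrier F) \<and> ring_char F = p \<and> primitive_root_of_unity F N w"
proof -
  interpret Z: residues_prime p "residue_ring (int p)" by unfold_locales (rule p)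
  let ?L = "Z.alg_closure"
  let ?K = "Z.indexed_const ` carrier (residue_ring (int p))"
  interpret L: algebraic_closure ?L ?K by (rule Z.alg_closureE)
  have hom: "Z.indexed_const \<in> ring_hom (residue_ring (int p)) ?L" by (rule Z.alg_closureE)
  have Zn: "[n] \<cdot>\<^bsub>residue_ring (int p)\<^esub> \<one>\<^bsub>residue_ring (int p)\<^esub> = int n mod int p" for n
    by (induction n) (simp_all add: Z.res_zero_eq Z.res_one_eq Z.res_add_eq mod_simps add.commute)
  have "[p] \<cdot>\<^bsub>?L\<^esub> \<one>\<^bsub>?L\<^esub> = Z.indexed_const \<zero>\<^bsub>residue_ring (int p)\<^esub>"
    using ring_hom_multiple_of_one[OF hom Z.ring_axioms L.ring_axioms, of p] Zn[of p]
    by (simp add: Z.res_zero_eq)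
  then have char: "[p] \<cdot>\<^bsub>?L\<^esub> \<one>\<^bsub>?L\<^esub> = \<zero>\<^bsub>?L\<^esub>"
    using ring_hom_zero[OF hom Z.ring_axioms L.ring_axioms] by simp
  obtain w where w: "primitive_root_of_unity ?L N w"
    using L.exists_primitive_root_of_unity[OF p char N] by blast
  then have wc: "w \<in> carrier ?L" "w [^]\<^bsub>?L\<^esub> N = \<one>\<^bsub>?L\<^esub>" by (auto simp: primitive_root_of_unity_def)
  let ?S = "L.simple_extension ?K w"
  have K: "subfield ?K ?L" by (rule L.subfield_axioms)
  have finK: "finite ?K" by (simp add: Z.finite)
  have S: "subfield ?S ?L"
    using L.simple_extension_is_subfield[OF K wc(1)] L.algebraic_extension[OF wc(1)] by simp
  have finS: "finite ?S"
    using L.finite_simple_extension[OF K finK wc(1), of "N - 1"] wc(2) N by simp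
  have wS: "w \<in> ?S"
    using L.simple_extension_mem[OF subfieldE(1)[OF K] wc(1)] .
  let ?F = "?L\<lparr>carrier := ?S\<rparr>"
  interpret F: field ?F by (rule L.subfield_iff(2)[OF S])
  \<comment> \<open>The algebraic closure has its own element type, whereas a ring over
    \<open>nat\<close> is wanted. Being finite, the subfield injects into \<open>nat\<close>, and
    \<open>image_ring\<close> carries its operations along.\<close>
  obtain f :: "_ \<Rightarrow> nat" where f: "inj_on f ?S" using finite_imp_inj_to_nat_seg[OF finS] by blast
  let ?G = "image_ring f ?F"
  have G: "field ?G" using F.inj_imp_image_ring_is_field[of f] f by simp
  interpret G: field ?G by (rule G)
  have fh: "f \<in> ring_hom ?F ?G"
    using inj_imp_image_ring_iso[of f ?F] f by (simp add: ring_iso_def)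
  have finG: "finite (carrier ?G)" using finS by (simp add: image_ring_carrier)
  have powF: "x [^]\<^bsub>?F\<^esub> (j::nat) = x [^]\<^bsub>?L\<^esub> j" for x j by (simp add: nat_pow_def)
  have "[j] \<cdot>\<^bsub>?F\<^esub> \<one>\<^bsub>?F\<^esub> = [j] \<cdot>\<^bsub>?L\<^esub> \<one>\<^bsub>?L\<^esub>" for j :: nat by (simp add: add_pow_def nat_pow_def)
  then have "[p] \<cdot>\<^bsub>?G\<^esub> \<one>\<^bsub>?G\<^esub> = f \<zero>\<^bsub>?F\<^esub>"
    using ring_hom_multiple_of_one[OF fh F.ring_axioms G.ring_axioms, of p] char by simp
  then have "[p] \<cdot>\<^bsub>?G\<^esub> \<one>\<^bsub>?G\<^esub> = \<zero>\<^bsub>?G\<^esub>"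
    using ring_hom_zero[OF fh F.ring_axioms G.ring_axioms] by simp
  then have charG: "ring_char ?G = p" by (rule G.ring_char_eq[OF p])
  have fpow: "f w [^]\<^bsub>?G\<^esub> (j::nat) = f (w [^]\<^bsub>?L\<^esub> j)" for j
    using ring_hom_pow[OF fh F.monoid_axioms, of w j] wS powF by simp
  have wSj: "w [^]\<^bsub>?L\<^esub> (j::nat) \<in> ?S" for j using F.nat_pow_closed[of w j] wS powF by simp
  have one: "\<one>\<^bsub>?G\<^esub> = f \<one>\<^bsub>?L\<^esub>" by (simp add: image_ring_one)
  have "f w [^]\<^bsub>?G\<^esub> j = \<one>\<^bsub>?G\<^esub> \<longleftrightarrow> w [^]\<^bsub>?L\<^esub> j = \<one>\<^bsub>?L\<^esub>" for j :: nat
    unfolding fpow one using inj_on_eq_iff[OF f wSj] F.one_closed by simp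
  then have "primitive_root_of_unity ?G N (f w)"
    using w wS unfolding primitive_root_of_unity_def by (simp add: image_ring_carrier)
  then show ?thesis using G finG charG by blast
qed

section \<open>From a single code to the series\<close>

lemma fourier_data_rows:
  assumes "fourier_data F N w k" and "0 < m" and "m \<le> N"
  shows "fourier_rows F N m w k"
  using assms
  by (auto simp: fourier_data_def fourier_rows_def fourier_rows_axioms_def coprime_iff_gcd_eq_1)

lemma encodes_within_mono:
  "encodes_within F N m w s k enc T \<Longrightarrow> T \<le> T' \<Longrightarrow> encodes_within F N m w s k enc T'"
  unfolding encodes_within_def by (meson order_trans)

lemma decodes_within_mono:
  "decodes_within F N m w s k t dec T \<Longrightarrow> T \<le> T' \<Longrightarrow> decodes_within F N m w s k t dec T'"
  unfolding decodes_within_def by (meson order_trans)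

text \<open>As the rate is fixed, $t$ is proportional to $i$ once $i \ge 2$, so $t^2$ dominates $N^2$; for $i = 1$
  it may happen that $t = 0$, and the term $N \log_2 N$ takes over.\<close>

lemma quadratic_bound:
  fixes i n r :: nat
  assumes "0 < r" and "r < n" and "0 < i"
  shows "1000 * real (i * n) ^ 2 \<le> 9000 * real n ^ 2 *
    max (real (i * n) * log 2 (real (i * n))) (real ((i * n - i * r) div 2) ^ 2)"
proof (cases "i = 1")
  case True
  \<comment> \<open>Here the length is n itself, and 0 < r < n makes it at least 2, so N log N is at
    least 1.\<close>
  have "log 2 2 \<le> log 2 (real n)" using assms by (intro log_mono) auto
  then have "1 * 1 \<le> real n * log 2 (real n)" using assms by (intro mult_mono) auto
  then have "1 \<le> max (real (i * n) * log 2 (real (i * n))) (real ((i * n - i * r) div 2) ^ 2)"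
    using True by simp
  then have "1000 * real n ^ 2 * 1 \<le> 9000 * real n ^ 2 *
      max (real (i * n) * log 2 (real (i * n))) (real ((i * n - i * r) div 2) ^ 2)"
    by (intro mult_mono) auto
  then show ?thesis using True by simp
next
  case False
  have "i * 1 \<le> i * (n - r)" using assms by (intro mult_left_mono) auto
  then have "i \<le> i * n - i * r" by (simp add: diff_mult_distrib2)
  \<comment> \<open>For every natural number x \<ge> 2 one has x \<le> 3 * (x div 2), with equality
    at x = 3. Squaring the 3 turns the factor 1000 into 9000.\<close>
  then have "i \<le> 3 * ((i * n - i * r) div 2)" using False assms(3) by linarith
  then have "real i \<le> 3 * real ((i * n - i * r) div 2)" by linarith
  then have "real i ^ 2 \<le> (3 * real ((i * n - i * r) div 2)) ^ 2" by (intro power_mono) auto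
  also have "\<dots> \<le> 9 * max (real (i * n) * log 2 (real (i * n))) (real ((i * n - i * r) div 2) ^ 2)"
    by (simp add: power_mult_distrib)
  finally have "1000 * real n ^ 2 * real i ^ 2 \<le> 1000 * real n ^ 2 *
      (9 * max (real (i * n) * log 2 (real (i * n))) (real ((i * n - i * r) div 2) ^ 2))"
    by (intro mult_left_mono) auto
  then show ?thesis by (simp add: power_mult_distrib mult_ac)
qed

theorem mainTheorem4:
  fixes r n :: nat and R :: real and I :: "nat set"
  assumes "0 < r" and "r < n" and "R = real r / real n"
    and "infinite I" and "\<forall>i\<in>I. 0 < i"
  shows
    "(\<forall>i\<in>I. \<forall>p::nat. Factorial_Ring.prime p \<and> \<not> p dvd i * n \<longrightarrow>
        (\<exists>(F :: nat ring) \<omega>. field F \<and> finite (carrier F) \<and> ring_char F = p \<and>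
           primitive_root_of_unity F (i * n) \<omega>)) \<and>
     (\<exists>(F :: nat \<Rightarrow> nat ring) \<omega> k. \<forall>i\<in>I. fourier_data (F i) (i * n) (\<omega> i) (k i)) \<and>
     (\<forall>(F :: nat \<Rightarrow> 'a ring) \<omega> s k.
        (\<forall>i\<in>I. fourier_data (F i) (i * n) (\<omega> i) (k i)) \<longrightarrow>
        (let C = (\<lambda>i. fourier_code (F i) (i * n) (i * r) (\<omega> i) (s i) (k i));
             d = (\<lambda>i. code_distance (F i) (i * n) (C i))
         in (\<forall>i\<in>I. mds_code (F i) (i * n) (i * r) (C i) \<and>
                code_rate (F i) (i * n) (C i) = real (i * r) / real (i * n) \<and>
                real (i * r) / real (i * n) = R \<and>
                d i = i * n - i * r + 1 \<and>
                real (d i) / real (i * n) = (real (i * n) - real (i * r) + 1) / real (i * n) \<and>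
                (real (i * n) - real (i * r) + 1) / real (i * n) = 1 - R + 1 / real (i * n)) \<and>
            ((\<lambda>i. real (d i) / real (i * n)) \<longlongrightarrow> 1 - R) (inf at_top (principal I)))) \<and>
     (\<exists>enc dec. \<exists>c::real. \<forall>i\<in>I. \<forall>(F :: 'a ring) \<omega> s k.
        fourier_data F (i * n) \<omega> k \<longrightarrow>
        (let N = i * n; m = i * r;
             t = (code_distance F N (fourier_code F N m \<omega> s k) - 1) div 2;
             T = c * max (real N * log 2 (real N)) (real t ^ 2)
         in encodes_within F N m \<omega> s k enc T \<and> decodes_within F N m \<omega> s k t dec T))"
proof (intro conjI)
  have N0: "0 < i * n" "0 < i * r" "i * r \<le> i * n" if "i \<in> I" for i
    using assms that by auto
  show ex: "\<forall>i\<in>I. \<forall>p::nat. Factorial_Ring.prime p \<and> \<not> p dvd i * n \<longrightarrow>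
        (\<exists>(F :: nat ring) \<omega>. field F \<and> finite (carrier F) \<and> ring_char F = p \<and>
           primitive_root_of_unity F (i * n) \<omega>)"
    using exists_finite_field_with_root_of_unity N0 by blast
  show "\<exists>(F :: nat \<Rightarrow> nat ring) \<omega> k. \<forall>i\<in>I. fourier_data (F i) (i * n) (\<omega> i) (k i)"
  proof -
    have "\<exists>Fw :: nat ring \<times> nat. fourier_data (fst Fw) (i * n) (snd Fw) 1" if i: "i \<in> I" for i
    proof -
      \<comment> \<open>Any prime above the length will do as characteristic, and the difference k =
        1, meaning consecutive rows, is always admissible.\<close>
      obtain p :: nat where p: "Factorial_Ring.prime p" "i * n < p" using bigger_prime by blast
      then have "\<not> p dvd i * n" using N0[OF i] by (meson dvd_imp_le not_le)
      then obtain F :: "nat ring" and w where "field F" "finite (carrier F)" "primitive_root_of_unity F (i * n) w"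
        using ex i p(1) by blast
      then have "fourier_data F (i * n) w 1" by (simp add: fourier_data_def)
      then show ?thesis by (intro exI[of _ "(F, w)"]) simp
    qed
    then obtain Fw :: "nat \<Rightarrow> nat ring \<times> nat" where "\<forall>i\<in>I. fourier_data (fst (Fw i)) (i * n) (snd (Fw i)) 1"
      by metis
    then show ?thesis
      by (intro exI[of _ "\<lambda>i. fst (Fw i)"] exI[of _ "\<lambda>i. snd (Fw i)"] exI[of _ "\<lambda>_. 1"])
  qed
  show "\<forall>(F :: nat \<Rightarrow> 'a ring) \<omega> s k.
        (\<forall>i\<in>I. fourier_data (F i) (i * n) (\<omega> i) (k i)) \<longrightarrow>
        (let C = (\<lambda>i. fourier_code (F i) (i * n) (i * r) (\<omega> i) (s i) (k i));
             d = (\<lambda>i. code_distance (F i) (i * n) (C i))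
         in (\<forall>i\<in>I. mds_code (F i) (i * n) (i * r) (C i) \<and>
                code_rate (F i) (i * n) (C i) = real (i * r) / real (i * n) \<and>
                real (i * r) / real (i * n) = R \<and>
                d i = i * n - i * r + 1 \<and>
                real (d i) / real (i * n) = (real (i * n) - real (i * r) + 1) / real (i * n) \<and>
                (real (i * n) - real (i * r) + 1) / real (i * n) = 1 - R + 1 / real (i * n)) \<and>
            ((\<lambda>i. real (d i) / real (i * n)) \<longlongrightarrow> 1 - R) (inf at_top (principal I)))"
  proof (intro allI impI)
    fix F :: "nat \<Rightarrow> 'a ring" and w s k
    assume F: "\<forall>i\<in>I. fourier_data (F i) (i * n) (w i) (k i)"
    define C where "C = (\<lambda>i. fourier_code (F i) (i * n) (i * r) (w i) (s i) (k i))"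
    define d where "d = (\<lambda>i. code_distance (F i) (i * n) (C i))"
    have main: "mds_code (F i) (i * n) (i * r) (C i) \<and>
        code_rate (F i) (i * n) (C i) = real (i * r) / real (i * n) \<and>
        real (i * r) / real (i * n) = R \<and> d i = i * n - i * r + 1 \<and>
        real (d i) / real (i * n) = (real (i * n) - real (i * r) + 1) / real (i * n) \<and>
        (real (i * n) - real (i * r) + 1) / real (i * n) = 1 - R + 1 / real (i * n)" if i: "i \<in> I" for i
    proof -
      interpret fourier_rows "F i" "i * n" "i * r" "w i" "s i" "k i"
        using F i by (intro fourier_data_rows[OF _ N0(2,3)[OF i]]) blast
      have d: "d i = i * n - i * r + 1" using distance by (simp add: d_def C_def)
      have i0: "0 < real i" "0 < real n" using assms i by auto
      have "mds_code (F i) (i * n) (i * r) (C i)" unfolding C_def by (rule mds)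
      moreover have "code_dim (F i) (i * n) (C i) = i * r"
        using linear_code by (simp add: C_def linear_code_def)
      moreover have "real (d i) = real (i * n) - real (i * r) + 1"
        using d N0[OF i] by (simp add: of_nat_diff)
      moreover have "real (i * r) / real (i * n) = R" using i0 assms(3) by simp
      moreover have "(real (i * n) - real (i * r) + 1) / real (i * n) = 1 - R + 1 / real (i * n)"
        using i0 assms(3) by (simp add: field_simps)
      ultimately show ?thesis using d by (simp only: code_rate_def)
    qed
    from main have main': "\<forall>i\<in>I. mds_code (F i) (i * n) (i * r) (C i) \<and>
        code_rate (F i) (i * n) (C i) = real (i * r) / real (i * n) \<and>
        real (i * r) / real (i * n) = R \<and> d i = i * n - i * r + 1 \<and>
        real (d i) / real (i * n) = (real (i * n) - real (i * r) + 1) / real (i * n) \<and>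
        (real (i * n) - real (i * r) + 1) / real (i * n) = 1 - R + 1 / real (i * n)"
      by (rule ballI)
    have "(\<lambda>i. 1 - R + 1 / real (i * n)) \<longlonglongrightarrow> 1 - R + 0"
    proof (intro tendsto_add tendsto_const)
      have "(\<lambda>i. inverse (real n) * (1 / real i)) \<longlonglongrightarrow> inverse (real n) * 0"
        by (intro tendsto_mult tendsto_const lim_1_over_n)
      then show "(\<lambda>i. 1 / real (i * n)) \<longlonglongrightarrow> 0" by (simp add: field_simps)
    qed
    \<comment> \<open>The filter restricts \<open>i\<close> to I and refines \<open>at_top\<close>,
      so the limit over all naturals carries over. The explicit sequence is treated first because
      d_i is known only for i in I.\<close>
    then have lim: "((\<lambda>i. 1 - R + 1 / real (i * n)) \<longlongrightarrow> 1 - R) (inf at_top (principal I))"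
      by (simp add: tendsto_mono[OF inf_le1])
    have "((\<lambda>i. real (d i) / real (i * n)) \<longlongrightarrow> 1 - R) (inf at_top (principal I))"
    proof (rule Lim_transform_eventually[OF lim])
      show "\<forall>\<^sub>F i in inf at_top (principal I). 1 - R + 1 / real (i * n) = real (d i) / real (i * n)"
        unfolding eventually_inf_principal using main by (intro always_eventually) metis
    qed
    then show "let C = (\<lambda>i. fourier_code (F i) (i * n) (i * r) (w i) (s i) (k i));
             d = (\<lambda>i. code_distance (F i) (i * n) (C i))
         in (\<forall>i\<in>I. mds_code (F i) (i * n) (i * r) (C i) \<and>
                code_rate (F i) (i * n) (C i) = real (i * r) / real (i * n) \<and>
                real (i * r) / real (i * n) = R \<and>
                d i = i * n - i * r + 1 \<and>
                real (d i) / real (i * n) = (real (i * n) - real (i * r) + 1) / real (i * n) \<and>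
                (real (i * n) - real (i * r) + 1) / real (i * n) = 1 - R + 1 / real (i * n)) \<and>
            ((\<lambda>i. real (d i) / real (i * n)) \<longlongrightarrow> 1 - R) (inf at_top (principal I))"
      using main' unfolding Let_def d_def C_def by (intro conjI)
  qed
  show "\<exists>enc dec. \<exists>c::real. \<forall>i\<in>I. \<forall>(F :: 'a ring) \<omega> s k.
        fourier_data F (i * n) \<omega> k \<longrightarrow>
        (let N = i * n; m = i * r;
             t = (code_distance F N (fourier_code F N m \<omega> s k) - 1) div 2;
             T = c * max (real N * log 2 (real N)) (real t ^ 2)
         in encodes_within F N m \<omega> s k enc T \<and> decodes_within F N m \<omega> s k t dec T)"
  proof (rule exI[of _ encode_prog], rule exI[of _ decode_prog], rule exI[of _ "9000 * real n ^ 2"],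
      intro ballI allI impI)
    fix i and F :: "'a ring" and w s k
    assume i: "i \<in> I" and F: "fourier_data F (i * n) w k"
    interpret fourier_rows F "i * n" "i * r" w s k
      by (rule fourier_data_rows[OF F N0(2,3)[OF i]])
    let ?t = "(i * n - i * r) div 2"
    \<comment> \<open>The factor depends only on n, which is fixed throughout the series; neither
      \<open>i\<close> nor the field enters it.\<close>
    let ?T = "9000 * real n ^ 2 * max (real (i * n) * log 2 (real (i * n))) (real ?t ^ 2)"
    have le: "1000 * real (i * n) ^ 2 \<le> ?T" 
      by (rule quadratic_bound[OF assms(1,2)]) (use assms(5) i in blast)
    have "encodes_within F (i * n) (i * r) w s k encode_prog ?T"
      by (rule encodes_within_mono[OF encodes le])
    moreover have "decodes_within F (i * n) (i * r) w s k ?t decode_prog ?T"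
      by (rule decodes_within_mono[OF decodes le]) simp
    ultimately show "let N = i * n; m = i * r;
             t = (code_distance F N (fourier_code F N m w s k) - 1) div 2;
             T = 9000 * real n ^ 2 * max (real N * log 2 (real N)) (real t ^ 2)
         in encodes_within F N m w s k encode_prog T \<and> decodes_within F N m w s k t decode_prog T"
      unfolding Let_def distance by simp
  qed
qed

end
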